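(* Let $F_I^\circ$ be a (nonempty) open face of dimension $m$ that is accessible for the sum interaction $g_\Sigma$. Then $$\dim_H\bigl(F_I^\circ,d_{\partial,\Sigma}\bigr)=\frac{m}{1-\frac{M_I}{2}} .$$
   Context: Let $X$ be a compact smooth $n$-dimensional manifold with corners (locally modelled on $[0,\infty)^k\times\mathbb R^{n-k}$, $0\le k\le n$) whose boundary hypersurfaces $H_1,\dots,H_N$ are globally embedded, and let $X^\circ=X\setminus\partial X$. For each $i$ let $\rho_i:X\to[0,\infty)$ be a smooth boundary-defining function of $H_i$: $H_i=\rho_i^{-1}(0)$, $d\rho_i\neq0$ on $H_i$, and $\rho_i>0$ on $X\setminus H_i$. Let $g_0$ be a smooth Riemannian metric on $X$ (up to the boundary), and let $\alpha_1,\dots,\alpha_N\ge 0$. On $X^\circ$ put $g_\Sigma=\bigl(\sum_{i=1}^N\rho_i^{-\alpha_i}\bigr)g_0$, with Riemannian distance $d_{g_\Sigma}$. For $p\in X$, $I(p)=\{i: p\in H_i\}$; for nonempty $I\subseteq\{1,\dots,N\}$, the open face is $F_I^\circ=\{p\in X: I(p)=I\}$, a smooth manifold without boundary of codimension $|I|$ when nonempty, and $M_I=\max_{i\in I}\alpha_i$. A point $p\in\partial X$ is accessible for $g_\Sigma$ if there is a $d_{g_\Sigma}$-Cauchy sequence in $X^\circ$ converging to $p$ in the topology of $X$; an open face is accessible if all its points are; for a nonempty open face this is equivalent to $M_I<2$. For $z$ in an accessible open face, all sequences in $X^\circ$ converging to $z$ in the topology of $X$ are $d_{g_\Sigma}$-Cauchy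 and equivalent; $\overline z$ denotes the resulting point of the metric completion of $(X^\circ,d_{g_\Sigma})$. The induced boundary distance $d_{\partial,\Sigma}(z,z')$ is the distance in that completion between $\overline z$ and $\overline{z'}$. $\dim_H$ denotes Hausdorff dimension. *)

theory Defs
  imports "HOL-Analysis.Analysis"
begin

section \<open>Smooth maps on arbitrary subsets of a Euclidean space\<close>

primrec Ck_on :: "nat \<Rightarrow> 'e::euclidean_space set \<Rightarrow> ('e \<Rightarrow> 'f::real_normed_vector) \<Rightarrow> bool" where
  "Ck_on 0 U f \<longleftrightarrow> continuous_on U f"
| "Ck_on (Suc k) U f \<longleftrightarrow>
     (\<forall>x\<in>U. f differentiable (at x)) \<and> (\<forall>v. Ck_on k U (\<lambda>x. frechet_derivative f (at x) v))"

text \<open>On a set that is not open, smoothness means that there are local smooth extensions.\<close>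

definition smooth_on :: "'e::euclidean_space set \<Rightarrow> ('e \<Rightarrow> 'f::real_normed_vector) \<Rightarrow> bool" where
  "smooth_on S f \<longleftrightarrow>
     (\<forall>x\<in>S. \<exists>U F. open U \<and> x \<in> U \<and> (\<forall>k. Ck_on k U F) \<and> (\<forall>y\<in>S \<inter> U. F y = f y))"


section \<open>Compact manifolds with corners\<close>

text \<open>
  The model $[0,\infty)^k \times \mathbb{R}^{n-k}$ is the set of points of an \<open>n\<close>-dimensional
  Euclidean space whose coordinates in the directions \<open>B\<close> (a set of \<open>k\<close> basis vectors)
  are nonnegative. A chart records this set of directions as \<open>walls\<close>; the values of
  \<open>coord\<close> outside \<open>chart_dom\<close> are irrelevant.
\<close>

definition corner_model :: "'e::euclidean_space set \<Rightarrow> 'e set" where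
  "corner_model B = {x. \<forall>b\<in>B. 0 \<le> x \<bullet> b}"

datatype ('a, 'e) corner_chart =
  Corner_Chart (chart_dom: "'a set") (coord: "'a \<Rightarrow> 'e") (walls: "'e set")

definition chart_inv :: "('a, 'e) corner_chart \<Rightarrow> 'e \<Rightarrow> 'a" where
  "chart_inv c = inv_into (chart_dom c) (coord c)"

definition is_corner_chart ::
    "'a::topological_space set \<Rightarrow> ('a, 'e::euclidean_space) corner_chart \<Rightarrow> bool" where
  "is_corner_chart X c \<longleftrightarrow>
     openin (top_of_set X) (chart_dom c) \<and>
     walls c \<subseteq> Basis \<and>
     openin (top_of_set (corner_model (walls c))) (coord c ` chart_dom c) \<and>
     (\<exists>\<psi>. homeomorphism (chart_dom c) (coord c ` chart_dom c) (coord c) \<psi>)"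

text \<open>Atlases are not required to be maximal.\<close>

definition smooth_corner_atlas ::
    "'a::topological_space set \<Rightarrow> ('a, 'e::euclidean_space) corner_chart set \<Rightarrow> bool" where
  "smooth_corner_atlas X A \<longleftrightarrow>
     (\<forall>c\<in>A. is_corner_chart X c) \<and>
     X = (\<Union>c\<in>A. chart_dom c) \<and>
     (\<forall>c\<in>A. \<forall>c'\<in>A.
        smooth_on (coord c ` (chart_dom c \<inter> chart_dom c')) (coord c' \<circ> chart_inv c))"

text \<open>The ambient type provides the Hausdorff property; with compactness and the existence of
  charts this yields second countability.\<close>

definition compact_corner_manifold ::
    "'a::t2_space set \<Rightarrow> ('a, 'e::euclidean_space) corner_chart set \<Rightarrow> bool" where
  "compact_corner_manifold X A \<longleftrightarrow> compact X \<and> smooth_corner_atlas X A"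

text \<open>The points at which exactly \<open>k\<close> of the boundary coordinates vanish.\<close>

definition corner_stratum ::
    "'a set \<Rightarrow> ('a, 'e::euclidean_space) corner_chart set \<Rightarrow> nat \<Rightarrow> 'a set" where
  "corner_stratum X A k =
     {p\<in>X. \<exists>c\<in>A. p \<in> chart_dom c \<and> card {b\<in>walls c. coord c p \<bullet> b = 0} = k}"

definition mf_interior :: "'a set \<Rightarrow> ('a, 'e::euclidean_space) corner_chart set \<Rightarrow> 'a set" where
  "mf_interior X A = corner_stratum X A 0"

definition mf_boundary :: "'a set \<Rightarrow> ('a, 'e::euclidean_space) corner_chart set \<Rightarrow> 'a set" where
  "mf_boundary X A = X - mf_interior X A"

text \<open>Boundary hypersurfaces are the closures of the connected components of the
  codimension one stratum.\<close>

definition boundary_hypersurfaces ::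
    "'a::topological_space set \<Rightarrow> ('a, 'e::euclidean_space) corner_chart set \<Rightarrow> 'a set set" where
  "boundary_hypersurfaces X A = {X \<inter> closure C |C. C \<in> components (corner_stratum X A 1)}"

text \<open>Embeddedness: near each of its points, a hypersurface is a single coordinate wall, so it
  does not meet itself at a corner.\<close>

definition embedded_hypersurface ::
    "'a::topological_space set \<Rightarrow> ('a, 'e::euclidean_space) corner_chart set \<Rightarrow> 'a set \<Rightarrow> bool" where
  "embedded_hypersurface X A H \<longleftrightarrow>
     (\<forall>p\<in>H. \<exists>c\<in>A. \<exists>b\<in>walls c. \<exists>W.
        openin (top_of_set X) W \<and> p \<in> W \<and> W \<subseteq> chart_dom c \<and>
        H \<inter> W = {q\<in>W. coord c q \<bullet> b = 0})"

definition smooth_function ::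
    "('a, 'e::euclidean_space) corner_chart set \<Rightarrow> ('a \<Rightarrow> real) \<Rightarrow> bool" where
  "smooth_function A f \<longleftrightarrow> (\<forall>c\<in>A. smooth_on (coord c ` chart_dom c) (f \<circ> chart_inv c))"

text \<open>In the last clause the derivative is taken within the image of the chart; it is unique
  there, also at corner points.\<close>

definition boundary_defining_function ::
    "'a set \<Rightarrow> ('a, 'e::euclidean_space) corner_chart set \<Rightarrow> 'a set \<Rightarrow> ('a \<Rightarrow> real) \<Rightarrow> bool" where
  "boundary_defining_function X A H \<rho> \<longleftrightarrow>
     smooth_function A \<rho> \<and>
     H = {p\<in>X. \<rho> p = 0} \<and>
     (\<forall>p\<in>X - H. \<rho> p > 0) \<and>
     (\<forall>p\<in>H. \<forall>c\<in>A. p \<in> chart_dom c \<longrightarrow>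
        \<not> ((\<rho> \<circ> chart_inv c) has_derivative (\<lambda>_. 0))
            (at (coord c p) within coord c ` chart_dom c))"

definition open_face :: "'a set \<Rightarrow> nat \<Rightarrow> (nat \<Rightarrow> 'a set) \<Rightarrow> nat set \<Rightarrow> 'a set" where
  "open_face X N H I = {p\<in>X. {i\<in>{1..N}. p \<in> H i} = I}"

text \<open>\<open>F\<close> is locally a slice on which all but \<open>m\<close> of the coordinates of some chart
  are constant.\<close>

definition submanifold_of_dim ::
    "'a::topological_space set \<Rightarrow> ('a, 'e::euclidean_space) corner_chart set \<Rightarrow> 'a set \<Rightarrow> nat \<Rightarrow> bool" where
  "submanifold_of_dim X A F m \<longleftrightarrow>
     F \<subseteq> X \<and>
     (\<forall>p\<in>F. \<exists>c\<in>A. \<exists>J W.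
        J \<subseteq> Basis \<and> card J + m = DIM('e) \<and>
        openin (top_of_set X) W \<and> p \<in> W \<and> W \<subseteq> chart_dom c \<and>
        F \<inter> W = {q\<in>W. \<forall>b\<in>J. coord c q \<bullet> b = coord c p \<bullet> b})"


section \<open>Riemannian metrics and distances\<close>

text \<open>A metric is the family of its coordinate representations: \<open>g c p v w\<close> is the inner
  product at the point \<open>p\<close> of the tangent vectors with components \<open>v\<close> and \<open>w\<close> in the
  chart \<open>c\<close>. The last clause is the transformation law of a covariant tensor of degree two.\<close>

type_synonym ('a, 'e) metric_family = "('a, 'e) corner_chart \<Rightarrow> 'a \<Rightarrow> 'e \<Rightarrow> 'e \<Rightarrow> real"

definition riemannian_metric ::
    "('a, 'e::euclidean_space) corner_chart set \<Rightarrow> ('a, 'e) metric_family \<Rightarrow> bool" where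
  "riemannian_metric A g \<longleftrightarrow>
     (\<forall>c\<in>A. \<forall>p\<in>chart_dom c.
        bilinear (g c p) \<and> (\<forall>v w. g c p v w = g c p w v) \<and> (\<forall>v. v \<noteq> 0 \<longrightarrow> g c p v v > 0)) \<and>
     (\<forall>c\<in>A. \<forall>v w. smooth_on (coord c ` chart_dom c) (\<lambda>x. g c (chart_inv c x) v w)) \<and>
     (\<forall>c\<in>A. \<forall>c'\<in>A. \<forall>p\<in>chart_dom c \<inter> chart_dom c'. \<forall>T.
        ((coord c' \<circ> chart_inv c) has_derivative T)
          (at (coord c p) within coord c ` (chart_dom c \<inter> chart_dom c')) \<longrightarrow>
        (\<forall>v w. g c p v w = g c' p (T v) (T w)))"

text \<open>The metric \<open>g_Sigma\<close>. Only its values on the interior matter, where all \<open>\<rho> i\<close> are positive.\<close>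

definition sum_metric ::
    "nat \<Rightarrow> (nat \<Rightarrow> 'a \<Rightarrow> real) \<Rightarrow> (nat \<Rightarrow> real) \<Rightarrow> ('a, 'e) metric_family \<Rightarrow> ('a, 'e) metric_family" where
  "sum_metric N \<rho> \<alpha> g0 = (\<lambda>c p v w. (\<Sum>i\<in>{1..N}. \<rho> i p powr (- \<alpha> i)) * g0 c p v w)"

definition C1_curve ::
    "('a, 'e::euclidean_space) corner_chart set \<Rightarrow> (real \<Rightarrow> 'a) \<Rightarrow> real \<Rightarrow> real \<Rightarrow> bool" where
  "C1_curve A \<gamma> a b \<longleftrightarrow>
     (\<forall>c\<in>A. \<exists>D. continuous_on {t\<in>{a..b}. \<gamma> t \<in> chart_dom c} D \<and>
        (\<forall>t\<in>{a..b}. \<gamma> t \<in> chart_dom c \<longrightarrow>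
           ((coord c \<circ> \<gamma>) has_vector_derivative D t) (at t within {a..b})))"

definition piecewise_C1_curve ::
    "('a::topological_space, 'e::euclidean_space) corner_chart set \<Rightarrow> (real \<Rightarrow> 'a) \<Rightarrow> bool" where
  "piecewise_C1_curve A \<gamma> \<longleftrightarrow>
     continuous_on {0..1} \<gamma> \<and>
     (\<exists>k \<tau>. \<tau> 0 = 0 \<and> \<tau> k = 1 \<and>
        (\<forall>j<k. \<tau> j < \<tau> (Suc j) \<and> C1_curve A \<gamma> (\<tau> j) (\<tau> (Suc j))))"

text \<open>The speed does not depend on the chart chosen, except possibly at the finitely many
  break points of the curve, which do not affect the length.\<close>

definition speed ::
    "('a, 'e::euclidean_space) corner_chart set \<Rightarrow> ('a, 'e) metric_family \<Rightarrow> (real \<Rightarrow> 'a) \<Rightarrow> real \<Rightarrow> real" where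
  "speed A g \<gamma> t =
     (let c = (SOME c. c \<in> A \<and> \<gamma> t \<in> chart_dom c);
          v = vector_derivative (coord c \<circ> \<gamma>) (at t within {0..1})
      in sqrt (g c (\<gamma> t) v v))"

definition curve_length ::
    "('a, 'e::euclidean_space) corner_chart set \<Rightarrow> ('a, 'e) metric_family \<Rightarrow> (real \<Rightarrow> 'a) \<Rightarrow> ennreal" where
  "curve_length A g \<gamma> = (\<integral>\<^sup>+t\<in>{0..1}. ennreal (speed A g \<gamma> t) \<partial>lborel)"

text \<open>The manifold need not be connected: points of \<open>Y\<close> that cannot be joined by a curve in
  \<open>Y\<close> have distance \<open>\<infinity>\<close>.\<close>

definition riemannian_dist ::
    "'a::topological_space set \<Rightarrow> ('a, 'e::euclidean_space) corner_chart set \<Rightarrow> ('a, 'e) metric_family \<Rightarrow>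
     'a \<Rightarrow> 'a \<Rightarrow> ennreal" where
  "riemannian_dist Y A g p q =
     (INF \<gamma>\<in>{\<gamma>. piecewise_C1_curve A \<gamma> \<and> \<gamma> ` {0..1} \<subseteq> Y \<and> \<gamma> 0 = p \<and> \<gamma> 1 = q}. curve_length A g \<gamma>)"


section \<open>Metric completion for distances with values in \<open>[0,\<infinity>]\<close>\<close>

definition dist_Cauchy :: "'a set \<Rightarrow> ('a \<Rightarrow> 'a \<Rightarrow> ennreal) \<Rightarrow> (nat \<Rightarrow> 'a) \<Rightarrow> bool" where
  "dist_Cauchy Y d x \<longleftrightarrow>
     range x \<subseteq> Y \<and> (\<forall>e>0. \<exists>K. \<forall>m\<ge>K. \<forall>n\<ge>K. d (x m) (x n) < e)"

definition Cauchy_equiv :: "'a set \<Rightarrow> ('a \<Rightarrow> 'a \<Rightarrow> ennreal) \<Rightarrow> ((nat \<Rightarrow> 'a) \<times> (nat \<Rightarrow> 'a)) set" where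
  "Cauchy_equiv Y d =
     {(x, y). dist_Cauchy Y d x \<and> dist_Cauchy Y d y \<and> (\<lambda>n. d (x n) (y n)) \<longlonglongrightarrow> 0}"

definition completion :: "'a set \<Rightarrow> ('a \<Rightarrow> 'a \<Rightarrow> ennreal) \<Rightarrow> (nat \<Rightarrow> 'a) set set" where
  "completion Y d = {x. dist_Cauchy Y d x} // Cauchy_equiv Y d"

definition completion_dist ::
    "('a \<Rightarrow> 'a \<Rightarrow> ennreal) \<Rightarrow> (nat \<Rightarrow> 'a) set \<Rightarrow> (nat \<Rightarrow> 'a) set \<Rightarrow> ennreal" where
  "completion_dist d P Q = (THE L. \<forall>x\<in>P. \<forall>y\<in>Q. (\<lambda>n. d (x n) (y n)) \<longlonglongrightarrow> L)"

definition accessible_point ::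
    "'a::topological_space set \<Rightarrow> ('a \<Rightarrow> 'a \<Rightarrow> ennreal) \<Rightarrow> 'a \<Rightarrow> bool" where
  "accessible_point Y d p \<longleftrightarrow> (\<exists>x. dist_Cauchy Y d x \<and> x \<longlonglongrightarrow> p)"

text \<open>The point of the completion represented by all sequences of \<open>Y\<close> that converge
  topologically to \<open>z\<close>; it is meaningful if these are Cauchy and equivalent, as is the case
  for the points of accessible faces.\<close>

definition completion_point ::
    "'a::topological_space set \<Rightarrow> ('a \<Rightarrow> 'a \<Rightarrow> ennreal) \<Rightarrow> 'a \<Rightarrow> (nat \<Rightarrow> 'a) set" where
  "completion_point Y d z =
     (THE P. P \<in> completion Y d \<and> (\<forall>x. range x \<subseteq> Y \<and> x \<longlonglongrightarrow> z \<longrightarrow> x \<in> P))"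

definition boundary_dist ::
    "'a::topological_space set \<Rightarrow> ('a \<Rightarrow> 'a \<Rightarrow> ennreal) \<Rightarrow> 'a \<Rightarrow> 'a \<Rightarrow> ennreal" where
  "boundary_dist Y d z z' = completion_dist d (completion_point Y d z) (completion_point Y d z')"


section \<open>Hausdorff dimension\<close>

definition ediam :: "('a \<Rightarrow> 'a \<Rightarrow> ennreal) \<Rightarrow> 'a set \<Rightarrow> ennreal" where
  "ediam d U = (SUP x\<in>U. SUP y\<in>U. d x y)"

text \<open>The summand $(\mathrm{diam}\, U)^s$, with $(\mathrm{diam}\, \emptyset)^s = 0$ and
  $0^0 = 1$ on nonempty sets (\<open>0 powr 0\<close> is \<open>0\<close>). It is only used for sets of finite diameter.\<close>

definition diam_powr :: "('a \<Rightarrow> 'a \<Rightarrow> ennreal) \<Rightarrow> real \<Rightarrow> 'a set \<Rightarrow> ennreal" where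
  "diam_powr d s U =
     (if U = {} then 0 else if s = 0 then 1 else ennreal (enn2real (ediam d U) powr s))"

definition hausdorff_premeasure ::
    "('a \<Rightarrow> 'a \<Rightarrow> ennreal) \<Rightarrow> 'a set \<Rightarrow> real \<Rightarrow> real \<Rightarrow> ennreal" where
  "hausdorff_premeasure d S s \<delta> =
     (INF U\<in>{U :: nat \<Rightarrow> 'a set. S = (\<Union>i. U i) \<and> (\<forall>i. ediam d (U i) \<le> ennreal \<delta>)}.
        \<Sum>i. diam_powr d s (U i))"

definition hausdorff_measure :: "('a \<Rightarrow> 'a \<Rightarrow> ennreal) \<Rightarrow> 'a set \<Rightarrow> real \<Rightarrow> ennreal" where
  "hausdorff_measure d S s = (SUP \<delta>\<in>{0<..}. hausdorff_premeasure d S s \<delta>)"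

definition hausdorff_dim :: "('a \<Rightarrow> 'a \<Rightarrow> ennreal) \<Rightarrow> 'a set \<Rightarrow> ennreal" where
  "hausdorff_dim d S = (INF s\<in>{s. 0 \<le> s \<and> hausdorff_measure d S s = 0}. ennreal s)"

end

theory Submission
  imports Defs
begin

text \<open>
  Near a point \<open>p\<close> of the face, work in one chart. There the induced distance is comparable to the
  power \<open>1 - M / 2\<close> of the coordinate distance, so the Hausdorff dimension of an
  \<open>m\<close>-dimensional slice is divided by \<open>1 - M / 2\<close>.

  Upper bound: move from two points at distance \<open>r\<close> inward by \<open>r\<close>, then across. Every \<open>\<rho> i\<close> that
  vanishes at \<open>p\<close> grows linearly along the inward direction: its derivative is nonzero and
  nonnegative on the tangent cone, hence positive on the interior of the cone. The length is
  therefore of order $\int_0^r t^{-M/2}\,dt$.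

  Lower bound: a curve between the two points must first leave the coordinate ball of radius \<open>r\<close>
  around one of them, and in this ball the defining function with the largest weight is at most of
  order \<open>r\<close>. The same bound shows \<open>M < 2\<close> at accessible points, since for \<open>M \<ge> 2\<close> it does not tend to
  \<open>0\<close> with \<open>r\<close>.
\<close>

section \<open>Hausdorff measure zero and Hoelder bounds\<close>

text \<open>On the face the conformal factor is infinite, and the induced distance exists only as a
  limit of distances between interior points. Each estimate is therefore proved between interior
  points near \<open>p\<close>, with constants that do not degenerate as the points approach the
  face, and only then carried to the limit.

  The two bounds share an exponent because, precisely for \<open>M < 2\<close>, the integral of
  \<open>t powr (- M / 2)\<close> up to \<open>r\<close> has the same order as the crude product of
  \<open>r\<close> and \<open>r powr (- M / 2)\<close>.

  Only Hoelder bounds for pairs of nearby points enter the count of dimension, and they do so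
  asymmetrically. The upper bound concerns all of the face, which need not be compact, so countably
  many neighbourhoods have to be combined. For the lower bound one neighbourhood is enough, as a
  cover of the face also covers each of its parts.

  They are compared with the walls of a chart through the sign of their derivatives, tested on one
  vector that is transverse to all walls.\<close>

lemma ediam_upper: "x \<in> U \<Longrightarrow> y \<in> U \<Longrightarrow> d x y \<le> ediam d U"
  unfolding ediam_def by (meson SUP_upper order_trans)

lemma ediam_least: "(\<And>x y. x \<in> U \<Longrightarrow> y \<in> U \<Longrightarrow> d x y \<le> e) \<Longrightarrow> ediam d U \<le> e"
  unfolding ediam_def by (meson SUP_least)

lemma diam_powr_empty [simp]: "diam_powr d s {} = 0"
  by (simp add: diam_powr_def)

lemma diam_powr_le:
  assumes "ediam d U \<le> ennreal e" "0 \<le> e" "0 < s"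
  shows "diam_powr d s U \<le> ennreal (e powr s)"
proof -
  have "enn2real (ediam d U) \<le> e"
    using enn2real_mono[OF assms(1)] assms(2) by simp
  then have "enn2real (ediam d U) powr s \<le> e powr s"
    using assms by (intro powr_mono2) auto
  then show ?thesis
    using assms by (auto simp: diam_powr_def ennreal_leI)
qed

text \<open>The dimension only asks whether the measure vanishes. For that question the supremum
  over scales of infima over covers reduces to this condition with real tolerances, which passes
  directly to countable unions.\<close>

definition small_covers :: "('a \<Rightarrow> 'a \<Rightarrow> ennreal) \<Rightarrow> 'a set \<Rightarrow> real \<Rightarrow> bool" where
  "small_covers d S s \<longleftrightarrow>
     (\<forall>\<delta>>0. \<forall>e>0. \<exists>U :: nat \<Rightarrow> 'a set. S = (\<Union>i. U i) \<and> (\<forall>i. ediam d (U i) \<le> ennreal \<delta>) \<and>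
        (\<Sum>i. diam_powr d s (U i)) \<le> ennreal e)"

lemma hausdorff_measure_eq_0_iff:
  "hausdorff_measure d S s = 0 \<longleftrightarrow> small_covers d S s"
proof
  assume 0: "hausdorff_measure d S s = 0"
  show "small_covers d S s"
    unfolding small_covers_def
  proof (intro allI impI)
    fix \<delta> e :: real assume "\<delta> > 0" "e > 0"
    then have "hausdorff_premeasure d S s \<delta> \<le> hausdorff_measure d S s"
      unfolding hausdorff_measure_def by (intro SUP_upper) auto
    then have "hausdorff_premeasure d S s \<delta> < ennreal e"
      using 0 \<open>e > 0\<close> by (simp add: ennreal_zero_less_divide)
    then show "\<exists>U. S = (\<Union>i. U i) \<and> (\<forall>i. ediam d (U i) \<le> ennreal \<delta>) \<and>
        (\<Sum>i. diam_powr d s (U i)) \<le> ennreal e"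
      unfolding hausdorff_premeasure_def INF_less_iff by (auto intro: less_imp_le)
  qed
next
  assume *: "small_covers d S s"
  have "hausdorff_premeasure d S s \<delta> \<le> 0" if "\<delta> > 0" for \<delta>
  proof (rule ennreal_le_epsilon)
    fix e :: real assume "e > 0"
    then obtain U :: "nat \<Rightarrow> 'a set" where "S = (\<Union>i. U i)" "\<forall>i. ediam d (U i) \<le> ennreal \<delta>"
        "(\<Sum>i. diam_powr d s (U i)) \<le> ennreal e"
      using * \<open>\<delta> > 0\<close> unfolding small_covers_def by blast
    then show "hausdorff_premeasure d S s \<delta> \<le> 0 + ennreal e"
      unfolding hausdorff_premeasure_def by (intro INF_lower2[of U]) auto
  qed
  then show "hausdorff_measure d S s = 0"
    unfolding hausdorff_measure_def by (auto intro!: antisym SUP_least)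
qed

text \<open>The \<open>j\<close>-th set receives the tolerance \<open>e / 2 ^ (j + 1)\<close>, and
  the double sequence of covering sets is enumerated by \<open>prod_decode\<close>, so the total
  stays at most \<open>e\<close>.\<close>

lemma small_covers_UN:
  fixes S :: "nat \<Rightarrow> 'a set"
  assumes "\<And>j. small_covers d (S j) s"
  shows "small_covers d (\<Union>j. S j) s"
  unfolding small_covers_def
proof (intro allI impI)
  fix \<delta> e :: real assume "\<delta> > 0" "e > 0"
  have "\<exists>U :: nat \<Rightarrow> 'a set. S j = (\<Union>i. U i) \<and> (\<forall>i. ediam d (U i) \<le> ennreal \<delta>) \<and>
        (\<Sum>i. diam_powr d s (U i)) \<le> ennreal (e * (1/2) ^ Suc j)" for j
    using assms[of j] \<open>\<delta> > 0\<close> \<open>e > 0\<close> unfolding small_covers_def by simp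
  then obtain U :: "nat \<Rightarrow> nat \<Rightarrow> 'a set" where
    U: "\<And>j. S j = (\<Union>i. U j i)" "\<And>j i. ediam d (U j i) \<le> ennreal \<delta>"
       "\<And>j. (\<Sum>i. diam_powr d s (U j i)) \<le> ennreal (e * (1/2) ^ Suc j)"
    by metis
  define V where "V n = (case prod_decode n of (j, i) \<Rightarrow> U j i)" for n
  have "(\<Sum>n. diam_powr d s (V n)) = (\<Sum>n. (\<lambda>(j, i). diam_powr d s (U j i)) (prod_decode n))"
    by (simp add: V_def case_prod_beta)
  also have "\<dots> = (\<Sum>j. \<Sum>i. diam_powr d s (U j i))"
    by (intro suminf_ennreal_2dimen) simp
  also have "\<dots> \<le> (\<Sum>j. ennreal (e * (1/2) ^ Suc j))"
    by (intro suminf_le U(3)) auto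
  also have "\<dots> = ennreal e"
  proof -
    have "(\<lambda>j. e * (1/2) ^ Suc j) sums (e * 1)"
      by (intro sums_mult power_half_series)
    then show ?thesis
      using \<open>e > 0\<close> by (subst suminf_ennreal_eq) auto
  qed
  finally have "(\<Sum>n. diam_powr d s (V n)) \<le> ennreal e" .
  moreover have "(\<Union>j. S j) = (\<Union>n. V n)"
  proof -
    have "U j i = V (prod_encode (j, i))" for j i
      by (simp add: V_def)
    then have "U j i \<subseteq> (\<Union>n. V n)" for j i
      by blast
    moreover have "V n \<subseteq> (\<Union>j. \<Union>i. U j i)" for n
      by (auto simp: V_def case_prod_beta)
    ultimately show ?thesis
      unfolding U(1) by (intro antisym UN_least)
  qed
  moreover have "\<forall>n. ediam d (V n) \<le> ennreal \<delta>"
    by (simp add: V_def case_prod_beta U(2))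
  ultimately show "\<exists>U. (\<Union>j. S j) = (\<Union>i. U i) \<and> (\<forall>i. ediam d (U i) \<le> ennreal \<delta>) \<and>
        (\<Sum>i. diam_powr d s (U i)) \<le> ennreal e"
    by blast
qed

text \<open>The cover consists of the fibres of \<open>\<phi>\<close> over \<open>K\<close>,
  followed by empty sets, which contribute 0 to the sum.\<close>

lemma finite_partition_cover:
  fixes \<phi> :: "'a \<Rightarrow> 'k"
  assumes "finite K" "\<phi> ` S \<subseteq> K" "0 \<le> e" "0 < s"
    and close: "\<And>p q. p \<in> S \<Longrightarrow> q \<in> S \<Longrightarrow> \<phi> p = \<phi> q \<Longrightarrow> d p q \<le> ennreal e"
  shows "\<exists>U :: nat \<Rightarrow> 'a set. S = (\<Union>i. U i) \<and> (\<forall>i. ediam d (U i) \<le> ennreal e) \<and>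
    (\<Sum>i. diam_powr d s (U i)) \<le> ennreal (card K * e powr s)"
proof -
  obtain h where h: "bij_betw h {0..<card K} K"
    using ex_bij_betw_nat_finite[OF \<open>finite K\<close>] by blast
  define U where "U i = (if i < card K then {p\<in>S. \<phi> p = h i} else {})" for i
  have "S = (\<Union>i. U i)"
  proof -
    have "\<exists>i. p \<in> U i" if "p \<in> S" for p
    proof -
      have "\<phi> p \<in> h ` {0..<card K}"
        using h that assms(2) by (auto simp: bij_betw_def)
      then obtain i where "i < card K" "\<phi> p = h i"
        by auto
      then have "p \<in> U i"
        using that by (simp add: U_def)
      then show ?thesis ..
    qed
    moreover have "U i \<subseteq> S" for i
      by (simp add: U_def)
    ultimately show ?thesis
      by blast
  qed
  moreover have ed: "ediam d (U i) \<le> ennreal e" for i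
    by (rule ediam_least) (auto simp: U_def close split: if_splits)
  moreover have "(\<Sum>i. diam_powr d s (U i)) = (\<Sum>i<card K. diam_powr d s (U i))"
    by (rule suminf_finite) (auto simp: U_def)
  moreover have "(\<Sum>i<card K. diam_powr d s (U i)) \<le> (\<Sum>i<card K. ennreal (e powr s))"
    by (intro sum_mono diam_powr_le ed assms)
  ultimately show ?thesis
    by (intro exI[of _ U]) (simp add: ennreal_mult ennreal_of_nat_eq_real_of_nat)
qed

lemma norm_le_DIM_bound:
  fixes v :: "'e::euclidean_space" and e :: real
  assumes "\<And>b. b \<in> Basis \<Longrightarrow> \<bar>v \<bullet> b\<bar> \<le> e"
  shows "norm v \<le> DIM('e) * e"
  using norm_le_l1[of v] sum_mono[of Basis "\<lambda>b. \<bar>v \<bullet> b\<bar>" "\<lambda>_. e"] assms by simp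

text \<open>Counting grid cells. Cutting the \<open>m\<close> free directions into pieces of length
  \<open>l / k\<close> gives \<open>(2 * k) ^ m\<close> cells, each of diameter of order
  \<open>k powr (- \<theta>)\<close> by the Hoelder bound. The sum has order
  \<open>k powr (m - \<theta> * s)\<close>, which tends to 0 as \<open>s\<close> exceeds
  \<open>m / \<theta>\<close>.\<close>

lemma small_covers_Hoelder:
  fixes x :: "'a \<Rightarrow> 'e::euclidean_space"
  assumes J: "J \<subseteq> Basis" "card J + m = DIM('e)"
    and slice: "\<And>p b. p \<in> S \<Longrightarrow> b \<in> J \<Longrightarrow> x p \<bullet> b = a \<bullet> b"
    and bounded: "\<And>p b. p \<in> S \<Longrightarrow> b \<in> Basis \<Longrightarrow> \<bar>x p \<bullet> b - a \<bullet> b\<bar> < l"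
    and Hoelder: "\<And>p q r. p \<in> S \<Longrightarrow> q \<in> S \<Longrightarrow> norm (x p - x q) < r \<Longrightarrow> r \<le> r0 \<Longrightarrow>
        d p q \<le> ennreal (C * r powr \<theta>)"
    and pos: "0 < r0" "0 \<le> C" "0 < \<theta>" "0 < l"
    and s: "m / \<theta> < s"
  shows "small_covers d S s"
  unfolding small_covers_def
proof (intro allI impI)
  fix \<delta> e :: real assume "\<delta> > 0" "e > 0"
  define n where "n = real DIM('e)"
  have "n \<ge> 1" by (simp add: n_def DIM_positive Suc_leI)
  have "0 < s" using s pos by (meson divide_nonneg_pos le_less_trans of_nat_0_le_iff)
  have \<theta>s: "real m < \<theta> * s"
    using s pos by (simp add: field_simps)
  \<comment> \<open>Two points in one cell differ by at most \<open>l / k\<close> in each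
    coordinate, hence by at most \<open>n * (l / k)\<close> in norm; the factor 2 provides the
    strict inequality in the Hoelder hypothesis.\<close>
  define r where "r k = 2 * n * (l / real k)" for k :: nat
  define \<eta> where "\<eta> k = C * r k powr \<theta>" for k
  have "(\<lambda>k. r k) \<longlonglongrightarrow> 0"
    unfolding r_def by (rule tendsto_mult_right_zero[OF lim_const_over_n])
  then have ev1: "\<forall>\<^sub>F k in sequentially. r k < r0"
    using pos(1) by (rule order_tendstoD)
  have "\<eta> \<longlonglongrightarrow> C * 0"
    unfolding \<eta>_def
    by (intro tendsto_mult tendsto_const tendsto_zero_powrI[OF \<open>r \<longlonglongrightarrow> 0\<close> tendsto_const _ pos(3)])
      (use \<open>n \<ge> 1\<close> pos in \<open>auto simp: r_def\<close>)
  then have ev2: "\<forall>\<^sub>F k in sequentially. \<eta> k < \<delta>"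
    using \<open>\<delta> > 0\<close> by (auto intro: order_tendstoD)
  \<comment> \<open>\<open>Q\<close> collects the factors of the covering sum that do not depend on
    \<open>k\<close>.\<close>
  define Q where "Q = 2 ^ m * (C * (2 * n * l) powr \<theta>) powr s"
  have "(\<lambda>k. Q * real k powr (m - \<theta> * s)) \<longlonglongrightarrow> Q * 0"
    by (intro tendsto_mult tendsto_const tendsto_neg_powr filterlim_real_sequentially) (use \<theta>s in auto)
  then have ev3: "\<forall>\<^sub>F k in sequentially. Q * real k powr (m - \<theta> * s) < e"
    using \<open>e > 0\<close> by (auto intro: order_tendstoD)
  obtain k where k: "r k < r0" "\<eta> k < \<delta>" "Q * real k powr (m - \<theta> * s) < e" "k \<ge> 1"
    using eventually_happens[OF eventually_conj[OF ev1 eventually_conj[OF ev2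
          eventually_conj[OF ev3 eventually_ge_at_top[of 1]]]]] by auto
  define K where "K = PiE (Basis - J) (\<lambda>_. {- int k..<int k})"
  \<comment> \<open>The cell index of \<open>p\<close>. The coordinates stay strictly within
    \<open>l\<close> of those of \<open>a\<close>, so each floor takes one of the
    \<open>2 * k\<close> values from \<open>- k\<close> to \<open>k - 1\<close>.\<close>
  define \<phi> where "\<phi> p = (\<lambda>b\<in>Basis - J. \<lfloor>(x p \<bullet> b - a \<bullet> b) * k / l\<rfloor>)" for p
  have "card (Basis - J) = m"
    using J by (simp add: card_Diff_subset finite_subset[OF J(1)])
  then have cardK: "card K = (2 * k) ^ m"
    unfolding K_def by (subst card_PiE) (auto simp: nat_mult_distrib finite_subset[OF J(1)])
  have "finite K"
    unfolding K_def by (intro finite_PiE) auto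
  have "\<phi> ` S \<subseteq> K"
  proof (rule image_subsetI)
    fix p assume "p \<in> S"
    show "\<phi> p \<in> K"
      unfolding K_def \<phi>_def
    proof (rule restrict_PiE_iff[THEN iffD2], rule ballI)
      fix b assume b: "b \<in> Basis - J"
      then have "\<bar>x p \<bullet> b - a \<bullet> b\<bar> < l" using bounded \<open>p \<in> S\<close> by blast
      then have "\<bar>x p \<bullet> b - a \<bullet> b\<bar> * (k / l) < l * (k / l)"
        using \<open>k \<ge> 1\<close> pos(4) by (intro mult_strict_right_mono) auto
      then have "\<bar>(x p \<bullet> b - a \<bullet> b) * k / l\<bar> < k"
        using pos(4) by (simp add: abs_mult)
      then show "\<lfloor>(x p \<bullet> b - a \<bullet> b) * k / l\<rfloor> \<in> {- int k..<int k}"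
        unfolding abs_less_iff by (simp add: floor_less_iff le_floor_iff)
    qed
  qed
  have close: "d p q \<le> ennreal (\<eta> k)" if pq: "p \<in> S" "q \<in> S" "\<phi> p = \<phi> q" for p q
  proof -
    have "\<bar>(x p - x q) \<bullet> b\<bar> \<le> l / k" if "b \<in> Basis" for b
    proof (cases "b \<in> J")
      case True
      then show ?thesis using slice pq pos(4) by (simp add: inner_diff_left)
    next
      case False
      then have "\<lfloor>(x p \<bullet> b - a \<bullet> b) * k / l\<rfloor> = \<lfloor>(x q \<bullet> b - a \<bullet> b) * k / l\<rfloor>"
        using pq(3) that unfolding \<phi>_def by (metis (mono_tags, lifting) DiffI restrict_apply')
      then have "\<bar>(x p \<bullet> b - a \<bullet> b) * k / l - (x q \<bullet> b - a \<bullet> b) * k / l\<bar> < 1"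
        by linarith
      also have "(x p \<bullet> b - a \<bullet> b) * k / l - (x q \<bullet> b - a \<bullet> b) * k / l = (x p - x q) \<bullet> b * (k / l)"
        by (simp add: inner_diff_left diff_divide_distrib[symmetric] left_diff_distrib)
      finally show ?thesis
        using \<open>k \<ge> 1\<close> pos(4) by (simp add: abs_mult field_simps)
    qed
    then have "norm (x p - x q) \<le> n * (l / k)"
      unfolding n_def by (rule norm_le_DIM_bound)
    also have "\<dots> < r k"
      using \<open>n \<ge> 1\<close> pos(4) \<open>k \<ge> 1\<close> by (simp add: r_def divide_strict_right_mono)
    finally show ?thesis
      unfolding \<eta>_def by (intro Hoelder pq) (use k in auto)
  qed
  have "0 \<le> \<eta> k"
    using pos by (simp add: \<eta>_def)
  have "\<exists>U :: nat \<Rightarrow> 'a set. S = (\<Union>i. U i) \<and> (\<forall>i. ediam d (U i) \<le> ennreal (\<eta> k)) \<and>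
      (\<Sum>i. diam_powr d s (U i)) \<le> ennreal (card K * \<eta> k powr s)"
    by (rule finite_partition_cover[OF \<open>finite K\<close> \<open>\<phi> ` S \<subseteq> K\<close> \<open>0 \<le> \<eta> k\<close> \<open>0 < s\<close> close])
  then obtain U :: "nat \<Rightarrow> 'a set" where U: "S = (\<Union>i. U i)" "\<forall>i. ediam d (U i) \<le> ennreal (\<eta> k)"
    "(\<Sum>i. diam_powr d s (U i)) \<le> ennreal (card K * \<eta> k powr s)"
    by (elim exE conjE)
  have "card K * \<eta> k powr s = Q * real k powr (m - \<theta> * s)"
  proof -
    have kp: "real k > 0" using k by simp
    have "\<eta> k = C * (2 * n * l) powr \<theta> * real k powr (- \<theta>)"
      using \<open>n \<ge> 1\<close> pos kp by (simp add: \<eta>_def r_def powr_divide powr_minus field_simps)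
    then have "\<eta> k powr s = (C * (2 * n * l) powr \<theta>) powr s * real k powr (- \<theta> * s)"
      using pos by (simp add: powr_mult powr_powr)
    moreover have "real (card K) = 2 ^ m * real k powr m"
      using kp by (simp add: cardK power_mult_distrib powr_realpow)
    ultimately show ?thesis
      by (simp add: Q_def powr_diff powr_minus divide_simps)
  qed
  then have "(\<Sum>i. diam_powr d s (U i)) \<le> ennreal e"
    using U(3) k(3) by (metis ennreal_leI less_imp_le order_trans)
  moreover have "\<forall>i. ediam d (U i) \<le> ennreal \<delta>"
    using U(2) k(2) by (meson ennreal_leI less_imp_le order_trans)
  ultimately show "\<exists>U. S = (\<Union>i. U i) \<and> (\<forall>i. ediam d (U i) \<le> ennreal \<delta>) \<and>
        (\<Sum>i. diam_powr d s (U i)) \<le> ennreal e"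
    using U(1) by blast
qed

text \<open>A volume argument in the manner of the mass distribution principle: a cover with small
  sum would produce Lebesgue sets that cover a cube of side \<open>l\<close> but have a smaller
  total volume. A set of diameter \<open>D \<le> 1\<close> has coordinate extent of order
  \<open>D powr (1 / \<theta>)\<close> and hence \<open>m\<close>-dimensional volume of order
  \<open>D powr (m / \<theta>)\<close>, which its summand dominates since
  \<open>s < m / \<theta>\<close>. Sets of the cover may leave \<open>S\<close>; their traces on
  \<open>S\<close> are what is measured.\<close>

lemma not_small_covers_Hoelder:
  fixes x :: "'a \<Rightarrow> 'e::euclidean_space"
  assumes J: "J \<subseteq> Basis" "card J + m = DIM('e)"
    and SF: "S \<subseteq> F"
    and box: "\<And>y. (\<forall>b\<in>J. y \<bullet> b = a \<bullet> b) \<Longrightarrow> (\<forall>b\<in>Basis - J. a \<bullet> b \<le> y \<bullet> b \<and> y \<bullet> b \<le> a \<bullet> b + l) \<Longrightarrow> y \<in> x ` S"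
    and Hoelder: "\<And>p q. p \<in> S \<Longrightarrow> q \<in> S \<Longrightarrow> ennreal (c * norm (x p - x q) powr \<theta>) \<le> d p q"
    and pos: "0 < c" "0 < \<theta>" "0 < l"
    and s: "0 \<le> s" "s < m / \<theta>"
  shows "\<not> small_covers d F s"
proof
  assume sc: "small_covers d F s"
  have "m > 0" using s by (cases m) auto
  have cardJ: "card (Basis - J) = m"
    using J by (simp add: card_Diff_subset finite_subset[OF J(1)])
  \<comment> \<open>The slice is thickened by $[0,1]$ in the directions \<open>J\<close>, so that its
    \<open>m\<close>-dimensional volume becomes a Lebesgue measure on the whole space.\<close>
  define slab where "slab v w = cbox (\<Sum>b\<in>Basis. (if b \<in> J then 0 else v b) *\<^sub>R b)
      (\<Sum>b\<in>Basis. (if b \<in> J then 1 else w b) *\<^sub>R b :: 'e)" for v w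
  have slab_iff: "y \<in> slab v w \<longleftrightarrow> (\<forall>b\<in>Basis. if b \<in> J then 0 \<le> y \<bullet> b \<and> y \<bullet> b \<le> 1
      else v b \<le> y \<bullet> b \<and> y \<bullet> b \<le> w b)" for y v w
    by (auto simp: slab_def mem_box)
  have slab_vol: "emeasure lborel (slab v w) = ennreal (h ^ m)"
    if h: "\<And>b. b \<in> Basis - J \<Longrightarrow> w b = v b + h" "0 \<le> h" for v w h
  proof -
    have "(\<Prod>b\<in>Basis. (\<Sum>b\<in>Basis. (if b \<in> J then 1 else w b) *\<^sub>R b - (if b \<in> J then 0 else v b) *\<^sub>R b) \<bullet> b)
       = (\<Prod>b\<in>(Basis::'e set). if b \<in> J then 1 else h)"
      using h by (intro prod.cong refl) (auto simp: sum_subtractf inner_diff_left)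
    also have "\<dots> = h ^ m"
      using J by (simp add: prod.If_cases Int_absorb1 Diff_eq[symmetric] cardJ)
    finally have *: "(\<Prod>b\<in>Basis. (\<Sum>b\<in>Basis. (if b \<in> J then 1 else w b) *\<^sub>R b - (if b \<in> J then 0 else v b) *\<^sub>R b) \<bullet> b) = h ^ m" .
    show ?thesis
      unfolding slab_def by (subst emeasure_lborel_cbox) (use h * in \<open>auto simp: sum_subtractf\<close>)
  qed
  \<comment> \<open>With \<open>r = (D / c) powr (1 / \<theta>)\<close>, a cube of side
    \<open>2 * r\<close> in the \<open>m\<close> free directions has volume
    \<open>G * D powr (m / \<theta>)\<close>; the tolerance \<open>e\<close> below makes
    \<open>G * e\<close> half of \<open>l ^ m\<close>.\<close>
  define G where "G = 2 ^ m * (1 / c) powr (m / \<theta>)"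
  have "G > 0" using pos by (simp add: G_def)
  define e where "e = l ^ m / (2 * G)"
  have "e > 0" using pos \<open>G > 0\<close> by (simp add: e_def)
  \<comment> \<open>Scale 1 is chosen because \<open>D \<le> 1\<close> makes
    \<open>D powr (m / \<theta>)\<close> at most \<open>D powr s\<close>.\<close>
  obtain U where U: "F = (\<Union>i. U i)" "\<And>i. ediam d (U i) \<le> ennreal 1" "(\<Sum>i. diam_powr d s (U i)) \<le> ennreal e"
    using sc \<open>e > 0\<close> unfolding small_covers_def by (metis zero_less_one)
  \<comment> \<open>\<open>T\<close> has to contain, over each point of
    \<open>U i \<inter> S\<close>, the full unit cube in the directions \<open>J\<close>.\<close>
  have "\<exists>T. T \<in> sets lborel \<and> (\<forall>p\<in>U i \<inter> S. \<forall>y. (\<forall>b\<in>Basis. if b \<in> J then 0 \<le> y \<bullet> b \<and> y \<bullet> b \<le> 1 else y \<bullet> b = x p \<bullet> b) \<longrightarrow> y \<in> T)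
      \<and> emeasure lborel T \<le> ennreal G * diam_powr d s (U i)" for i
  proof (cases "U i \<inter> S = {}")
    case True
    then show ?thesis by (intro exI[of _ "{}"]) auto
  next
    case False
    then obtain p where p: "p \<in> U i" "p \<in> S" by blast
    define D where "D = enn2real (ediam d (U i))"
    have D: "ediam d (U i) = ennreal D" "0 \<le> D" "D \<le> 1"
      using U(2)[of i] by (auto simp: D_def ennreal_enn2real_if enn2real_leI top_unique)
    define r where "r = (D / c) powr (1 / \<theta>)"
    have near: "norm (x p - x q) \<le> r" if q: "q \<in> U i" "q \<in> S" for q
    proof -
      have "ennreal (c * norm (x p - x q) powr \<theta>) \<le> ennreal D"
        using Hoelder[OF p(2) q(2)] ediam_upper[OF p(1) q(1), of d] D(1) by (metis order_trans)
      then have "norm (x p - x q) powr \<theta> \<le> D / c"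
        using D pos by (simp add: field_simps)
      then have "(norm (x p - x q) powr \<theta>) powr (1 / \<theta>) \<le> r"
        unfolding r_def using pos by (intro powr_mono2) auto
      then show ?thesis using pos by (simp add: powr_powr)
    qed
    define T where "T = slab (\<lambda>b. x p \<bullet> b - r) (\<lambda>b. x p \<bullet> b + r)"
    have inT: "y \<in> T" if q: "q \<in> U i \<inter> S"
      and y: "\<forall>b\<in>Basis. if b \<in> J then 0 \<le> y \<bullet> b \<and> y \<bullet> b \<le> 1 else y \<bullet> b = x q \<bullet> b" for q y
    proof -
      have "\<bar>x p \<bullet> b - x q \<bullet> b\<bar> \<le> r" if "b \<in> Basis" for b
        using near[of q] q Basis_le_norm[OF that, of "x p - x q"] by (simp add: inner_diff_left)
      then show ?thesis
        unfolding T_def slab_iff using y by (smt (verit))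
    qed
    have "emeasure lborel T = ennreal ((2 * r) ^ m)"
      unfolding T_def by (rule slab_vol) (auto simp: r_def)
    moreover have "(2 * r) ^ m = G * D powr (m / \<theta>)"
    proof -
      have "r ^ m = (D / c) powr (m / \<theta>)"
        using \<open>m > 0\<close> pos by (cases "D = 0") (simp_all add: r_def powr_power)
      then show ?thesis
        using D pos by (simp add: G_def power_mult_distrib powr_divide)
    qed
    moreover have "ennreal (D powr (m / \<theta>)) \<le> diam_powr d s (U i)"
    proof -
      \<comment> \<open>For \<open>s = 0\<close> the summand of a nonempty set is 1 by convention,
        and \<open>D \<le> 1\<close> still gives the bound.\<close>
      have "D powr (m / \<theta>) \<le> (if s = 0 then 1 else D powr s)"
        using D s by (cases "D = 0") (auto intro!: powr_mono' simp: powr_le1)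
      then show ?thesis
        using p by (auto simp: diam_powr_def D_def[symmetric] ennreal_leI split: if_splits)
    qed
    ultimately have "emeasure lborel T \<le> ennreal G * diam_powr d s (U i)"
      using \<open>G > 0\<close> by (simp add: ennreal_mult mult_left_mono)
    then show ?thesis
      using inT by (intro exI[of _ T]) (simp add: T_def slab_def)
  qed
  then obtain T where T: "\<And>i. T i \<in> sets lborel"
    "\<And>i p y. p \<in> U i \<inter> S \<Longrightarrow> (\<forall>b\<in>Basis. if b \<in> J then 0 \<le> y \<bullet> b \<and> y \<bullet> b \<le> 1 else y \<bullet> b = x p \<bullet> b) \<Longrightarrow> y \<in> T i"
    "\<And>i. emeasure lborel (T i) \<le> ennreal G * diam_powr d s (U i)"
    by metis
  define Q where "Q = slab (\<lambda>b. a \<bullet> b) (\<lambda>b. a \<bullet> b + l)"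
  have "Q \<subseteq> (\<Union>i. T i)"
  proof
    fix y assume y: "y \<in> Q"
    \<comment> \<open>The projection of \<open>y\<close> back to the slice: its auxiliary
      coordinates in \<open>J\<close> are replaced by those of \<open>a\<close>, so that
      \<open>box\<close> applies.\<close>
    define y' where "y' = (\<Sum>b\<in>Basis. (if b \<in> J then a \<bullet> b else y \<bullet> b) *\<^sub>R b)"
    have y': "y' \<bullet> b = (if b \<in> J then a \<bullet> b else y \<bullet> b)" if "b \<in> Basis" for b
      using that by (simp add: y'_def)
    have "y' \<in> x ` S"
      by (rule box) (use y y' J in \<open>auto simp: Q_def slab_iff\<close>)
    then obtain p where p: "p \<in> S" "x p = y'" by auto
    then obtain i where "p \<in> U i" using SF U(1) by auto
    then have "y \<in> T i"
      using p y y' by (intro T(2)[of p]) (auto simp: Q_def slab_iff)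
    then show "y \<in> (\<Union>i. T i)" by blast
  qed
  then have "emeasure lborel Q \<le> emeasure lborel (\<Union>i. T i)"
    using T(1) by (intro emeasure_mono) auto
  also have "\<dots> \<le> (\<Sum>i. emeasure lborel (T i))"
    using T(1) by (intro emeasure_subadditive_countably) auto
  also have "\<dots> \<le> (\<Sum>i. ennreal G * diam_powr d s (U i))"
    by (intro suminf_le T(3)) auto
  also have "\<dots> = ennreal G * (\<Sum>i. diam_powr d s (U i))"
    by (rule ennreal_suminf_cmult)
  also have "\<dots> \<le> ennreal G * ennreal e"
    by (intro mult_left_mono U(3)) auto
  also have "\<dots> = ennreal (l ^ m / 2)"
    using \<open>G > 0\<close> pos by (simp add: e_def ennreal_mult'[symmetric])
  also have "\<dots> < ennreal (l ^ m)"
    using pos by (simp add: ennreal_less_iff)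
  also have "\<dots> = emeasure lborel Q"
    unfolding Q_def by (rule slab_vol[symmetric]) (use pos in auto)
  finally show False by simp
qed

lemma hausdorff_dim_eqI:
  assumes "0 \<le> D"
    and "\<And>s. D < s \<Longrightarrow> small_covers d S s"
    and "\<And>s. 0 \<le> s \<Longrightarrow> s < D \<Longrightarrow> \<not> small_covers d S s"
  shows "hausdorff_dim d S = ennreal D"
  unfolding hausdorff_dim_def hausdorff_measure_eq_0_iff
proof (rule antisym)
  show "(INF s\<in>{s. 0 \<le> s \<and> small_covers d S s}. ennreal s) \<le> ennreal D"
  proof (rule ennreal_le_epsilon)
    fix e :: real assume "e > 0"
    then show "(INF s\<in>{s. 0 \<le> s \<and> small_covers d S s}. ennreal s) \<le> ennreal D + ennreal e"
      using assms(1) assms(2)[of "D + e"] by (intro INF_lower2[of "D + e"]) auto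
  qed
  show "ennreal D \<le> (INF s\<in>{s. 0 \<le> s \<and> small_covers d S s}. ennreal s)"
    by (intro INF_greatest ennreal_leI) (use assms(3) not_less in blast)
qed

section \<open>Distances in the completion\<close>

locale ext_pseudometric =
  fixes Y :: "'a::topological_space set" and d :: "'a \<Rightarrow> 'a \<Rightarrow> ennreal"
  assumes ext_dist_sym: "d x y = d y x"
    and ext_dist_triangle: "d x z \<le> d x y + d y z"
begin

lemma equiv_Cauchy_equiv: "equiv {x. dist_Cauchy Y d x} (Cauchy_equiv Y d)"
proof (rule equivI)
  show "Cauchy_equiv Y d \<subseteq> {x. dist_Cauchy Y d x} \<times> {x. dist_Cauchy Y d x}"
    by (auto simp: Cauchy_equiv_def)
  \<comment> \<open>\<open>d x x = 0\<close> is not an axiom of the locale; self-distances along a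
    Cauchy sequence tend to 0 by the Cauchy condition at equal indices.\<close>
  have "(\<lambda>n. d (x n) (x n)) \<longlonglongrightarrow> 0" if x: "dist_Cauchy Y d x" for x
  proof (rule order_tendstoI)
    fix e :: ennreal assume "0 < e"
    then obtain K where "\<forall>m\<ge>K. \<forall>n\<ge>K. d (x m) (x n) < e"
      using x unfolding dist_Cauchy_def by blast
    then show "\<forall>\<^sub>F n in sequentially. d (x n) (x n) < e"
      by (intro eventually_sequentiallyI[of K]) auto
  qed auto
  then show "refl_on {x. dist_Cauchy Y d x} (Cauchy_equiv Y d)"
    by (auto simp: refl_on_def Cauchy_equiv_def)
  show "sym (Cauchy_equiv Y d)"
    by (auto simp: sym_def Cauchy_equiv_def ext_dist_sym)
  show "trans (Cauchy_equiv Y d)"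
  proof (rule transI)
    fix x y z assume *: "(x, y) \<in> Cauchy_equiv Y d" "(y, z) \<in> Cauchy_equiv Y d"
    then have sum: "(\<lambda>n. d (x n) (y n) + d (y n) (z n)) \<longlonglongrightarrow> 0 + 0"
      by (intro tendsto_add) (auto simp: Cauchy_equiv_def)
    have "(\<lambda>n. d (x n) (z n)) \<longlonglongrightarrow> 0"
    proof (rule tendsto_sandwich[of "\<lambda>_. 0" _ _ "\<lambda>n. d (x n) (y n) + d (y n) (z n)"])
      show "\<forall>\<^sub>F n in sequentially. d (x n) (z n) \<le> d (x n) (y n) + d (y n) (z n)"
        by (simp add: ext_dist_triangle)
    qed (use sum in auto)
    with * show "(x, z) \<in> Cauchy_equiv Y d"
      by (auto simp: Cauchy_equiv_def)
  qed
qed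

lemma dist_quadrangle: "d a b \<le> d a a' + d a' b' + d b' b"
proof -
  have "d a b \<le> d a a' + d a' b"
    by (rule ext_dist_triangle)
  also have "\<dots> \<le> d a a' + (d a' b' + d b' b)"
    by (intro add_left_mono ext_dist_triangle)
  finally show ?thesis
    by (simp add: add.assoc)
qed

text \<open>Differences of values in \<open>[0,\<infinity>]\<close> are useless at \<infinity>, so
  convergence comes from \<open>limsup \<le> liminf\<close> with an additive error. Sequences at
  infinite distance from each other are thereby included.\<close>

lemma convergent_dist:
  assumes "dist_Cauchy Y d x" "dist_Cauchy Y d y"
  obtains L where "(\<lambda>n. d (x n) (y n)) \<longlonglongrightarrow> L"
proof -
  let ?a = "\<lambda>n. d (x n) (y n)"
  have "limsup ?a \<le> liminf ?a"
  proof (rule ennreal_le_epsilon)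
    fix e :: real assume "e > 0"
    then have "0 < ennreal (e / 2)" by simp
    then obtain K1 K2 where
      "\<forall>m\<ge>K1. \<forall>n\<ge>K1. d (x m) (x n) < ennreal (e / 2)"
      "\<forall>m\<ge>K2. \<forall>n\<ge>K2. d (y m) (y n) < ennreal (e / 2)"
      using assms unfolding dist_Cauchy_def by metis
    then have K: "d (x m) (x n) \<le> ennreal (e / 2)" "d (y m) (y n) \<le> ennreal (e / 2)"
      if "m \<ge> max K1 K2" "n \<ge> max K1 K2" for m n
      using that by (auto intro: less_imp_le)
    have le: "?a n \<le> ?a m + ennreal e" if mn: "m \<ge> max K1 K2" "n \<ge> max K1 K2" for m n
    proof -
      have "?a n \<le> d (x n) (x m) + d (x m) (y m) + d (y m) (y n)"
        by (rule dist_quadrangle)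
      also have "\<dots> \<le> ennreal (e / 2) + d (x m) (y m) + ennreal (e / 2)"
        by (intro add_mono K order_refl mn)
      also have "\<dots> = ?a m + (ennreal (e / 2) + ennreal (e / 2))"
        by (simp add: ac_simps)
      also have "ennreal (e / 2) + ennreal (e / 2) = ennreal e"
        using \<open>e > 0\<close> by (simp flip: ennreal_plus)
      finally show ?thesis .
    qed
    have "limsup ?a \<le> ?a m + ennreal e" if "m \<ge> max K1 K2" for m
      by (intro Limsup_bounded eventually_sequentiallyI[of "max K1 K2"] le that)
    then have "limsup ?a \<le> liminf (\<lambda>m. ?a m + ennreal e)"
      by (intro Liminf_bounded eventually_sequentiallyI[of "max K1 K2"]) auto
    also have "\<dots> = liminf ?a + ennreal e"
      by (rule Liminf_add_const) simp
    finally show "limsup ?a \<le> liminf ?a + ennreal e" .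
  qed
  then have "?a \<longlonglongrightarrow> liminf ?a"
    by (simp add: tendsto_iff_Liminf_eq_Limsup antisym Liminf_le_Limsup)
  then show ?thesis ..
qed

text \<open>Replacing both sequences by equivalent ones changes their distances by quantities that
  tend to 0. All representatives thus share one limit, and the description in
  \<open>completion_dist\<close> determines it.\<close>

lemma completion_dist_tendsto:
  assumes x: "dist_Cauchy Y d x" and y: "dist_Cauchy Y d y"
  shows "(\<lambda>n. d (x n) (y n)) \<longlonglongrightarrow>
    completion_dist d (Cauchy_equiv Y d `` {x}) (Cauchy_equiv Y d `` {y})"
proof -
  obtain L where L: "(\<lambda>n. d (x n) (y n)) \<longlonglongrightarrow> L"
    using convergent_dist[OF x y] .
  have "(\<lambda>n. d (x' n) (y' n)) \<longlonglongrightarrow> L"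
    if x': "(x, x') \<in> Cauchy_equiv Y d" and y': "(y, y') \<in> Cauchy_equiv Y d" for x' y'
  proof -
    obtain L' where L': "(\<lambda>n. d (x' n) (y' n)) \<longlonglongrightarrow> L'"
      using convergent_dist x' y' by (metis (no_types, lifting) Cauchy_equiv_def case_prodD mem_Collect_eq)
    have 0: "(\<lambda>n. d (x n) (x' n)) \<longlonglongrightarrow> 0" "(\<lambda>n. d (y n) (y' n)) \<longlonglongrightarrow> 0"
      using x' y' by (auto simp: Cauchy_equiv_def)
    then have zero': "(\<lambda>n. d (x' n) (x n)) \<longlonglongrightarrow> 0" "(\<lambda>n. d (y' n) (y n)) \<longlonglongrightarrow> 0"
      by (simp_all add: ext_dist_sym)
    have "L \<le> 0 + L' + 0"
      by (rule LIMSEQ_le[OF L tendsto_add[OF tendsto_add[OF 0(1) L'] zero'(2)]]) (simp add: dist_quadrangle)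
    moreover have "L' \<le> 0 + L + 0"
      by (rule LIMSEQ_le[OF L' tendsto_add[OF tendsto_add[OF zero'(1) L] 0(2)]]) (simp add: dist_quadrangle)
    ultimately show ?thesis
      using L' by simp
  qed
  then have all: "\<forall>x'\<in>Cauchy_equiv Y d `` {x}. \<forall>y'\<in>Cauchy_equiv Y d `` {y}. (\<lambda>n. d (x' n) (y' n)) \<longlonglongrightarrow> L"
    by blast
  have self: "x \<in> Cauchy_equiv Y d `` {x}" "y \<in> Cauchy_equiv Y d `` {y}"
    using equiv_class_self[OF equiv_Cauchy_equiv] x y by auto
  have "completion_dist d (Cauchy_equiv Y d `` {x}) (Cauchy_equiv Y d `` {y}) = L"
    unfolding completion_dist_def
  proof (rule the_equality, rule all)
    fix L' assume "\<forall>x'\<in>Cauchy_equiv Y d `` {x}. \<forall>y'\<in>Cauchy_equiv Y d `` {y}. (\<lambda>n. d (x' n) (y' n)) \<longlonglongrightarrow> L'"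
    then have "(\<lambda>n. d (x n) (y n)) \<longlonglongrightarrow> L'"
      using self by blast
    then show "L' = L"
      using L by (rule LIMSEQ_unique)
  qed
  then show ?thesis
    using L by simp
qed

text \<open>This replaces the two descriptions in \<open>boundary_dist\<close> by a limit along
  freely chosen sequences. The common class of all interior sequences at \<open>z\<close> is
  \<open>completion_point\<close>: any other candidate shares \<open>x\<close> with it and coincides
  with it, because distinct classes are disjoint.\<close>

lemma boundary_dist_tendsto:
  assumes z: "\<And>u v. range u \<subseteq> Y \<Longrightarrow> range v \<subseteq> Y \<Longrightarrow> u \<longlonglongrightarrow> z \<Longrightarrow> v \<longlonglongrightarrow> z \<Longrightarrow> (u, v) \<in> Cauchy_equiv Y d"
    and z': "\<And>u v. range u \<subseteq> Y \<Longrightarrow> range v \<subseteq> Y \<Longrightarrow> u \<longlonglongrightarrow> z' \<Longrightarrow> v \<longlonglongrightarrow> z' \<Longrightarrow> (u, v) \<in> Cauchy_equiv Y d"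
    and x: "range x \<subseteq> Y" "x \<longlonglongrightarrow> z" and y: "range y \<subseteq> Y" "y \<longlonglongrightarrow> z'"
  shows "(\<lambda>n. d (x n) (y n)) \<longlonglongrightarrow> boundary_dist Y d z z'"
proof -
  have cp: "completion_point Y d w = Cauchy_equiv Y d `` {u}" and Cauchy: "dist_Cauchy Y d u"
    if w: "\<And>u v. range u \<subseteq> Y \<Longrightarrow> range v \<subseteq> Y \<Longrightarrow> u \<longlonglongrightarrow> w \<Longrightarrow> v \<longlonglongrightarrow> w \<Longrightarrow> (u, v) \<in> Cauchy_equiv Y d"
      and u: "range u \<subseteq> Y" "u \<longlonglongrightarrow> w" for w u
  proof -
    show uC: "dist_Cauchy Y d u"
      using w[of u u] u by (auto simp: Cauchy_equiv_def)
    show "completion_point Y d w = Cauchy_equiv Y d `` {u}"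
      unfolding completion_point_def
    proof (rule the_equality)
      show "Cauchy_equiv Y d `` {u} \<in> completion Y d \<and>
          (\<forall>x. range x \<subseteq> Y \<and> x \<longlonglongrightarrow> w \<longrightarrow> x \<in> Cauchy_equiv Y d `` {u})"
        using w u uC by (auto simp: completion_def intro: quotientI)
      fix P assume "P \<in> completion Y d \<and> (\<forall>x. range x \<subseteq> Y \<and> x \<longlonglongrightarrow> w \<longrightarrow> x \<in> P)"
      then have P: "P \<in> completion Y d" "u \<in> P"
        using u by auto
      then obtain a where "P = Cauchy_equiv Y d `` {a}"
        by (auto simp: completion_def elim: quotientE)
      then show "P = Cauchy_equiv Y d `` {u}"
        using equiv_class_eq[OF equiv_Cauchy_equiv, of a u] P(2) by auto
    qed
  qed
  show ?thesis
    using completion_dist_tendsto[OF Cauchy[OF z x] Cauchy[OF z' y]]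
    by (simp add: boundary_dist_def cp[OF z x] cp[OF z' y])
qed

end

section \<open>Lengths of curves\<close>

text \<open>The nonnegative integral of an arbitrary function is a supremum over simple functions below it,
  so the following two inequalities hold without measurability; it is thus not needed that the
  speed of a curve is measurable.\<close>

lemma nn_integral_real_affine_le:
  fixes f :: "real \<Rightarrow> ennreal"
  assumes "c \<noteq> 0"
  shows "(\<integral>\<^sup>+x. ennreal \<bar>c\<bar> * f (t + c * x) \<partial>lborel) \<le> (\<integral>\<^sup>+x. f x \<partial>lborel)"
  unfolding nn_integral_def[of lborel "\<lambda>x. ennreal \<bar>c\<bar> * f (t + c * x)"]
proof (rule SUP_least)
  fix g assume "g \<in> {g. simple_function lborel g \<and> g \<le> (\<lambda>x. ennreal \<bar>c\<bar> * f (t + c * x))}"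
  then have g: "simple_function lborel g" "\<And>x. g x \<le> ennreal \<bar>c\<bar> * f (t + c * x)"
    by (auto simp: le_fun_def)
  have [measurable]: "g \<in> borel_measurable borel"
    using borel_measurable_simple_function[OF g(1)] by simp
  \<comment> \<open>\<open>g\<close> transported back along the affine map. It is measurable, so the
    exact substitution rule applies to it, and it lies below \<open>f\<close>.\<close>
  define G where "G x = ennreal (1 / \<bar>c\<bar>) * g ((x - t) / c)" for x
  have "integral\<^sup>S lborel g = (\<integral>\<^sup>+x. g x \<partial>lborel)"
    by (rule nn_integral_eq_simple_integral[OF g(1), symmetric])
  also have "\<dots> = (\<integral>\<^sup>+x. ennreal \<bar>c\<bar> * G (t + c * x) \<partial>lborel)"
    using assms by (intro nn_integral_cong) (simp add: G_def mult.assoc[symmetric] ennreal_mult[symmetric])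
  also have "\<dots> = ennreal \<bar>c\<bar> * (\<integral>\<^sup>+x. G (t + c * x) \<partial>lborel)"
    unfolding G_def by (intro nn_integral_cmult) measurable
  also have "\<dots> = (\<integral>\<^sup>+x. G x \<partial>lborel)"
    unfolding G_def using assms by (intro nn_integral_real_affine[symmetric]) measurable
  also have "\<dots> \<le> (\<integral>\<^sup>+x. f x \<partial>lborel)"
  proof (rule nn_integral_mono)
    fix x
    have "G x \<le> ennreal (1 / \<bar>c\<bar>) * (ennreal \<bar>c\<bar> * f x)"
      unfolding G_def using g(2)[of "(x - t) / c"] assms by (intro mult_left_mono) auto
    then show "G x \<le> f x"
      using assms by (simp add: mult.assoc[symmetric] ennreal_mult[symmetric])
  qed
  finally show "integral\<^sup>S lborel g \<le> (\<integral>\<^sup>+x. f x \<partial>lborel)" .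
qed

lemma nn_integral_split_le:
  fixes f :: "'a \<Rightarrow> ennreal"
  assumes "S \<in> sets M"
  shows "(\<integral>\<^sup>+x. f x \<partial>M) \<le> (\<integral>\<^sup>+x\<in>S. f x \<partial>M) + (\<integral>\<^sup>+x\<in>space M - S. f x \<partial>M)"
  unfolding nn_integral_def[of M f]
proof (rule SUP_least)
  fix g assume "g \<in> {g. simple_function M g \<and> g \<le> f}"
  then have g: "simple_function M g" "g \<le> f" by auto
  have [measurable]: "g \<in> borel_measurable M" "S \<in> sets M"
    using borel_measurable_simple_function[OF g(1)] assms by auto
  have "integral\<^sup>S M g = (\<integral>\<^sup>+x. g x \<partial>M)"
    by (rule nn_integral_eq_simple_integral[OF g(1), symmetric])
  also have "\<dots> = (\<integral>\<^sup>+x. g x * indicator S x + g x * indicator (space M - S) x \<partial>M)"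
    by (intro nn_integral_cong) (auto simp: indicator_def)
  also have "\<dots> = (\<integral>\<^sup>+x\<in>S. g x \<partial>M) + (\<integral>\<^sup>+x\<in>space M - S. g x \<partial>M)"
    by (intro nn_integral_add) measurable
  also have "\<dots> \<le> (\<integral>\<^sup>+x\<in>S. f x \<partial>M) + (\<integral>\<^sup>+x\<in>space M - S. f x \<partial>M)"
    by (intro add_mono nn_integral_mono mult_right_mono) (use g(2) in \<open>auto simp: le_fun_def\<close>)
  finally show "integral\<^sup>S M g \<le> (\<integral>\<^sup>+x\<in>S. f x \<partial>M) + (\<integral>\<^sup>+x\<in>space M - S. f x \<partial>M)" .
qed

text \<open>The chain rule, used for the reversal of a curve (\<open>h = -1\<close>) and for the two
  halves of a join (\<open>h = 2\<close>).\<close>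

lemma C1_curve_affine:
  assumes \<gamma>: "C1_curve A \<gamma> a b" and "h \<noteq> 0"
    and sub: "\<And>t. t \<in> {a'..b'} \<Longrightarrow> h * t + s \<in> {a..b}"
    and eq: "\<And>t. t \<in> {a'..b'} \<Longrightarrow> \<gamma>' t = \<gamma> (h * t + s)"
  shows "C1_curve A \<gamma>' a' b'"
  unfolding C1_curve_def
proof
  fix c assume "c \<in> A"
  then obtain D where D: "continuous_on {t\<in>{a..b}. \<gamma> t \<in> chart_dom c} D"
    "\<And>t. t\<in>{a..b} \<Longrightarrow> \<gamma> t \<in> chart_dom c \<Longrightarrow> ((coord c \<circ> \<gamma>) has_vector_derivative D t) (at t within {a..b})"
    using \<gamma> unfolding C1_curve_def by blast
  have "continuous_on {t\<in>{a'..b'}. \<gamma>' t \<in> chart_dom c} (\<lambda>t. h *\<^sub>R D (h * t + s))"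
    by (intro continuous_intros continuous_on_compose2[OF D(1)]) (use sub eq in auto)
  moreover have "((coord c \<circ> \<gamma>') has_vector_derivative h *\<^sub>R D (h * t + s)) (at t within {a'..b'})"
    if t: "t \<in> {a'..b'}" "\<gamma>' t \<in> chart_dom c" for t
  proof -
    have "((coord c \<circ> \<gamma> \<circ> (\<lambda>t. h * t + s)) has_vector_derivative h *\<^sub>R D (h * t + s)) (at t within {a'..b'})"
    proof (rule vector_diff_chain_within)
      show "((\<lambda>t. h * t + s) has_vector_derivative h) (at t within {a'..b'})"
        by (auto intro!: derivative_eq_intros)
      show "(coord c \<circ> \<gamma> has_vector_derivative D (h * t + s)) (at (h * t + s) within (\<lambda>t. h * t + s) ` {a'..b'})"
        by (rule has_vector_derivative_within_subset[OF D(2)]) (use sub eq t in auto)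
    qed
    then show ?thesis
      by (rule has_vector_derivative_transform[OF t(1), rotated]) (use eq in auto)
  qed
  ultimately show "\<exists>D. continuous_on {t\<in>{a'..b'}. \<gamma>' t \<in> chart_dom c} D \<and>
        (\<forall>t\<in>{a'..b'}. \<gamma>' t \<in> chart_dom c \<longrightarrow>
           ((coord c \<circ> \<gamma>') has_vector_derivative D t) (at t within {a'..b'}))"
    by blast
qed

lemma break_point_interval:
  fixes \<tau> :: "nat \<Rightarrow> real"
  assumes "\<tau> 0 < t" "t < \<tau> k" "t \<notin> \<tau> ` {..k}"
  shows "\<exists>j<k. \<tau> j < t \<and> t < \<tau> (Suc j)"
  using assms
proof (induction k)
  case (Suc k)
  then show ?case
  proof (cases "t < \<tau> k")
    case True
    then show ?thesis using Suc by (force simp: less_Suc_eq)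
  next
    case False
    moreover have "t \<noteq> \<tau> k" using Suc.prems by auto
    ultimately show ?thesis using Suc.prems by (intro exI[of _ k]) auto
  qed
qed auto

text \<open>Strictly inside a piece the one-sided derivatives are two-sided. \<open>B\<close> is the
  set of break points, with both ends of the parameter interval, and is negligible for
  lengths.\<close>

lemma piecewise_C1_curve_has_derivative:
  assumes "piecewise_C1_curve A \<gamma>"
  obtains B where "finite B" "0 \<in> B" "1 \<in> B"
    and "\<And>t c. t \<in> {0..1} - B \<Longrightarrow> c \<in> A \<Longrightarrow> \<gamma> t \<in> chart_dom c \<Longrightarrow>
      ((coord c \<circ> \<gamma>) has_vector_derivative vector_derivative (coord c \<circ> \<gamma>) (at t)) (at t)"
proof -
  obtain k \<tau> where \<tau>: "\<tau> 0 = 0" "\<tau> k = 1" "\<And>j. j < k \<Longrightarrow> \<tau> j < \<tau> (Suc j)"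
      "\<And>j. j < k \<Longrightarrow> C1_curve A \<gamma> (\<tau> j) (\<tau> (Suc j))"
    using assms unfolding piecewise_C1_curve_def by blast
  show ?thesis
  proof (rule that[of "\<tau> ` {..k}"])
    show "0 \<in> \<tau> ` {..k}" "1 \<in> \<tau> ` {..k}"
      using \<tau>(1,2) by (metis atMost_iff image_eqI le0, metis atMost_iff image_eqI order_refl)
    fix t c assume t: "t \<in> {0..1} - \<tau> ` {..k}" "c \<in> A" "\<gamma> t \<in> chart_dom c"
    have "t \<noteq> 0" "t \<noteq> 1"
      using t \<open>0 \<in> \<tau> ` {..k}\<close> \<open>1 \<in> \<tau> ` {..k}\<close> by auto
    then obtain j where j: "j < k" "\<tau> j < t" "t < \<tau> (Suc j)"
      using break_point_interval[of \<tau> t k] t \<tau>(1,2) by auto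
    then obtain D where "((coord c \<circ> \<gamma>) has_vector_derivative D) (at t within {\<tau> j..\<tau> (Suc j)})"
      using \<tau>(4)[OF j(1)] t unfolding C1_curve_def by (metis atLeastAtMost_iff less_imp_le)
    then have "((coord c \<circ> \<gamma>) has_vector_derivative D) (at t)"
      using j by (simp add: at_within_Icc_at)
    then show "((coord c \<circ> \<gamma>) has_vector_derivative vector_derivative (coord c \<circ> \<gamma>) (at t)) (at t)"
      by (simp add: vector_derivative_at)
  qed auto
qed

lemma AE_lborel_notin_finite: "finite B \<Longrightarrow> AE x in lborel. (x::real) \<notin> B"
  by (intro AE_not_in finite_imp_null_set_lborel)

locale chart_metric =
  fixes A :: "('a::topological_space, 'e::euclidean_space) corner_chart set"
    and g :: "('a, 'e) metric_family"
  assumes metric_bilinear: "c \<in> A \<Longrightarrow> p \<in> chart_dom c \<Longrightarrow> bilinear (g c p)"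
begin

text \<open>The chart that \<open>speed\<close> selects depends only on the point reached. Both
  curves pass through the same point, so they select the same chart, and the factor \<bar>h\<bar> is
  the homogeneity of \<open>sqrt (g c p v v)\<close> in \<open>v\<close>.\<close>

lemma speed_affine:
  assumes t: "t \<in> {0<..<1}" "h * t + s \<in> {0<..<1}" and "h \<noteq> 0"
    and "open S" "t \<in> S" and eq: "\<And>u. u \<in> S \<Longrightarrow> \<gamma>' u = \<gamma> (h * u + s)"
    and dom: "\<gamma> (h * t + s) \<in> (\<Union>c\<in>A. chart_dom c)"
    and deriv: "\<And>c. c \<in> A \<Longrightarrow> \<gamma> (h * t + s) \<in> chart_dom c \<Longrightarrow>
      ((coord c \<circ> \<gamma>) has_vector_derivative vector_derivative (coord c \<circ> \<gamma>) (at (h * t + s))) (at (h * t + s))"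
  shows "speed A g \<gamma>' t = \<bar>h\<bar> * speed A g \<gamma> (h * t + s)"
proof -
  have eqt: "\<gamma>' t = \<gamma> (h * t + s)"
    using eq \<open>t \<in> S\<close> .
  define c where "c = (SOME c. c \<in> A \<and> \<gamma> (h * t + s) \<in> chart_dom c)"
  have c: "c \<in> A" "\<gamma> (h * t + s) \<in> chart_dom c"
    unfolding c_def using dom by (metis (mono_tags, lifting) UN_E someI_ex)+
  define v where "v = vector_derivative (coord c \<circ> \<gamma>) (at (h * t + s))"
  have "((coord c \<circ> \<gamma> \<circ> (\<lambda>t. h * t + s)) has_vector_derivative h *\<^sub>R v) (at t)"
  proof (rule vector_diff_chain_at)
    show "((\<lambda>t. h * t + s) has_vector_derivative h) (at t)"
      by (auto intro!: derivative_eq_intros)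
    show "(coord c \<circ> \<gamma> has_vector_derivative v) (at (h * t + s))"
      unfolding v_def by (rule deriv[OF c])
  qed
  then have "((coord c \<circ> \<gamma>') has_vector_derivative h *\<^sub>R v) (at t)"
    by (rule has_vector_derivative_transform_within_open[OF _ \<open>open S\<close> \<open>t \<in> S\<close>]) (simp add: eq)
  then have "vector_derivative (coord c \<circ> \<gamma>') (at t) = h *\<^sub>R v"
    by (rule vector_derivative_at)
  then have "speed A g \<gamma>' t = sqrt (g c (\<gamma> (h * t + s)) (h *\<^sub>R v) (h *\<^sub>R v))"
    using t by (simp add: speed_def eqt c_def[symmetric] Let_def at_within_Icc_at)
  also have "g c (\<gamma> (h * t + s)) (h *\<^sub>R v) (h *\<^sub>R v) = h\<^sup>2 * g c (\<gamma> (h * t + s)) v v"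
    using metric_bilinear[OF c] by (simp add: bilinear_lmul bilinear_rmul power2_eq_square)
  also have "sqrt \<dots> = \<bar>h\<bar> * sqrt (g c (\<gamma> (h * t + s)) v v)"
    by (simp add: real_sqrt_mult)
  also have "sqrt (g c (\<gamma> (h * t + s)) v v) = speed A g \<gamma> (h * t + s)"
    using t by (simp add: speed_def c_def[symmetric] Let_def at_within_Icc_at v_def)
  finally show ?thesis .
qed

text \<open>For nonmeasurable integrands substitution is an inequality, in the direction that is
  wanted here: reversed and joined curves must not become longer. The hypotheses concern the open
  interval so that the two halves of a join can be treated apart.\<close>

lemma length_affine_le:
  assumes \<gamma>: "piecewise_C1_curve A \<gamma>" "\<gamma> ` {0..1} \<subseteq> (\<Union>c\<in>A. chart_dom c)" and "h \<noteq> 0"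
    and sub: "\<And>t. t \<in> {a<..<b} \<Longrightarrow> t \<in> {0<..<1} \<and> h * t + s \<in> {0<..<1}"
    and eq: "\<And>t. t \<in> {a<..<b} \<Longrightarrow> \<gamma>' t = \<gamma> (h * t + s)"
  shows "(\<integral>\<^sup>+t\<in>{a..b}. ennreal (speed A g \<gamma>' t) \<partial>lborel) \<le> curve_length A g \<gamma>"
proof -
  obtain B where B: "finite B" "0 \<in> B" "1 \<in> B"
    "\<And>t c. t \<in> {0..1} - B \<Longrightarrow> c \<in> A \<Longrightarrow> \<gamma> t \<in> chart_dom c \<Longrightarrow>
      ((coord c \<circ> \<gamma>) has_vector_derivative vector_derivative (coord c \<circ> \<gamma>) (at t)) (at t)"
    using piecewise_C1_curve_has_derivative[OF \<gamma>(1)] by blast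
  \<comment> \<open>The times that are carried to break points of \<open>\<gamma>\<close>, and the
    two end points: a null set.\<close>
  define B' where "B' = (\<lambda>t. (t - s) / h) ` B \<union> {a, b}"
  have "finite B'" using B(1) by (simp add: B'_def)
  let ?f = "\<lambda>u. ennreal (speed A g \<gamma> u) * indicator {0..1} u"
  have sp: "speed A g \<gamma>' t = \<bar>h\<bar> * speed A g \<gamma> (h * t + s)" if t: "t \<in> {a<..<b}" "t \<notin> B'" for t
  proof (rule speed_affine)
    show "open {a<..<b}" "\<And>u. u \<in> {a<..<b} \<Longrightarrow> \<gamma>' u = \<gamma> (h * u + s)"
      using eq by auto
    have "h * t + s \<notin> B"
      using t(2) \<open>h \<noteq> 0\<close> by (force simp: B'_def image_iff)
    then show "\<And>c. c \<in> A \<Longrightarrow> \<gamma> (h * t + s) \<in> chart_dom c \<Longrightarrow>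
      ((coord c \<circ> \<gamma>) has_vector_derivative vector_derivative (coord c \<circ> \<gamma>) (at (h * t + s))) (at (h * t + s))"
      using B(4) sub[OF t(1)] by auto
    show "\<gamma> (h * t + s) \<in> (\<Union>c\<in>A. chart_dom c)"
      using \<gamma>(2) sub[OF t(1)] by (force simp: image_subset_iff)
  qed (use sub[OF t(1)] t(1) \<open>h \<noteq> 0\<close> in auto)
  have "(\<integral>\<^sup>+t\<in>{a..b}. ennreal (speed A g \<gamma>' t) \<partial>lborel) \<le> (\<integral>\<^sup>+t. ennreal \<bar>h\<bar> * ?f (s + h * t) \<partial>lborel)"
  proof (rule nn_integral_mono_AE, rule AE_mp[OF AE_lborel_notin_finite[OF \<open>finite B'\<close>]], rule AE_I2, rule impI)
    fix t assume "t \<notin> B'"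
    show "ennreal (speed A g \<gamma>' t) * indicator {a..b} t \<le> ennreal \<bar>h\<bar> * ?f (s + h * t)"
    proof (cases "t \<in> {a<..<b}")
      case True
      then show ?thesis
        using sp[OF True \<open>t \<notin> B'\<close>] sub[OF True] by (simp add: ennreal_mult' indicator_def add.commute)
    next
      case False
      then have "t \<notin> {a..b}" using \<open>t \<notin> B'\<close> by (auto simp: B'_def)
      then show ?thesis by simp
    qed
  qed
  also have "\<dots> \<le> (\<integral>\<^sup>+t. ?f t \<partial>lborel)"
    by (rule nn_integral_real_affine_le[OF \<open>h \<noteq> 0\<close>])
  finally show ?thesis
    by (simp add: curve_length_def)
qed

section \<open>Symmetry and the triangle inequality of the Riemannian distance\<close>

lemma riemannian_dist_sym_le:
  assumes Y: "Y \<subseteq> (\<Union>c\<in>A. chart_dom c)"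
  shows "riemannian_dist Y A g q p \<le> riemannian_dist Y A g p q"
  unfolding riemannian_dist_def[of Y A g p q]
proof (rule INF_greatest, clarsimp)
  fix \<gamma> assume \<gamma>: "piecewise_C1_curve A \<gamma>" "\<gamma> ` {0..1} \<subseteq> Y" and p: "p = \<gamma> 0" and q: "q = \<gamma> 1"
  obtain k \<tau> where \<tau>: "\<tau> 0 = 0" "\<tau> k = 1" "\<And>j. j < k \<Longrightarrow> \<tau> j < \<tau> (Suc j)"
      "\<And>j. j < k \<Longrightarrow> C1_curve A \<gamma> (\<tau> j) (\<tau> (Suc j))" and cont: "continuous_on {0..1} \<gamma>"
    using \<gamma>(1) unfolding piecewise_C1_curve_def by blast
  have "piecewise_C1_curve A (reversepath \<gamma>)"
    unfolding piecewise_C1_curve_def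
  proof (intro conjI exI[of _ k] exI[of _ "\<lambda>j. 1 - \<tau> (k - j)"] allI impI)
    show "continuous_on {0..1} (reversepath \<gamma>)"
      using path_reversepath[of \<gamma>] cont by (simp add: path_def)
    fix j assume j: "j < k"
    then have k: "k - j = Suc (k - Suc j)" "k - Suc j < k" by auto
    show "1 - \<tau> (k - j) < 1 - \<tau> (k - Suc j)"
      using \<tau>(3)[OF k(2)] k(1) by simp
    show "C1_curve A (reversepath \<gamma>) (1 - \<tau> (k - j)) (1 - \<tau> (k - Suc j))"
      by (rule C1_curve_affine[OF \<tau>(4)[OF k(2)], where h = "-1" and s = 1])
        (auto simp: reversepath_def k(1))
  qed (use \<tau> in auto)
  moreover have "reversepath \<gamma> ` {0..1} \<subseteq> Y"
    using \<gamma>(2) path_image_reversepath[of \<gamma>] by (simp add: path_image_def)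
  moreover have "curve_length A g (reversepath \<gamma>) \<le> curve_length A g \<gamma>"
    unfolding curve_length_def[of A g "reversepath \<gamma>"]
    by (rule length_affine_le[where h = "-1" and s = 1]) (use \<gamma> Y in \<open>auto simp: reversepath_def\<close>)
  ultimately show "riemannian_dist Y A g (\<gamma> 1) (\<gamma> 0) \<le> curve_length A g \<gamma>"
    unfolding riemannian_dist_def by (intro INF_lower2[of "reversepath \<gamma>"]) (auto simp: reversepath_def)
qed

lemma piecewise_C1_join:
  assumes \<gamma>1: "piecewise_C1_curve A \<gamma>1" and \<gamma>2: "piecewise_C1_curve A \<gamma>2" and eq: "\<gamma>1 1 = \<gamma>2 0"
  shows "piecewise_C1_curve A (\<gamma>1 +++ \<gamma>2)"
proof -
  obtain k1 \<tau>1 where \<tau>1: "\<tau>1 0 = 0" "\<tau>1 k1 = 1" "\<And>j. j < k1 \<Longrightarrow> \<tau>1 j < \<tau>1 (Suc j)"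
      "\<And>j. j < k1 \<Longrightarrow> C1_curve A \<gamma>1 (\<tau>1 j) (\<tau>1 (Suc j))"
    using \<gamma>1 unfolding piecewise_C1_curve_def by blast
  obtain k2 \<tau>2 where \<tau>2: "\<tau>2 0 = 0" "\<tau>2 k2 = 1" "\<And>j. j < k2 \<Longrightarrow> \<tau>2 j < \<tau>2 (Suc j)"
      "\<And>j. j < k2 \<Longrightarrow> C1_curve A \<gamma>2 (\<tau>2 j) (\<tau>2 (Suc j))"
    using \<gamma>2 unfolding piecewise_C1_curve_def by blast
  have le1: "\<tau>1 j \<le> 1" if "j \<le> k1" for j
    using that by (induction j rule: inc_induct) (use \<tau>1(2,3) in \<open>auto intro: less_imp_le order_trans\<close>)
  have ge0: "0 \<le> \<tau>2 j" if "j \<le> k2" for j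
    using that by (induction j) (use \<tau>2(1,3) in \<open>auto simp: Suc_le_eq intro: less_imp_le order_trans\<close>)
  \<comment> \<open>The break points of the first curve are halved, those of the second are halved
    and shifted. Index \<open>k1\<close> falls into the first branch; both branches give
    \<open>1 / 2\<close> there.\<close>
  define \<tau> where "\<tau> j = (if j \<le> k1 then \<tau>1 j / 2 else 1 / 2 + \<tau>2 (j - k1) / 2)" for j
  show ?thesis
    unfolding piecewise_C1_curve_def
  proof (intro conjI exI[of _ "k1 + k2"] exI[of _ \<tau>] allI impI)
    show "continuous_on {0..1} (\<gamma>1 +++ \<gamma>2)"
      using path_join_imp[of \<gamma>1 \<gamma>2] \<gamma>1 \<gamma>2 eq
      by (simp add: path_def piecewise_C1_curve_def pathfinish_def pathstart_def)
    show "\<tau> 0 = 0"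
      using \<tau>1 by (simp add: \<tau>_def)
    show "\<tau> (k1 + k2) = 1"
      using \<tau>1 \<tau>2 by (cases "k2 = 0") (simp_all add: \<tau>_def)
    fix j assume j: "j < k1 + k2"
    show "\<tau> j < \<tau> (Suc j)" and "C1_curve A (\<gamma>1 +++ \<gamma>2) (\<tau> j) (\<tau> (Suc j))"
    proof (atomize (full), cases "j < k1")
      case True
      then have \<tau>: "\<tau> j = \<tau>1 j / 2" "\<tau> (Suc j) = \<tau>1 (Suc j) / 2"
        by (auto simp: \<tau>_def)
      have "C1_curve A (\<gamma>1 +++ \<gamma>2) (\<tau> j) (\<tau> (Suc j))"
        by (rule C1_curve_affine[OF \<tau>1(4)[OF True], where h = 2 and s = 0])
          (use le1[of "Suc j"] True in \<open>auto simp: \<tau> joinpaths_def\<close>)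
      then show "\<tau> j < \<tau> (Suc j) \<and> C1_curve A (\<gamma>1 +++ \<gamma>2) (\<tau> j) (\<tau> (Suc j))"
        using \<tau>1(3)[OF True] by (simp add: \<tau>)
    next
      case False
      then have \<tau>: "\<tau> j = 1 / 2 + \<tau>2 (j - k1) / 2" "\<tau> (Suc j) = 1 / 2 + \<tau>2 (Suc (j - k1)) / 2"
        using \<tau>1(2) \<tau>2(1) by (auto simp: \<tau>_def Suc_diff_le)
      have j': "j - k1 < k2"
        using False j by simp
      have "C1_curve A (\<gamma>1 +++ \<gamma>2) (\<tau> j) (\<tau> (Suc j))"
      proof (rule C1_curve_affine[OF \<tau>2(4)[OF j'], where h = 2 and s = "-1"])
        fix t assume t: "t \<in> {\<tau> j..\<tau> (Suc j)}"
        then have "1 / 2 \<le> t"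
          using ge0[of "j - k1"] j' by (auto simp: \<tau>)
        \<comment> \<open>At \<open>t = 1 / 2\<close> the join still follows
          \<open>\<gamma>1\<close>; the value there is \<open>\<gamma>2 0\<close> by
          \<open>eq\<close>.\<close>
        then show "(\<gamma>1 +++ \<gamma>2) t = \<gamma>2 (2 * t + - 1)"
          using eq by (cases "t = 1 / 2", hypsubst) (simp_all add: joinpaths_def)
      qed (auto simp: \<tau>)
      then show "\<tau> j < \<tau> (Suc j) \<and> C1_curve A (\<gamma>1 +++ \<gamma>2) (\<tau> j) (\<tau> (Suc j))"
        using \<tau>2(3)[OF j'] by (simp add: \<tau>)
    qed
  qed
qed

text \<open>Almost shortest curves are joined, and the length of the join is split at
  \<open>1 / 2\<close> by \<open>nn_integral_split_le\<close>, valid for arbitrary speeds. Curves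
  within \<open>e / 2\<close> of the infimum are available when both distances are finite, hence the
  case distinction.\<close>

lemma riemannian_dist_triangle:
  assumes Y: "Y \<subseteq> (\<Union>c\<in>A. chart_dom c)"
  shows "riemannian_dist Y A g p r \<le> riemannian_dist Y A g p q + riemannian_dist Y A g q r"
proof -
  let ?C = "\<lambda>p q. {\<gamma>. piecewise_C1_curve A \<gamma> \<and> \<gamma> ` {0..1} \<subseteq> Y \<and> \<gamma> 0 = p \<and> \<gamma> 1 = q}"
  have le: "riemannian_dist Y A g p r \<le> curve_length A g \<gamma>1 + curve_length A g \<gamma>2"
    if \<gamma>1: "\<gamma>1 \<in> ?C p q" and \<gamma>2: "\<gamma>2 \<in> ?C q r" for \<gamma>1 \<gamma>2
  proof -
    let ?\<gamma> = "\<gamma>1 +++ \<gamma>2"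
    let ?f = "\<lambda>t. ennreal (speed A g ?\<gamma> t) * indicator {0..1} t"
    have "piecewise_C1_curve A ?\<gamma>"
      using \<gamma>1 \<gamma>2 by (intro piecewise_C1_join) auto
    moreover have "?\<gamma> ` {0..1} \<subseteq> Y"
      using \<gamma>1 \<gamma>2 path_image_join_subset[of \<gamma>1 \<gamma>2] by (auto simp: path_image_def)
    moreover have "?\<gamma> 0 = p" "?\<gamma> 1 = r"
      using \<gamma>1 \<gamma>2 by (auto simp: joinpaths_def)
    ultimately have "riemannian_dist Y A g p r \<le> curve_length A g ?\<gamma>"
      unfolding riemannian_dist_def by (intro INF_lower) auto
    also have "\<dots> \<le> (\<integral>\<^sup>+t\<in>{0..1/2}. ?f t \<partial>lborel) + (\<integral>\<^sup>+t\<in>space lborel - {0..1/2}. ?f t \<partial>lborel)"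
      unfolding curve_length_def by (rule nn_integral_split_le) simp
    also have "\<dots> \<le> (\<integral>\<^sup>+t\<in>{0..1/2}. ennreal (speed A g ?\<gamma> t) \<partial>lborel) +
        (\<integral>\<^sup>+t\<in>{1/2..1}. ennreal (speed A g ?\<gamma> t) \<partial>lborel)"
      by (intro add_mono nn_integral_mono) (auto simp: indicator_def)
    also have "\<dots> \<le> curve_length A g \<gamma>1 + curve_length A g \<gamma>2"
    proof (rule add_mono)
      show "(\<integral>\<^sup>+t\<in>{0..1/2}. ennreal (speed A g ?\<gamma> t) \<partial>lborel) \<le> curve_length A g \<gamma>1"
        by (rule length_affine_le[where h = 2 and s = 0]) (use \<gamma>1 Y in \<open>auto simp: joinpaths_def\<close>)
      show "(\<integral>\<^sup>+t\<in>{1/2..1}. ennreal (speed A g ?\<gamma> t) \<partial>lborel) \<le> curve_length A g \<gamma>2"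
        by (rule length_affine_le[where h = 2 and s = "-1"]) (use \<gamma>2 Y in \<open>auto simp: joinpaths_def\<close>)
    qed
    finally show ?thesis .
  qed
  show ?thesis
  proof (cases "riemannian_dist Y A g p q = \<infinity> \<or> riemannian_dist Y A g q r = \<infinity>")
    case True
    then show ?thesis by auto
  next
    case False
    show ?thesis
    proof (rule ennreal_le_epsilon)
      fix e :: real assume "0 < e"
      have *: "riemannian_dist Y A g p q < riemannian_dist Y A g p q + ennreal (e / 2)"
        "riemannian_dist Y A g q r < riemannian_dist Y A g q r + ennreal (e / 2)"
        using False \<open>0 < e\<close> by (simp_all add: ennreal_add_left_cancel_less less_top)
      obtain \<gamma>1 where \<gamma>1: "\<gamma>1 \<in> ?C p q" "curve_length A g \<gamma>1 < riemannian_dist Y A g p q + ennreal (e / 2)"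
        using *(1) unfolding riemannian_dist_def[of Y A g p q] INF_less_iff by blast
      obtain \<gamma>2 where \<gamma>2: "\<gamma>2 \<in> ?C q r" "curve_length A g \<gamma>2 < riemannian_dist Y A g q r + ennreal (e / 2)"
        using *(2) unfolding riemannian_dist_def[of Y A g q r] INF_less_iff by blast
      have "riemannian_dist Y A g p r \<le> curve_length A g \<gamma>1 + curve_length A g \<gamma>2"
        by (rule le[OF \<gamma>1(1) \<gamma>2(1)])
      also have "\<dots> \<le> (riemannian_dist Y A g p q + ennreal (e / 2)) + (riemannian_dist Y A g q r + ennreal (e / 2))"
        using \<gamma>1(2) \<gamma>2(2) by (intro add_mono less_imp_le)
      also have "\<dots> = riemannian_dist Y A g p q + riemannian_dist Y A g q r + (ennreal (e / 2) + ennreal (e / 2))"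
        by (simp add: ac_simps)
      also have "ennreal (e / 2) + ennreal (e / 2) = ennreal e"
        using \<open>0 < e\<close> by (simp flip: ennreal_plus)
      finally show "riemannian_dist Y A g p r \<le> riemannian_dist Y A g p q + riemannian_dist Y A g q r + ennreal e" .
    qed
  qed
qed

end

section \<open>Charts and curves\<close>

text \<open>The first-order content of smoothness. As \<open>F\<close> lives on an open set,
  derivatives at corner points can be taken in all directions, and they vary continuously.\<close>

lemma smooth_on_C1:
  assumes "smooth_on S f" "x \<in> S"
  obtains U F F' where "open U" "x \<in> U"
    and "\<And>y. y \<in> U \<Longrightarrow> (F has_derivative F' y) (at y)"
    and "\<And>v. continuous_on U (\<lambda>y. F' y v)"
    and "\<And>y. y \<in> S \<Longrightarrow> y \<in> U \<Longrightarrow> F y = f y"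
proof -
  obtain U F where UF: "open U" "x \<in> U" "\<And>k. Ck_on k U F" "\<And>y. y \<in> S \<inter> U \<Longrightarrow> F y = f y"
    using assms unfolding smooth_on_def by metis
  have "Ck_on (Suc 0) U F" by (rule UF)
  then have "\<And>y. y \<in> U \<Longrightarrow> (F has_derivative frechet_derivative F (at y)) (at y)"
    "\<And>v. continuous_on U (\<lambda>y. frechet_derivative F (at y) v)"
    by (simp_all add: frechet_derivative_works[symmetric])
  then show ?thesis
    using that[of U F "\<lambda>y. frechet_derivative F (at y)"] UF by blast
qed

lemma has_derivative_within_openin_transform:
  assumes "(f has_derivative f') (at x within S)" "openin (top_of_set S) V" "x \<in> V"
    and "\<And>y. y \<in> V \<Longrightarrow> f y = g y"
  shows "(g has_derivative f') (at x within S)"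
proof -
  obtain G where "open G" "V = S \<inter> G"
    using assms(2) by (auto simp: openin_open)
  then have "\<forall>\<^sub>F y in at x within S. f y = g y"
    using assms(3,4) by (auto simp: eventually_at_topological)
  then show ?thesis
    using assms(3,4) openin_imp_subset[OF assms(2)]
    by (intro has_derivative_transform_eventually[OF assms(1)]) auto
qed

lemma smooth_on_has_derivative:
  assumes "smooth_on S f" "x \<in> S"
  obtains T where "(f has_derivative T) (at x within S)"
proof -
  obtain U F F' where UF: "open U" "x \<in> U" "\<And>y. y \<in> U \<Longrightarrow> (F has_derivative F' y) (at y)"
    "\<And>y. y \<in> S \<Longrightarrow> y \<in> U \<Longrightarrow> F y = f y"
    using smooth_on_C1[OF assms] by metis
  have "(f has_derivative F' x) (at x within S)"
    by (rule has_derivative_within_openin_transform[of F _ _ _ "S \<inter> U"])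
      (use UF assms(2) in \<open>auto intro: has_derivative_at_withinI\<close>)
  then show ?thesis ..
qed

lemma smooth_on_imp_continuous_on: "smooth_on S f \<Longrightarrow> continuous_on S f"
  unfolding continuous_on_eq_continuous_within
  by (metis smooth_on_has_derivative has_derivative_continuous)

locale corner_atlas =
  fixes X :: "'a::t2_space set" and A :: "('a, 'e::euclidean_space) corner_chart set"
  assumes atlas: "smooth_corner_atlas X A"
begin

lemma chart: "c \<in> A \<Longrightarrow> is_corner_chart X c"
  using atlas unfolding smooth_corner_atlas_def by blast

lemma dom_Union: "X = (\<Union>c\<in>A. chart_dom c)"
  using atlas unfolding smooth_corner_atlas_def by blast

lemma openin_dom: "c \<in> A \<Longrightarrow> openin (top_of_set X) (chart_dom c)"
  using chart by (simp add: is_corner_chart_def)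

lemma dom_subset: "c \<in> A \<Longrightarrow> chart_dom c \<subseteq> X"
  using openin_dom openin_imp_subset by blast

lemma walls_Basis: "c \<in> A \<Longrightarrow> walls c \<subseteq> Basis"
  using chart by (simp add: is_corner_chart_def)

lemma transition_smooth:
  "c \<in> A \<Longrightarrow> c' \<in> A \<Longrightarrow> smooth_on (coord c ` (chart_dom c \<inter> chart_dom c')) (coord c' \<circ> chart_inv c)"
  using atlas unfolding smooth_corner_atlas_def by blast

lemma homeomorphism_coord:
  assumes "c \<in> A"
  shows "homeomorphism (chart_dom c) (coord c ` chart_dom c) (coord c) (chart_inv c)"
proof -
  obtain \<psi> where \<psi>: "homeomorphism (chart_dom c) (coord c ` chart_dom c) (coord c) \<psi>"
    using chart[OF assms] by (auto simp: is_corner_chart_def)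
  have inj: "inj_on (coord c) (chart_dom c)"
    by (intro inj_on_inverseI[of _ \<psi>] homeomorphism_apply1[OF \<psi>])
  have "chart_inv c x = \<psi> x" if x: "x \<in> coord c ` chart_dom c" for x
  proof -
    from x obtain p where "p \<in> chart_dom c" "x = coord c p" ..
    then show ?thesis
      using inj homeomorphism_apply1[OF \<psi>] by (simp add: chart_inv_def)
  qed
  then show ?thesis
    by (intro homeomorphism_cong[OF \<psi>]) auto
qed

lemma chart_inv_coord: "c \<in> A \<Longrightarrow> p \<in> chart_dom c \<Longrightarrow> chart_inv c (coord c p) = p"
  using homeomorphism_apply1[OF homeomorphism_coord] by blast

lemma coord_chart_inv: "c \<in> A \<Longrightarrow> x \<in> coord c ` chart_dom c \<Longrightarrow> coord c (chart_inv c x) = x"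
  using homeomorphism_apply2[OF homeomorphism_coord] by blast

lemma chart_inv_in_dom: "c \<in> A \<Longrightarrow> x \<in> coord c ` chart_dom c \<Longrightarrow> chart_inv c x \<in> chart_dom c"
  using chart_inv_coord by auto

lemma continuous_on_coord: "c \<in> A \<Longrightarrow> continuous_on (chart_dom c) (coord c)"
  using homeomorphism_cont1[OF homeomorphism_coord] .

lemma continuous_on_chart_inv: "c \<in> A \<Longrightarrow> continuous_on (coord c ` chart_dom c) (chart_inv c)"
  using homeomorphism_cont2[OF homeomorphism_coord] .

lemma coord_image_subset: "c \<in> A \<Longrightarrow> coord c ` chart_dom c \<subseteq> corner_model (walls c)"
  using chart[of c] openin_imp_subset unfolding is_corner_chart_def by blast

lemma openin_coord_image:
  assumes c: "c \<in> A" and W: "openin (top_of_set X) W" "W \<subseteq> chart_dom c"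
  shows "openin (top_of_set (corner_model (walls c))) (coord c ` W)"
proof -
  have "openin (top_of_set (chart_dom c)) W"
    using openin_subset_trans[OF W(1,2)] dom_subset[OF c] by blast
  then have "openin (top_of_set (coord c ` chart_dom c)) (coord c ` W)"
    by (rule homeomorphism_imp_open_map[OF homeomorphism_coord[OF c]])
  then show ?thesis
    using chart[OF c] openin_trans by (auto simp: is_corner_chart_def)
qed

lemma openin_chart_inv_image:
  assumes c: "c \<in> A" and V: "openin (top_of_set (corner_model (walls c))) V" "V \<subseteq> coord c ` chart_dom c"
  shows "openin (top_of_set X) (chart_inv c ` V)"
proof -
  have "openin (top_of_set (coord c ` chart_dom c)) V"
    using openin_subset_trans[OF V(1,2)] coord_image_subset[OF c] by blast
  then have "openin (top_of_set (chart_dom c)) (chart_inv c ` V)"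
    by (rule homeomorphism_imp_open_map[OF homeomorphism_symD[OF homeomorphism_coord[OF c]]])
  then show ?thesis
    using openin_dom[OF c] openin_trans by blast
qed

lemma corner_ball_subset:
  assumes "c \<in> A" "openin (top_of_set X) W" "W \<subseteq> chart_dom c" "p \<in> W"
  obtains R where "0 < R" "corner_model (walls c) \<inter> cball (coord c p) R \<subseteq> coord c ` W"
  using openin_coord_image[OF assms(1-3)] assms(4) unfolding openin_contains_cball
  by (metis Int_commute image_eqI)

lemma transition_derivative:
  assumes "c \<in> A" "c' \<in> A" "p \<in> chart_dom c \<inter> chart_dom c'"
  obtains T where "((coord c' \<circ> chart_inv c) has_derivative T)
    (at (coord c p) within coord c ` (chart_dom c \<inter> chart_dom c'))"
  using smooth_on_has_derivative[OF transition_smooth[OF assms(1,2)]] assms(3) by blast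

text \<open>Change of chart for velocities. The times at which the curve lies in both charts form a
  relatively open set, so restricting to them does not alter the derivative at
  \<open>t\<close>.\<close>

lemma curve_transfer:
  assumes c: "c \<in> A" "c' \<in> A" and \<gamma>: "continuous_on I \<gamma>" "\<gamma> ` I \<subseteq> X"
    and t: "t \<in> I" "\<gamma> t \<in> chart_dom c" "\<gamma> t \<in> chart_dom c'"
    and v: "((coord c \<circ> \<gamma>) has_vector_derivative v) (at t within I)"
  obtains T where "((coord c' \<circ> chart_inv c) has_derivative T)
      (at (coord c (\<gamma> t)) within coord c ` (chart_dom c \<inter> chart_dom c'))"
    and "((coord c' \<circ> \<gamma>) has_vector_derivative T v) (at t within I)"
proof -
  let ?S = "coord c ` (chart_dom c \<inter> chart_dom c')"
  obtain T where T: "((coord c' \<circ> chart_inv c) has_derivative T) (at (coord c (\<gamma> t)) within ?S)"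
    using transition_derivative[OF c, of "\<gamma> t"] t by auto
  define V where "V = I \<inter> \<gamma> -` (chart_dom c \<inter> chart_dom c')"
  have V: "openin (top_of_set I) V"
    unfolding V_def using \<gamma> openin_dom c
    by (intro continuous_openin_preimage[of _ _ X]) (auto simp: image_subset_iff_funcset)
  then obtain G where G: "open G" "V = I \<inter> G"
    by (auto simp: openin_open)
  have "t \<in> V" using t by (simp add: V_def)
  have at: "at t within I = at t within V"
    by (rule at_within_nhd[of _ G]) (use G \<open>t \<in> V\<close> in auto)
  have "((coord c' \<circ> chart_inv c) \<circ> (coord c \<circ> \<gamma>) has_derivative T \<circ> (\<lambda>h. h *\<^sub>R v)) (at t within V)"
  proof (rule diff_chain_within)
    show "(coord c \<circ> \<gamma> has_derivative (\<lambda>h. h *\<^sub>R v)) (at t within V)"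
      using v at by (simp add: has_vector_derivative_def)
    show "(coord c' \<circ> chart_inv c has_derivative T) (at ((coord c \<circ> \<gamma>) t) within (coord c \<circ> \<gamma>) ` V)"
      by (rule has_derivative_subset) (use T in \<open>auto simp: V_def\<close>)
  qed
  moreover have "T \<circ> (\<lambda>h. h *\<^sub>R v) = (\<lambda>h. h *\<^sub>R T v)"
    using has_derivative_linear[OF T] by (auto simp: linear_scale)
  ultimately have "((coord c' \<circ> chart_inv c) \<circ> (coord c \<circ> \<gamma>) has_derivative (\<lambda>h. h *\<^sub>R T v)) (at t within I)"
    using at by simp
  then have "((coord c' \<circ> \<gamma>) has_derivative (\<lambda>h. h *\<^sub>R T v)) (at t within I)"
    by (rule has_derivative_within_openin_transform[OF _ V \<open>t \<in> V\<close>])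
      (use c in \<open>auto simp: V_def chart_inv_coord\<close>)
  then show ?thesis
    using that T by (simp add: has_vector_derivative_def)
qed

text \<open>The regularity has to be verified in every chart of the atlas. Near each parameter the
  transition map has a C1 extension \<open>F\<close>, and the velocity in the other chart is the
  derivative of \<open>F\<close> applied to the constant vector \<open>b - a\<close>.\<close>

lemma segment_C1_curve:
  fixes a b :: 'e
  assumes c: "c \<in> A" and seg: "\<And>t. t \<in> {0..1} \<Longrightarrow> a + t *\<^sub>R (b - a) \<in> coord c ` chart_dom c"
  shows "piecewise_C1_curve A (\<lambda>t. chart_inv c (a + t *\<^sub>R (b - a)))"
proof -
  define \<gamma> where "\<gamma> t = chart_inv c (a + t *\<^sub>R (b - a))" for t
  have cont: "continuous_on {0..1} \<gamma>"
    unfolding \<gamma>_def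
    by (rule continuous_on_compose2[OF continuous_on_chart_inv[OF c]])
      (use seg in \<open>auto intro!: continuous_intros\<close>)
  have \<gamma>_dom: "\<gamma> t \<in> chart_dom c" if "t \<in> {0..1}" for t
    unfolding \<gamma>_def using chart_inv_in_dom[OF c] seg that by blast
  have coord_\<gamma>: "coord c (\<gamma> t) = a + t *\<^sub>R (b - a)" if "t \<in> {0..1}" for t
    unfolding \<gamma>_def using coord_chart_inv[OF c] seg that by blast
  have "C1_curve A \<gamma> 0 1"
    unfolding C1_curve_def
  proof
    fix c' assume c': "c' \<in> A"
    let ?S = "coord c ` (chart_dom c \<inter> chart_dom c')"
    let ?J = "{t\<in>{0..1}. \<gamma> t \<in> chart_dom c'}"
    \<comment> \<open>The extension \<open>F\<close> changes with \<open>t\<close>. Taking the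
      derivative itself as \<open>D\<close> gives one function, whose continuity is then a local
      question.\<close>
    define D where "D t = vector_derivative (coord c' \<circ> \<gamma>) (at t within {0..1})" for t
    have J: "openin (top_of_set {0..1}) ?J"
    proof -
      have "openin (top_of_set {0..1}) ({0..1} \<inter> \<gamma> -` chart_dom c')"
        using cont openin_dom[OF c'] \<gamma>_dom dom_subset[OF c]
        by (intro continuous_openin_preimage[of _ _ X]) auto
      then show ?thesis
        by (simp add: Int_def vimage_def)
    qed
    have *: "((coord c' \<circ> \<gamma>) has_vector_derivative D t) (at t within {0..1}) \<and> continuous (at t within ?J) D"
      if t: "t \<in> ?J" for t
    proof -
      have "a + t *\<^sub>R (b - a) \<in> ?S"
        using t \<gamma>_dom coord_\<gamma> by (metis (no_types, lifting) IntI image_eqI mem_Collect_eq)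
      then obtain U F F' where UF: "open U" "a + t *\<^sub>R (b - a) \<in> U"
        "\<And>y. y \<in> U \<Longrightarrow> (F has_derivative F' y) (at y)"
        "\<And>v. continuous_on U (\<lambda>y. F' y v)"
        "\<And>y. y \<in> ?S \<Longrightarrow> y \<in> U \<Longrightarrow> F y = (coord c' \<circ> chart_inv c) y"
        using smooth_on_C1[OF transition_smooth[OF c c']] by metis
      define V where "V = ?J \<inter> (\<lambda>t. a + t *\<^sub>R (b - a)) -` U"
      have "open ((\<lambda>t. a + t *\<^sub>R (b - a)) -` U)"
        by (intro open_vimage UF(1) continuous_intros)
      then have V: "openin (top_of_set {0..1}) V"
        unfolding V_def using J by (intro openin_Int_open)
      have VJ: "openin (top_of_set ?J) V"
        by (rule openin_subset_trans[OF V]) (auto simp: V_def)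
      have "t \<in> V" using t UF(2) by (simp add: V_def)
      have vd: "((coord c' \<circ> \<gamma>) has_vector_derivative F' (a + s *\<^sub>R (b - a)) (b - a)) (at s within {0..1})"
        if s: "s \<in> V" for s
      proof -
        have sU: "a + s *\<^sub>R (b - a) \<in> U" using s by (simp add: V_def)
        have line: "((\<lambda>s. a + s *\<^sub>R (b - a)) has_derivative (\<lambda>h. h *\<^sub>R (b - a))) (at s within {0..1})"
          by (auto intro!: derivative_eq_intros)
        have "(F \<circ> (\<lambda>s. a + s *\<^sub>R (b - a)) has_derivative F' (a + s *\<^sub>R (b - a)) \<circ> (\<lambda>h. h *\<^sub>R (b - a))) (at s within {0..1})"
          by (rule diff_chain_within[OF line has_derivative_at_withinI[OF UF(3)[OF sU]]])
        moreover have "F' (a + s *\<^sub>R (b - a)) \<circ> (\<lambda>h. h *\<^sub>R (b - a)) = (\<lambda>h. h *\<^sub>R F' (a + s *\<^sub>R (b - a)) (b - a))"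
          using has_derivative_linear[OF UF(3)[OF sU]] by (auto simp: linear_scale)
        ultimately have "(F \<circ> (\<lambda>s. a + s *\<^sub>R (b - a)) has_derivative (\<lambda>h. h *\<^sub>R F' (a + s *\<^sub>R (b - a)) (b - a))) (at s within {0..1})"
          by simp
        moreover have "(F \<circ> (\<lambda>s. a + s *\<^sub>R (b - a))) u = (coord c' \<circ> \<gamma>) u" if u: "u \<in> V" for u
        proof -
          have "u \<in> {0..1}" "\<gamma> u \<in> chart_dom c'" "a + u *\<^sub>R (b - a) \<in> U"
            using u by (auto simp: V_def)
          then have "a + u *\<^sub>R (b - a) \<in> ?S"
            using \<gamma>_dom coord_\<gamma> by (metis (no_types, lifting) IntI image_eqI)
          then show ?thesis
            using UF(5) \<open>a + u *\<^sub>R (b - a) \<in> U\<close> by (simp add: \<gamma>_def)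
        qed
        ultimately show ?thesis
          unfolding has_vector_derivative_def
          by (rule has_derivative_within_openin_transform[OF _ V s])
      qed
      have D: "D s = F' (a + s *\<^sub>R (b - a)) (b - a)" if "s \<in> V" for s
        unfolding D_def
        by (rule vector_derivative_within_closed_interval[OF _ _ vd[OF that]])
          (use that in \<open>auto simp: V_def\<close>)
      have "continuous_on V (\<lambda>s. F' (a + s *\<^sub>R (b - a)) (b - a))"
        by (rule continuous_on_compose2[OF UF(4)]) (auto intro!: continuous_intros simp: V_def)
      then have "continuous_on V D"
        by (rule continuous_on_eq) (simp add: D)
      then have "continuous (at t within V) D"
        using \<open>t \<in> V\<close> continuous_on_eq_continuous_within by blast
      moreover obtain G where "open G" "V = ?J \<inter> G"
        using VJ by (auto simp: openin_open)
      then have "at t within V = at t within ?J"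
        by (intro at_within_nhd[of _ G]) (use \<open>t \<in> V\<close> in auto)
      ultimately show ?thesis
        using vd[OF \<open>t \<in> V\<close>] D[OF \<open>t \<in> V\<close>] by simp
    qed
    then have "continuous_on ?J D"
      unfolding continuous_on_eq_continuous_within by blast
    then show "\<exists>D. continuous_on ?J D \<and> (\<forall>t\<in>{0..1}. \<gamma> t \<in> chart_dom c' \<longrightarrow>
        ((coord c' \<circ> \<gamma>) has_vector_derivative D t) (at t within {0..1}))"
      using * by blast
  qed
  then have "piecewise_C1_curve A \<gamma>"
    unfolding piecewise_C1_curve_def using cont
    by (intro conjI exI[of _ 1] exI[of _ real]) auto
  then show ?thesis
    by (simp add: \<gamma>_def[abs_def])
qed

end

section \<open>Lengths in the conformal metric\<close>

text \<open>Projection to the direction \<open>u\<close> of the displacement reduces the claim to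
  the fundamental theorem for the gauge integral of a real function. That theorem also yields
  measurability of the projected derivative; if this function is not absolutely integrable, the
  integral on the right is infinite.\<close>

lemma norm_le_nn_integral_derivative:
  fixes \<sigma> :: "real \<Rightarrow> 'e::euclidean_space"
  assumes "a \<le> b" "continuous_on {a..b} \<sigma>" "finite B"
    and deriv: "\<And>t. t \<in> {a<..<b} - B \<Longrightarrow> (\<sigma> has_vector_derivative D t) (at t)"
  shows "ennreal (norm (\<sigma> b - \<sigma> a)) \<le> (\<integral>\<^sup>+t\<in>{a..b}. ennreal (norm (D t)) \<partial>lborel)"
proof -
  define u where "u = sgn (\<sigma> b - \<sigma> a)"
  have u: "norm u \<le> 1" "(\<sigma> b - \<sigma> a) \<bullet> u = norm (\<sigma> b - \<sigma> a)"
    by (cases "\<sigma> b = \<sigma> a"; simp add: u_def sgn_div_norm dot_square_norm power2_eq_square)+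
  define h where "h t = (if t \<in> insert a (insert b B) then 0 else D t \<bullet> u)" for t
  have int: "(h has_integral \<sigma> b \<bullet> u - \<sigma> a \<bullet> u) {a..b}"
  proof (rule fundamental_theorem_of_calculus_interior_strong)
    show "finite (insert a (insert b B))" using assms(3) by simp
    show "continuous_on {a..b} (\<lambda>t. \<sigma> t \<bullet> u)"
      by (intro continuous_intros assms)
    fix t assume "t \<in> {a<..<b} - insert a (insert b B)"
    then show "((\<lambda>t. \<sigma> t \<bullet> u) has_vector_derivative h t) (at t)"
      using bounded_linear.has_vector_derivative[OF bounded_linear_inner_left deriv, of t u]
      by (simp add: h_def)
  qed fact
  let ?f = "\<lambda>t. indicator {a..b} t *\<^sub>R h t"
  have meas: "?f \<in> borel_measurable lebesgue"
    using has_integral_implies_lebesgue_measurable[OF int] .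
  have "ennreal (norm (\<sigma> b - \<sigma> a)) \<le> (\<integral>\<^sup>+t. ennreal (norm (?f t)) \<partial>lebesgue)"
  proof (cases "(\<integral>\<^sup>+t. ennreal (norm (?f t)) \<partial>lebesgue) < \<infinity>")
    case True
    then have f: "integrable lebesgue ?f"
      by (intro integrableI_bounded meas)
    then have "(h has_integral integral\<^sup>L lebesgue ?f) {a..b}"
      using has_integral_set_lebesgue[of "{a..b}" h] by (simp add: set_integrable_def set_lebesgue_integral_def)
    then have "integral\<^sup>L lebesgue ?f = norm (\<sigma> b - \<sigma> a)"
      using has_integral_unique[OF int] u(2) by (simp add: inner_diff_left)
    then show ?thesis
      using integral_norm_bound_ennreal[OF f] by simp
  next
    case False
    then show ?thesis by (simp add: not_less top_unique)
  qed
  also have "\<dots> = (\<integral>\<^sup>+t. ennreal (norm (?f t)) \<partial>lborel)"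
    by (rule nn_integral_completion)
  also have "\<dots> \<le> (\<integral>\<^sup>+t\<in>{a..b}. ennreal (norm (D t)) \<partial>lborel)"
  proof (rule nn_integral_mono)
    fix t
    have "\<bar>D t \<bullet> u\<bar> \<le> norm (D t)"
      using Cauchy_Schwarz_ineq2[of "D t" u] mult_left_mono[OF u(1), of "norm (D t)"] by simp
    then show "ennreal (norm (?f t)) \<le> ennreal (norm (D t)) * indicator {a..b} t"
      by (auto simp: h_def indicator_def ennreal_leI)
  qed
  finally show ?thesis .
qed

lemma closed_corner_model: "closed (corner_model B)"
  unfolding corner_model_def Ball_def
  by (intro closed_Collect_all closed_Collect_imp closed_Collect_le continuous_intros) auto

lemma convex_corner_model: "convex (corner_model B)"
  by (auto simp: convex_def corner_model_def inner_add_left)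

locale conformal_corner = corner_atlas X A
  for X :: "'a::t2_space set" and A :: "('a, 'e::euclidean_space) corner_chart set" +
  fixes N :: nat and H :: "nat \<Rightarrow> 'a set" and \<rho> :: "nat \<Rightarrow> 'a \<Rightarrow> real"
    and \<alpha> :: "nat \<Rightarrow> real" and g0 :: "('a, 'e) metric_family"
  assumes bdf: "\<And>i. i \<in> {1..N} \<Longrightarrow> boundary_defining_function X A (H i) (\<rho> i)"
    and metric: "riemannian_metric A g0"
    and weights: "\<And>i. i \<in> {1..N} \<Longrightarrow> 0 \<le> \<alpha> i"
begin

definition conf :: "'a \<Rightarrow> real" where
  "conf p = (\<Sum>i\<in>{1..N}. \<rho> i p powr (- \<alpha> i))"

abbreviation g :: "('a, 'e) metric_family" where
  "g \<equiv> sum_metric N \<rho> \<alpha> g0"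

abbreviation Y :: "'a set" where
  "Y \<equiv> mf_interior X A"

lemma g_eq: "g c p v w = conf p * g0 c p v w"
  by (simp add: sum_metric_def conf_def)

lemma conf_nonneg: "0 \<le> conf p"
  unfolding conf_def by (intro sum_nonneg) simp

lemma g0_bilinear: "c \<in> A \<Longrightarrow> p \<in> chart_dom c \<Longrightarrow> bilinear (g0 c p)"
  using metric unfolding riemannian_metric_def by blast

lemma g0_pos: "c \<in> A \<Longrightarrow> p \<in> chart_dom c \<Longrightarrow> v \<noteq> 0 \<Longrightarrow> 0 < g0 c p v v"
  using metric unfolding riemannian_metric_def by blast

lemma g0_transform:
  assumes "c \<in> A" "c' \<in> A" "p \<in> chart_dom c" "p \<in> chart_dom c'"
    and "((coord c' \<circ> chart_inv c) has_derivative T)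
      (at (coord c p) within coord c ` (chart_dom c \<inter> chart_dom c'))"
  shows "g0 c p v w = g0 c' p (T v) (T w)"
  using metric assms unfolding riemannian_metric_def by blast

sublocale chart_metric A g
proof
  fix c p assume "c \<in> A" "p \<in> chart_dom c"
  moreover have "linear (\<lambda>x. conf p * f x)" if "linear f" for f :: "'e \<Rightarrow> real"
    using linear_compose_scale_right[OF that, of "conf p"] by simp
  ultimately show "bilinear (g c p)"
    using g0_bilinear[of c p] by (simp add: bilinear_def g_eq[abs_def])
qed

lemma Y_subset: "Y \<subseteq> X"
  by (auto simp: mf_interior_def corner_stratum_def)

lemma interiorI:
  assumes c: "c \<in> A" "x \<in> coord c ` chart_dom c" and "\<And>b. b \<in> walls c \<Longrightarrow> 0 < x \<bullet> b"
  shows "chart_inv c x \<in> Y"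
proof -
  have "{b \<in> walls c. coord c (chart_inv c x) \<bullet> b = 0} = {}"
    using assms coord_chart_inv[OF c] by force
  then have "card {b \<in> walls c. coord c (chart_inv c x) \<bullet> b = 0} = 0"
    by (metis card.empty)
  then show ?thesis
    unfolding mf_interior_def corner_stratum_def
    using c chart_inv_in_dom[OF c] dom_subset by (auto intro!: bexI[of _ c])
qed

text \<open>\<open>speed\<close> is computed in a chart picked by a choice operator; the
  transformation laws of velocities and of the metric give the same value in every chart around the
  point.\<close>

lemma speed_eq:
  assumes c: "c \<in> A" and \<gamma>: "continuous_on {0..1} \<gamma>" "\<gamma> ` {0..1} \<subseteq> X"
    and t: "t \<in> {0<..<1}" "\<gamma> t \<in> chart_dom c"
    and v: "((coord c \<circ> \<gamma>) has_vector_derivative v) (at t)"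
  shows "speed A g \<gamma> t = sqrt (conf (\<gamma> t) * g0 c (\<gamma> t) v v)"
proof -
  define c' where "c' = (SOME c. c \<in> A \<and> \<gamma> t \<in> chart_dom c)"
  have c': "c' \<in> A" "\<gamma> t \<in> chart_dom c'"
    unfolding c'_def using c t(2) by (metis (mono_tags, lifting) someI_ex)+
  have at: "at t within {0<..<1} = at t" "at t within {0..1} = at t"
    using at_within_open[OF t(1)] t(1) by (simp_all add: at_within_Icc_at)
  have \<gamma>': "continuous_on {0<..<1} \<gamma>" "\<gamma> ` {0<..<1} \<subseteq> X"
    using \<gamma> by (auto elim!: continuous_on_subset simp: image_subset_iff)
  obtain T where T: "((coord c' \<circ> chart_inv c) has_derivative T)
      (at (coord c (\<gamma> t)) within coord c ` (chart_dom c \<inter> chart_dom c'))"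
    "((coord c' \<circ> \<gamma>) has_vector_derivative T v) (at t)"
    using curve_transfer[OF c c'(1) \<gamma>' t c'(2), unfolded at, OF v] by blast
  have "speed A g \<gamma> t = sqrt (g c' (\<gamma> t) (T v) (T v))"
    using vector_derivative_at[OF T(2)] by (simp add: speed_def c'_def[symmetric] at Let_def)
  then show ?thesis
    using g0_transform[OF c c'(1) t(2) c'(2) T(1)] by (simp add: g_eq)
qed

text \<open>A curve may leave the chart for good, so it is followed only until it first exits the
  ball. Until then its coordinates travel a distance of at least \<open>r\<close>, and its speed is
  at least \<open>K\<close> times the coordinate speed; this is why the metric is bounded only in
  the closed ball and only at interior points.\<close>

lemma riemannian_dist_lower:
  assumes c: "c \<in> A" and sub: "corner_model (walls c) \<inter> cball x r \<subseteq> coord c ` chart_dom c"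
    and x: "x \<in> corner_model (walls c)" and "0 < r" "0 \<le> K"
    and q: "q \<notin> chart_inv c ` (corner_model (walls c) \<inter> ball x r)"
    and K: "\<And>z v. z \<in> corner_model (walls c) \<inter> cball x r \<Longrightarrow> chart_inv c z \<in> Y \<Longrightarrow>
      K * norm v \<le> sqrt (conf (chart_inv c z) * g0 c (chart_inv c z) v v)"
  shows "ennreal (K * r) \<le> riemannian_dist Y A g (chart_inv c x) q"
  unfolding riemannian_dist_def
proof (rule INF_greatest, clarsimp)
  fix \<gamma> assume \<gamma>: "piecewise_C1_curve A \<gamma>" "\<gamma> ` {0..1} \<subseteq> Y" "\<gamma> 0 = chart_inv c x" "q = \<gamma> 1"
  have cont: "continuous_on {0..1} \<gamma>"
    using \<gamma>(1) by (simp add: piecewise_C1_curve_def)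
  have \<gamma>X: "\<gamma> ` {0..1} \<subseteq> X"
    using \<gamma>(2) Y_subset by blast
  let ?M = "corner_model (walls c)"
  define P where "P = chart_inv c ` (?M \<inter> ball x r)"
  have P: "openin (top_of_set X) P"
    unfolding P_def using sub ball_subset_cball
    by (intro openin_chart_inv_image[OF c] openin_Int_open) auto
  define T where "T = {0..1} \<inter> \<gamma> -` (X - P)"
  have "closedin (top_of_set {0..1}) T"
    unfolding T_def using cont \<gamma>X P
    by (intro continuous_closedin_preimage_gen[of _ _ X]) (auto simp: closedin_def Diff_Diff_Int Int_absorb2 openin_imp_subset)
  then have "closed T"
    by (rule closedin_closed_trans) simp
  have "1 \<in> T"
    using q \<gamma> \<gamma>X by (auto simp: T_def P_def)
  have "bdd_below T"
    by (rule bdd_belowI[of _ 0]) (simp add: T_def)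
  \<comment> \<open>the first exit time from the coordinate ball\<close>
  define t1 where "t1 = Inf T"
  have "t1 \<in> T"
    unfolding t1_def using \<open>1 \<in> T\<close> \<open>closed T\<close> \<open>bdd_below T\<close> by (intro closed_contains_Inf) auto
  have before: "\<gamma> t \<in> P" if "0 \<le> t" "t < t1" for t
  proof -
    have "t \<notin> T"
      using that(2) cInf_lower[OF _ \<open>bdd_below T\<close>, of t] by (auto simp: t1_def)
    moreover have "t \<in> {0..1}"
      using that \<open>t1 \<in> T\<close> by (auto simp: T_def)
    ultimately show ?thesis
      using \<gamma>X by (auto simp: T_def image_subset_iff)
  qed
  have "0 \<notin> T"
    using \<gamma>(3) x \<open>0 < r\<close> by (auto simp: T_def P_def)
  then have t1: "0 < t1" "t1 \<le> 1"
    using \<open>t1 \<in> T\<close> by (auto simp: T_def order.strict_iff_order)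
  \<comment> \<open>At the exit time the curve has left the open ball but is still in the chart: the
    image of the closed ball is compact, hence closed in a Hausdorff space, and so contains the
    limit of the earlier points.\<close>
  have "compact (?M \<inter> cball x r)"
    by (intro closed_Int_compact closed_corner_model compact_cball)
  then have "closed (chart_inv c ` (?M \<inter> cball x r))"
    using sub continuous_on_chart_inv[OF c]
    by (intro compact_imp_closed compact_continuous_image) (auto elim: continuous_on_subset)
  then have "\<gamma> ` closure {0..<t1} \<subseteq> chart_inv c ` (?M \<inter> cball x r)"
    using before t1 cont
    by (intro image_closure_subset) (force simp: P_def elim: continuous_on_subset)+
  then have in_ball: "\<exists>z \<in> ?M \<inter> cball x r. \<gamma> t = chart_inv c z" if "t \<in> {0..t1}" for t
    using t1 that by (auto simp: image_subset_iff image_iff)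
  define \<sigma> where "\<sigma> = coord c \<circ> \<gamma>"
  have \<sigma>: "\<sigma> t \<in> ?M \<inter> cball x r" "\<gamma> t = chart_inv c (\<sigma> t)" "\<gamma> t \<in> chart_dom c" if t: "t \<in> {0..t1}" for t
  proof -
    obtain z where z: "z \<in> ?M \<inter> cball x r" "\<gamma> t = chart_inv c z"
      using in_ball[OF t] by blast
    then have "\<sigma> t = z"
      using coord_chart_inv[OF c, of z] sub by (auto simp: \<sigma>_def)
    then show "\<sigma> t \<in> ?M \<inter> cball x r" "\<gamma> t = chart_inv c (\<sigma> t)" "\<gamma> t \<in> chart_dom c"
      using z sub chart_inv_in_dom[OF c, of z] by auto
  qed
  have "\<sigma> 0 = x"
    using \<gamma>(3) coord_chart_inv[OF c, of x] sub x \<open>0 < r\<close> by (auto simp: \<sigma>_def)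
  have "\<sigma> t1 \<notin> ball x r"
  proof
    assume "\<sigma> t1 \<in> ball x r"
    then have "\<gamma> t1 \<in> P"
      using \<sigma>[of t1] t1 by (auto simp: P_def)
    then show False
      using \<open>t1 \<in> T\<close> by (auto simp: T_def)
  qed
  then have r: "r \<le> norm (\<sigma> t1 - \<sigma> 0)"
    by (simp add: \<open>\<sigma> 0 = x\<close> dist_norm norm_minus_commute)
  obtain B where B: "finite B" "0 \<in> B" "1 \<in> B"
    "\<And>t c. t \<in> {0..1} - B \<Longrightarrow> c \<in> A \<Longrightarrow> \<gamma> t \<in> chart_dom c \<Longrightarrow>
      ((coord c \<circ> \<gamma>) has_vector_derivative vector_derivative (coord c \<circ> \<gamma>) (at t)) (at t)"
    using piecewise_C1_curve_has_derivative[OF \<gamma>(1)] by blast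
  define D where "D t = vector_derivative (coord c \<circ> \<gamma>) (at t)" for t
  have deriv: "(\<sigma> has_vector_derivative D t) (at t)" if "t \<in> {0..t1} - B" for t
    unfolding \<sigma>_def D_def using that t1 \<sigma>(3)[of t] by (intro B(4) c) auto
  \<comment> \<open>The constant is absorbed into the curve \<open>K *\<^sub>R \<sigma>\<close>, so
    that it never has to be moved through the integral.\<close>
  have "K * r \<le> norm (K *\<^sub>R \<sigma> t1 - K *\<^sub>R \<sigma> 0)"
    using r \<open>0 \<le> K\<close> by (simp add: scaleR_diff_right[symmetric] mult_left_mono)
  then have "ennreal (K * r) \<le> ennreal (norm (K *\<^sub>R \<sigma> t1 - K *\<^sub>R \<sigma> 0))"
    by (rule ennreal_leI)
  also have "\<dots> \<le> (\<integral>\<^sup>+t\<in>{0..t1}. ennreal (norm (K *\<^sub>R D t)) \<partial>lborel)"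
  proof (rule norm_le_nn_integral_derivative[OF _ _ B(1)])
    show "continuous_on {0..t1} (\<lambda>t. K *\<^sub>R \<sigma> t)"
      unfolding \<sigma>_def o_def using \<sigma>(3) t1
      by (intro continuous_intros continuous_on_compose2[OF continuous_on_coord[OF c]] continuous_on_subset[OF cont]) auto
    fix t assume "t \<in> {0<..<t1} - B"
    then show "((\<lambda>t. K *\<^sub>R \<sigma> t) has_vector_derivative K *\<^sub>R D t) (at t)"
      by (intro bounded_linear.has_vector_derivative[OF bounded_linear_scaleR_right] deriv) auto
  qed (use t1 in simp)
  also have "\<dots> \<le> (\<integral>\<^sup>+t\<in>{0..1}. ennreal (speed A g \<gamma> t) \<partial>lborel)"
  proof (rule nn_integral_mono_AE, rule AE_mp[OF AE_lborel_notin_finite[OF B(1)]], rule AE_I2, rule impI)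
    fix t assume "t \<notin> B"
    show "ennreal (norm (K *\<^sub>R D t)) * indicator {0..t1} t \<le> ennreal (speed A g \<gamma> t) * indicator {0..1} t"
    proof (cases "t \<in> {0..t1}")
      case True
      have "t \<in> {0<..<1}"
        using True t1 B(2,3) \<open>t \<notin> B\<close> by (auto simp: order.strict_iff_order)
      then have "speed A g \<gamma> t = sqrt (conf (\<gamma> t) * g0 c (\<gamma> t) (D t) (D t))"
        using \<sigma>(3)[OF True] deriv[of t] True \<open>t \<notin> B\<close>
        by (intro speed_eq c cont \<gamma>X) (auto simp: \<sigma>_def)
      moreover have "K * norm (D t) \<le> sqrt (conf (\<gamma> t) * g0 c (\<gamma> t) (D t) (D t))"
      proof -
        have "\<gamma> t \<in> Y"
          using \<gamma>(2) \<open>t \<in> {0<..<1}\<close> by (auto simp: image_subset_iff)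
        then show ?thesis
          using K[OF \<sigma>(1)[OF True], of "D t"] unfolding \<sigma>(2)[OF True, symmetric] by simp
      qed
      ultimately show ?thesis
        using True t1 \<open>0 \<le> K\<close> by (simp add: ennreal_leI)
    qed simp
  qed
  finally show "ennreal (K * r) \<le> curve_length A g \<gamma>"
    by (simp add: curve_length_def)
qed

text \<open>The speed is bounded at interior parameters only, so \<open>\<phi>\<close> may blow up
  at the ends. This admits the integrable singularity \<open>t powr (- M / 2)\<close> for a segment
  that starts close to the face.\<close>

lemma riemannian_dist_segment:
  assumes c: "c \<in> A"
    and seg: "\<And>t. t \<in> {0..1} \<Longrightarrow> a + t *\<^sub>R (b - a) \<in> coord c ` chart_dom c"
      "\<And>t. t \<in> {0..1} \<Longrightarrow> chart_inv c (a + t *\<^sub>R (b - a)) \<in> Y"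
    and bound: "\<And>t x. t \<in> {0<..<1} \<Longrightarrow> x = chart_inv c (a + t *\<^sub>R (b - a)) \<Longrightarrow>
      sqrt (conf x * g0 c x (b - a) (b - a)) \<le> \<phi> t"
  shows "riemannian_dist Y A g (chart_inv c a) (chart_inv c b) \<le> (\<integral>\<^sup>+t\<in>{0..1}. ennreal (\<phi> t) \<partial>lborel)"
proof -
  define \<gamma> where "\<gamma> t = chart_inv c (a + t *\<^sub>R (b - a))" for t
  have C1: "piecewise_C1_curve A \<gamma>"
    using segment_C1_curve[OF c seg(1)] by (simp add: \<gamma>_def[abs_def])
  have coord_\<gamma>: "coord c (\<gamma> t) = a + t *\<^sub>R (b - a)" if "t \<in> {0..1}" for t
    unfolding \<gamma>_def using coord_chart_inv[OF c] seg(1) that by blast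
  have \<gamma>Y: "\<gamma> ` {0..1} \<subseteq> Y"
    using seg(2) by (auto simp: \<gamma>_def)
  have sp: "speed A g \<gamma> t \<le> \<phi> t" if t: "t \<in> {0<..<1}" for t
  proof -
    have "((\<lambda>t. a + t *\<^sub>R (b - a)) has_vector_derivative (b - a)) (at t)"
      by (auto intro!: derivative_eq_intros)
    then have "((coord c \<circ> \<gamma>) has_vector_derivative (b - a)) (at t)"
      by (rule has_vector_derivative_transform_within_open[of _ _ _ "{0<..<1}"])
        (use t coord_\<gamma> in auto)
    then have "speed A g \<gamma> t = sqrt (conf (\<gamma> t) * g0 c (\<gamma> t) (b - a) (b - a))"
      using C1 \<gamma>Y Y_subset t chart_inv_in_dom[OF c seg(1), of t]
      by (intro speed_eq c) (auto simp: piecewise_C1_curve_def \<gamma>_def)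
    then show ?thesis
      using bound[OF t refl] by (simp add: \<gamma>_def)
  qed
  have "riemannian_dist Y A g (chart_inv c a) (chart_inv c b) \<le> curve_length A g \<gamma>"
    unfolding riemannian_dist_def using C1 \<gamma>Y by (intro INF_lower) (auto simp: \<gamma>_def)
  also have "\<dots> \<le> (\<integral>\<^sup>+t\<in>{0..1}. ennreal (\<phi> t) \<partial>lborel)"
    unfolding curve_length_def
  proof (rule nn_integral_mono_AE, rule AE_mp[OF AE_lborel_notin_finite[of "{0, 1}"]], simp, rule AE_I2, rule impI)
    fix t :: real assume "t \<notin> {0, 1}"
    then show "ennreal (speed A g \<gamma> t) * indicator {0..1} t \<le> ennreal (\<phi> t) * indicator {0..1} t"
      using sp[of t] by (auto simp: indicator_def ennreal_leI order.strict_iff_order)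
  qed
  finally show ?thesis .
qed

end

section \<open>Local estimates near a face\<close>

lemma bilinear_small:
  fixes h :: "'e::euclidean_space \<Rightarrow> 'e \<Rightarrow> real"
  assumes h: "bilinear h" and small: "\<And>b b'. b \<in> Basis \<Longrightarrow> b' \<in> Basis \<Longrightarrow> \<bar>h b b'\<bar> \<le> \<eta>"
  shows "\<bar>h v v\<bar> \<le> (real DIM('e))\<^sup>2 * \<eta> * (norm v)\<^sup>2"
proof -
  have "h v v = h (\<Sum>b\<in>Basis. (v \<bullet> b) *\<^sub>R b) (\<Sum>b\<in>Basis. (v \<bullet> b) *\<^sub>R b)"
    by (simp add: euclidean_representation)
  also have "\<dots> = (\<Sum>(b, b')\<in>Basis \<times> Basis. h ((v \<bullet> b) *\<^sub>R b) ((v \<bullet> b') *\<^sub>R b'))"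
    by (rule bilinear_sum[OF h])
  finally have eq: "h v v = (\<Sum>(b, b')\<in>Basis \<times> Basis. h ((v \<bullet> b) *\<^sub>R b) ((v \<bullet> b') *\<^sub>R b'))" .
  have "\<bar>h v v\<bar> \<le> (\<Sum>(b, b')\<in>(Basis \<times> Basis :: ('e \<times> 'e) set). \<eta> * (norm v)\<^sup>2)"
    unfolding eq
  proof (rule order_trans[OF sum_abs], rule sum_mono, clarify)
    fix b b' :: 'e assume b: "b \<in> Basis" "b' \<in> Basis"
    have "\<bar>h ((v \<bullet> b) *\<^sub>R b) ((v \<bullet> b') *\<^sub>R b')\<bar> = (\<bar>v \<bullet> b\<bar> * \<bar>v \<bullet> b'\<bar>) * \<bar>h b b'\<bar>"
      using h by (simp add: bilinear_lmul bilinear_rmul abs_mult)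
    also have "\<dots> \<le> (norm v * norm v) * \<eta>"
      by (intro mult_mono Basis_le_norm small b) auto
    finally show "\<bar>h ((v \<bullet> b) *\<^sub>R b) ((v \<bullet> b') *\<^sub>R b')\<bar> \<le> \<eta> * (norm v)\<^sup>2"
      by (simp add: power2_eq_square mult.commute)
  qed
  also have "\<dots> = (real DIM('e))\<^sup>2 * \<eta> * (norm v)\<^sup>2"
    by (simp add: card_cartesian_product power2_eq_square)
  finally show ?thesis .
qed

text \<open>Compactness of the unit sphere: \<open>l\<close> is the minimum of the quadratic form
  there.\<close>

lemma pos_def_bilinear_bounds:
  fixes h :: "'e::euclidean_space \<Rightarrow> 'e \<Rightarrow> real"
  assumes h: "bilinear h" and pos: "\<And>v. v \<noteq> 0 \<Longrightarrow> 0 < h v v"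
  obtains l where "0 < l" "\<And>v. l * (norm v)\<^sup>2 \<le> h v v"
proof -
  have "continuous_on (sphere 0 1) (\<lambda>v. h v v)"
    by (rule bilinear_continuous_on_compose[OF continuous_on_id continuous_on_id h])
  moreover have "sphere (0::'e) 1 \<noteq> {}"
    using vector_choose_size[of 1] by auto
  ultimately obtain w where w: "w \<in> sphere 0 1" "\<And>v. v \<in> sphere 0 1 \<Longrightarrow> h w w \<le> h v v"
    using continuous_attains_inf[OF compact_sphere] by blast
  show ?thesis
  proof (rule that[of "h w w"])
    show "0 < h w w"
      using w by (intro pos) auto
    fix v
    show "h w w * (norm v)\<^sup>2 \<le> h v v"
    proof (cases "v = 0")
      case True
      then show ?thesis using h by (simp add: bilinear_lzero)
    next
      case False
      have "h w w \<le> h (v /\<^sub>R norm v) (v /\<^sub>R norm v)"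
        using False by (intro w) auto
      also have "\<dots> = h v v / (norm v)\<^sup>2"
        using h by (simp add: bilinear_lmul bilinear_rmul power2_eq_square divide_simps)
      finally show ?thesis
        using False by (simp add: field_simps)
    qed
  qed
qed

lemma small_scale_right: "0 < (e0::real) \<Longrightarrow> (\<And>e. 0 < e \<Longrightarrow> e < e0 \<Longrightarrow> P e) \<Longrightarrow> eventually P (at_right 0)"
  by (rule eventually_at_rightI[of 0 e0]) auto

context conformal_corner
begin

definition near :: "('a, 'e) corner_chart \<Rightarrow> 'a \<Rightarrow> real \<Rightarrow> 'e set" where
  "near c p e = corner_model (walls c) \<inter> ball (coord c p) e"

text \<open>Its inner product with every wall direction is 1. At each point of the chart it thus
  lies in the tangent cone together with the unit ball around it, whichever walls pass through that
  point.\<close>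

definition inward :: "('a, 'e) corner_chart \<Rightarrow> 'e" where
  "inward c = \<Sum>(walls c)"

lemma inner_inward: "c \<in> A \<Longrightarrow> b \<in> walls c \<Longrightarrow> inward c \<bullet> b = 1"
proof -
  assume c: "c \<in> A" and b: "b \<in> walls c"
  have fin: "finite (walls c)"
    by (rule finite_subset[OF walls_Basis[OF c] finite_Basis])
  have "inward c \<bullet> b = (\<Sum>b'\<in>walls c. if b' = b then 1 else 0)"
    unfolding inward_def inner_sum_left
    using walls_Basis[OF c] b by (intro sum.cong refl inner_Basis) auto
  then show ?thesis
    using b fin by simp
qed

lemma near_subset:
  assumes "c \<in> A" "openin (top_of_set X) W" "W \<subseteq> chart_dom c" "p \<in> W"
  shows "\<forall>\<^sub>F e in at_right 0. near c p e \<subseteq> coord c ` W"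
proof -
  obtain R where "0 < R" "corner_model (walls c) \<inter> cball (coord c p) R \<subseteq> coord c ` W"
    using corner_ball_subset[OF assms] .
  then show ?thesis
    by (intro small_scale_right[of R]) (auto simp: near_def)
qed

text \<open>The components of \<open>g0\<close> in the basis are finitely many continuous functions.
  Moving each by at most \<open>\<eta>\<close> changes the quadratic form on the unit sphere by at
  most \<open>l / 2\<close>, half of the lower bound \<open>l\<close> for it at
  \<open>p\<close>.\<close>

lemma near_metric:
  assumes c: "c \<in> A" and p: "p \<in> chart_dom c"
  shows "\<forall>\<^sub>F e in at_right 0. \<forall>x\<in>near c p e. \<forall>v. e * (norm v)\<^sup>2 \<le> g0 c (chart_inv c x) v v \<and>
    g0 c (chart_inv c x) v v \<le> (norm v)\<^sup>2 / e"
proof -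
  let ?S = "coord c ` chart_dom c"
  define G where "G x = g0 c (chart_inv c x)" for x
  define z where "z = coord c p"
  have z: "z \<in> ?S" using p by (simp add: z_def)
  have Gb: "bilinear (G x)" if "x \<in> ?S" for x
    unfolding G_def using g0_bilinear[OF c] chart_inv_in_dom[OF c that] .
  have Gp: "0 < G x v v" if "x \<in> ?S" "v \<noteq> 0" for x v
    unfolding G_def using g0_pos[OF c] chart_inv_in_dom[OF c that(1)] that(2) .
  obtain l where l: "0 < l" "\<And>v. l * (norm v)\<^sup>2 \<le> G z v v"
    using pos_def_bilinear_bounds[OF Gb[OF z] Gp[OF z]] by blast
  define n where "n = real DIM('e)"
  have n: "0 < n" by (simp add: n_def)
  define \<eta> where "\<eta> = l / (2 * n\<^sup>2)"
  have "0 < \<eta>" using l(1) n by (simp add: \<eta>_def)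
  have "\<forall>\<^sub>F x in at z within ?S. \<forall>b\<in>Basis. \<forall>b'\<in>Basis. dist (G x b b') (G z b b') < \<eta>"
  proof (intro eventually_ball_finite finite_Basis ballI)
    fix b b' :: 'e
    have "continuous_on ?S (\<lambda>x. G x b b')"
      unfolding G_def using metric c by (intro smooth_on_imp_continuous_on) (auto simp: riemannian_metric_def)
    then have "((\<lambda>x. G x b b') \<longlongrightarrow> G z b b') (at z within ?S)"
      using z unfolding continuous_on_def by blast
    then show "\<forall>\<^sub>F x in at z within ?S. dist (G x b b') (G z b b') < \<eta>"
      using \<open>0 < \<eta>\<close> by (rule tendstoD)
  qed
  then obtain R where R: "0 < R" "\<And>x b b'. x \<in> ?S \<Longrightarrow> dist x z < R \<Longrightarrow> b \<in> Basis \<Longrightarrow> b' \<in> Basis \<Longrightarrow>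
      \<bar>G x b b' - G z b b'\<bar> \<le> \<eta>"
    using \<open>0 < \<eta>\<close> unfolding eventually_at dist_real_def by (metis abs_zero diff_self less_imp_le)
  obtain C where C: "0 < C" "\<And>v w. norm (G z v w) \<le> C * norm v * norm w"
    using bilinear_bounded_pos[OF Gb[OF z]] by blast
  have bounds: "l / 2 * (norm v)\<^sup>2 \<le> G x v v \<and> G x v v \<le> (C + l / 2) * (norm v)\<^sup>2"
    if x: "x \<in> ?S" "dist x z < R" for x v
  proof -
    have "bilinear (\<lambda>v w. G x v w - G z v w)"
      using Gb[OF x(1)] Gb[OF z] by (auto simp: bilinear_def intro: linear_compose_sub)
    then have "\<bar>G x v v - G z v v\<bar> \<le> n\<^sup>2 * \<eta> * (norm v)\<^sup>2"
      unfolding n_def by (rule bilinear_small) (use R(2) x in auto)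
    also have "n\<^sup>2 * \<eta> = l / 2"
      using n by (simp add: \<eta>_def)
    finally have "\<bar>G x v v - G z v v\<bar> \<le> l / 2 * (norm v)\<^sup>2" .
    moreover have "G z v v \<le> C * (norm v)\<^sup>2"
      using C(2)[of v v] by (simp add: power2_eq_square mult.assoc)
    moreover have "l * (norm v)\<^sup>2 = l / 2 * (norm v)\<^sup>2 + l / 2 * (norm v)\<^sup>2" by simp
    ultimately show ?thesis
      using l(2)[of v] unfolding abs_le_iff distrib_right by linarith
  qed
  have "\<forall>\<^sub>F e in at_right 0. near c p e \<subseteq> ?S"
    by (rule near_subset[OF c openin_dom[OF c] order_refl p])
  moreover have "\<forall>\<^sub>F e in at_right (0::real). e < Min {R, l / 2, 1 / (C + l / 2)} \<and> 0 < e"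
    by (rule small_scale_right[of "Min {R, l / 2, 1 / (C + l / 2)}"])
      (use R(1) l(1) C(1) in auto)
  ultimately show ?thesis
  proof eventually_elim
    case (elim e)
    then have e: "e < R" "e < l / 2" "e < 1 / (C + l / 2)" "0 < e" by auto
    then have le: "C + l / 2 \<le> 1 / e"
      using C(1) l(1) by (simp add: field_simps)
    show ?case
    proof (intro ballI allI)
      fix x and v :: 'e assume x: "x \<in> near c p e"
      then have "x \<in> ?S" "dist x z < R"
        using elim(1) e by (auto simp: near_def z_def dist_commute)
      note b = bounds[OF this, of v]
      have "e * (norm v)\<^sup>2 \<le> l / 2 * (norm v)\<^sup>2" "(C + l / 2) * (norm v)\<^sup>2 \<le> 1 / e * (norm v)\<^sup>2"
        using e le by (intro mult_right_mono; simp)+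
      with b show "e * (norm v)\<^sup>2 \<le> g0 c (chart_inv c x) v v \<and> g0 c (chart_inv c x) v v \<le> (norm v)\<^sup>2 / e"
        by (auto simp: G_def)
    qed
  qed
qed

section \<open>Sign, growth and Lipschitz bounds of the defining functions\<close>

lemma H_iff: "i \<in> {1..N} \<Longrightarrow> p \<in> H i \<longleftrightarrow> p \<in> X \<and> \<rho> i p = 0"
  using bdf[of i] unfolding boundary_defining_function_def by blast

lemma rho_nonneg:
  assumes "i \<in> {1..N}" "p \<in> X"
  shows "0 \<le> \<rho> i p"
proof (cases "p \<in> H i")
  case True
  then show ?thesis using H_iff assms by simp
next
  case False
  then have "0 < \<rho> i p"
    using bdf[OF assms(1)] assms(2) unfolding boundary_defining_function_def by blast
  then show ?thesis by simp
qed

text \<open>\<open>F\<close> agrees with the nonnegative \<open>\<rho> i\<close> on the chart image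
  and vanishes at \<open>p\<close>, so it cannot decrease in a direction that keeps the point in the
  model for a short time; only the walls through \<open>p\<close> restrict such directions. That
  \<open>F'\<close> does not vanish at \<open>p\<close> is the last clause of
  \<open>boundary_defining_function\<close>, read through the extension.\<close>

lemma rho_C1:
  assumes i: "i \<in> {1..N}" and c: "c \<in> A" and p: "p \<in> chart_dom c" and 0: "\<rho> i p = 0"
  obtains U F F' where "open U" "coord c p \<in> U"
    and "\<forall>y\<in>U. (F has_derivative F' y) (at y)"
    and "\<forall>v. continuous_on U (\<lambda>y. F' y v)"
    and "\<forall>y\<in>coord c ` chart_dom c \<inter> U. F y = \<rho> i (chart_inv c y)"
    and "F' (coord c p) \<noteq> (\<lambda>_. 0)"
    and "\<forall>v. (\<forall>b\<in>walls c. coord c p \<bullet> b = 0 \<longrightarrow> 0 \<le> v \<bullet> b) \<longrightarrow> 0 \<le> F' (coord c p) v"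
proof -
  let ?S = "coord c ` chart_dom c" and ?z = "coord c p"
  have z: "?z \<in> ?S" using p by simp
  have pX: "p \<in> X" using dom_subset[OF c] p by blast
  have sm: "smooth_on ?S (\<rho> i \<circ> chart_inv c)"
    using bdf[OF i] c by (simp add: boundary_defining_function_def smooth_function_def)
  obtain U F F' where UF: "open U" "?z \<in> U" "\<And>y. y \<in> U \<Longrightarrow> (F has_derivative F' y) (at y)"
    "\<And>v. continuous_on U (\<lambda>y. F' y v)" "\<And>y. y \<in> ?S \<Longrightarrow> y \<in> U \<Longrightarrow> F y = (\<rho> i \<circ> chart_inv c) y"
    using smooth_on_C1[OF sm z] by metis
  show ?thesis
  proof (rule that[OF UF(1,2)])
    show "\<forall>y\<in>U. (F has_derivative F' y) (at y)" "\<forall>v. continuous_on U (\<lambda>y. F' y v)"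
      using UF(3,4) by blast+
    show "\<forall>y\<in>?S \<inter> U. F y = \<rho> i (chart_inv c y)"
      using UF(5) by simp
    show "F' ?z \<noteq> (\<lambda>_. 0)"
    proof
      assume "F' ?z = (\<lambda>_. 0)"
      then have "(F has_derivative (\<lambda>_. 0)) (at ?z within ?S)"
        using has_derivative_at_withinI[OF UF(3)[OF UF(2)], of ?S] by simp
      then have "((\<rho> i \<circ> chart_inv c) has_derivative (\<lambda>_. 0)) (at ?z within ?S)"
        by (rule has_derivative_within_openin_transform[of _ _ _ _ "?S \<inter> U"]) (use UF z in auto)
      moreover have "p \<in> H i"
        using H_iff[OF i] 0 pX by blast
      ultimately show False
        using bdf[OF i] c p unfolding boundary_defining_function_def by blast
    qed
    show "\<forall>v. (\<forall>b\<in>walls c. ?z \<bullet> b = 0 \<longrightarrow> 0 \<le> v \<bullet> b) \<longrightarrow> 0 \<le> F' ?z v"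
    proof (intro allI impI)
      fix v assume "\<forall>b\<in>walls c. ?z \<bullet> b = 0 \<longrightarrow> 0 \<le> v \<bullet> b"
      then have v: "\<And>b. b \<in> walls c \<Longrightarrow> ?z \<bullet> b = 0 \<Longrightarrow> 0 \<le> v \<bullet> b"
        by blast
      obtain R where R: "0 < R" "corner_model (walls c) \<inter> cball ?z R \<subseteq> ?S"
        using corner_ball_subset[OF c openin_dom[OF c] order_refl p] .
      have lim: "((\<lambda>h. ?z + h *\<^sub>R v) \<longlongrightarrow> ?z) (at_right (0::real))"
        by (auto intro!: tendsto_eq_intros)
      have "\<forall>\<^sub>F h in at_right (0::real). ?z + h *\<^sub>R v \<in> ball ?z R \<inter> U"
        by (rule topological_tendstoD[OF lim]) (use R UF in auto)
      moreover have "\<forall>\<^sub>F h in at_right (0::real). \<forall>b\<in>walls c. 0 \<le> (?z + h *\<^sub>R v) \<bullet> b"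
      proof (intro eventually_ball_finite ballI)
        show "finite (walls c)"
          by (rule finite_subset[OF walls_Basis[OF c] finite_Basis])
        fix b assume b: "b \<in> walls c"
        have "0 \<le> ?z \<bullet> b"
          using coord_image_subset[OF c] z b by (auto simp: corner_model_def)
        show "\<forall>\<^sub>F h in at_right (0::real). 0 \<le> (?z + h *\<^sub>R v) \<bullet> b"
        proof (cases "?z \<bullet> b = 0")
          case True
          then show ?thesis
            using v[OF b True] by (intro small_scale_right[of 1]) (auto simp: inner_add_left)
        next
          case False
          have "((\<lambda>h. (?z + h *\<^sub>R v) \<bullet> b) \<longlongrightarrow> ?z \<bullet> b) (at_right (0::real))"
            by (intro tendsto_inner lim tendsto_const)
          then have "\<forall>\<^sub>F h in at_right (0::real). 0 < (?z + h *\<^sub>R v) \<bullet> b"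
            by (rule order_tendstoD) (use False \<open>0 \<le> ?z \<bullet> b\<close> in auto)
          then show ?thesis by (rule eventually_mono) simp
        qed
      qed
      ultimately have ev: "\<forall>\<^sub>F h in at_right (0::real). 0 \<le> F (?z + h *\<^sub>R v)"
      proof eventually_elim
        case (elim h)
        then have S: "?z + h *\<^sub>R v \<in> ?S"
          using R(2) by (auto simp: corner_model_def)
        then have "F (?z + h *\<^sub>R v) = \<rho> i (chart_inv c (?z + h *\<^sub>R v))"
          using UF(5) elim by simp
        then show ?case
          using rho_nonneg[OF i] chart_inv_in_dom[OF c S] dom_subset[OF c] by auto
      qed
      have line: "((\<lambda>h. ?z + h *\<^sub>R v) has_derivative (\<lambda>h. h *\<^sub>R v)) (at 0)"
        by (auto intro!: derivative_eq_intros)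
      have "(F has_derivative F' ?z) (at (?z + 0 *\<^sub>R v))"
        using UF(2,3) by simp
      from diff_chain_at[OF line this]
      have "((\<lambda>h. F (?z + h *\<^sub>R v)) has_derivative (\<lambda>h. F' ?z (h *\<^sub>R v))) (at 0)"
        by (simp add: o_def)
      moreover have "(\<lambda>h. F' ?z (h *\<^sub>R v)) = (*) (F' ?z v)"
        using has_derivative_linear[OF UF(3)[OF UF(2)]] by (auto simp: linear_scale)
      ultimately have D: "((\<lambda>h. F (?z + h *\<^sub>R v)) has_real_derivative F' ?z v) (at 0)"
        by (simp add: has_field_derivative_def)
      have F0: "F ?z = 0"
        using UF(5)[OF z UF(2)] 0 chart_inv_coord[OF c p] by simp
      show "0 \<le> F' ?z v"
      proof (rule ccontr)
        assume "\<not> 0 \<le> F' ?z v"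
        then obtain d where d: "0 < d" "\<And>h. 0 < h \<Longrightarrow> h < d \<Longrightarrow> F (?z + h *\<^sub>R v) < 0"
          using DERIV_neg_dec_right[OF D] F0 by auto
        then have "\<forall>\<^sub>F h in at_right (0::real). F (?z + h *\<^sub>R v) < 0"
          by (intro small_scale_right[of d])
        with ev have "\<forall>\<^sub>F h in at_right (0::real). False"
          by eventually_elim simp
        then show False by simp
      qed
    qed
  qed
qed

text \<open>In a chart where \<open>p\<close> lies on no wall, the tangent cone is the whole space.
  A zero of \<open>\<rho> i\<close> would make its derivative nonnegative on \<open>v\<close> and on
  \<open>- v\<close>, hence zero, against \<open>rho_C1\<close>.\<close>

lemma rho_pos_interior:
  assumes i: "i \<in> {1..N}" and p: "p \<in> Y"
  shows "0 < \<rho> i p"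
proof (rule ccontr)
  assume "\<not> 0 < \<rho> i p"
  then have 0: "\<rho> i p = 0"
    using rho_nonneg[OF i] p Y_subset by force
  obtain c where c: "c \<in> A" "p \<in> chart_dom c" "card {b \<in> walls c. coord c p \<bullet> b = 0} = 0"
    using p by (auto simp: mf_interior_def corner_stratum_def)
  have "finite {b \<in> walls c. coord c p \<bullet> b = 0}"
    using walls_Basis[OF c(1)] finite_subset[of "{b \<in> walls c. coord c p \<bullet> b = 0}" Basis] by auto
  then have no_walls: "\<And>b. b \<in> walls c \<Longrightarrow> coord c p \<bullet> b \<noteq> 0"
    using c(3) by auto
  obtain U F F' where "open U" and U: "coord c p \<in> U"
    and F: "\<forall>y\<in>U. (F has_derivative F' y) (at y)"
    and "\<forall>v. continuous_on U (\<lambda>y. F' y v)"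
    and "\<forall>y\<in>coord c ` chart_dom c \<inter> U. F y = \<rho> i (chart_inv c y)"
    and ne: "F' (coord c p) \<noteq> (\<lambda>_. 0)"
    and nn: "\<forall>v. (\<forall>b\<in>walls c. coord c p \<bullet> b = 0 \<longrightarrow> 0 \<le> v \<bullet> b) \<longrightarrow> 0 \<le> F' (coord c p) v"
    using rho_C1[OF i c(1,2) 0] .
  have "F' (coord c p) v = 0" for v
    using nn[rule_format, of v] nn[rule_format, of "- v"] no_walls
      linear_neg[OF has_derivative_linear[OF F[rule_format, OF U]], of v]
    by fastforce
  then show False
    using ne by auto
qed

text \<open>Both bounds come from a C1 extension on a small ball: the growth from the mean value
  theorem along the inward direction, the Lipschitz estimate from a bound on the operator norm of
  the derivative.\<close>

lemma near_rho_zero: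
  assumes i: "i \<in> {1..N}" and c: "c \<in> A" and p: "p \<in> chart_dom c" and 0: "\<rho> i p = 0"
  shows "\<forall>\<^sub>F e in at_right 0. \<forall>x\<in>near c p e.
    (\<forall>y\<in>near c p e. \<bar>\<rho> i (chart_inv c x) - \<rho> i (chart_inv c y)\<bar> \<le> norm (x - y) / e) \<and>
    (\<forall>t\<ge>0. x + t *\<^sub>R inward c \<in> near c p e \<longrightarrow>
      \<rho> i (chart_inv c x) + e * t \<le> \<rho> i (chart_inv c (x + t *\<^sub>R inward c)))"
proof -
  let ?S = "coord c ` chart_dom c" and ?z = "coord c p" and ?\<nu> = "inward c"
  obtain U F F' where U: "open U" "?z \<in> U"
    and F': "\<forall>y\<in>U. (F has_derivative F' y) (at y)"
    and cont: "\<forall>v. continuous_on U (\<lambda>y. F' y v)"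
    and eq': "\<forall>y\<in>?S \<inter> U. F y = \<rho> i (chart_inv c y)"
    and ne: "F' ?z \<noteq> (\<lambda>_. 0)"
    and nn': "\<forall>v. (\<forall>b\<in>walls c. ?z \<bullet> b = 0 \<longrightarrow> 0 \<le> v \<bullet> b) \<longrightarrow> 0 \<le> F' ?z v"
    using rho_C1[OF i c p 0] .
  note F = F'[rule_format] and eq = eq'[rule_format, OF IntI]
  have nn: "0 \<le> F' ?z v" if "\<And>b. b \<in> walls c \<Longrightarrow> ?z \<bullet> b = 0 \<Longrightarrow> 0 \<le> v \<bullet> b" for v
    using nn' that by blast
  have lin: "linear (F' y)" if "y \<in> U" for y
    using has_derivative_linear[OF F[OF that]] .
  define k where "k = F' ?z ?\<nu>"
  \<comment> \<open>\<open>inward c + w\<close> stays in the tangent cone for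
    \<open>norm w \<le> 1\<close>. Used for \<open>w\<close> and \<open>- w\<close>, this shows that
    \<open>k\<close> bounds the linear form on the unit ball, so \<open>k = 0\<close> would make the
    form vanish.\<close>
  have cone: "0 \<le> k + F' ?z w" if "norm w \<le> 1" for w
  proof -
    have "0 \<le> F' ?z (?\<nu> + w)"
    proof (rule nn)
      fix b assume b: "b \<in> walls c"
      then have "\<bar>w \<bullet> b\<bar> \<le> 1"
        using Basis_le_norm[of b w] walls_Basis[OF c] that by force
      then show "0 \<le> (?\<nu> + w) \<bullet> b"
        using inner_inward[OF c b] by (simp add: inner_add_left)
    qed
    then show ?thesis
      using linear_add[OF lin[OF U(2)]] by (simp add: k_def)
  qed
  have "0 < k"
  proof (rule ccontr)
    assume "\<not> 0 < k"
    then have "k = 0"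
      using cone[of 0] linear_0[OF lin[OF U(2)]] by simp
    have "F' ?z v = 0" for v
    proof (cases "v = 0")
      case True
      then show ?thesis using linear_0[OF lin[OF U(2)]] by simp
    next
      case False
      have "F' ?z (v /\<^sub>R norm v) = 0"
        using cone[of "v /\<^sub>R norm v"] cone[of "- (v /\<^sub>R norm v)"] False \<open>k = 0\<close>
          linear_neg[OF lin[OF U(2)], of "v /\<^sub>R norm v"] by simp
      then show ?thesis
        using False linear_scale[OF lin[OF U(2)]] by simp
    qed
    then show False using ne by auto
  qed
  have tend: "((\<lambda>y. F' y v) \<longlongrightarrow> F' ?z v) (nhds ?z)" for v
  proof -
    have "isCont (\<lambda>y. F' y v) ?z"
      using cont[rule_format, of v] U by (simp add: continuous_on_eq_continuous_at)
    then show ?thesis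
      by (simp add: isCont_def tendsto_nhds_iff)
  qed
  have "\<forall>\<^sub>F y in nhds ?z. k / 2 < F' y ?\<nu>"
    by (rule order_tendstoD[OF tend]) (use \<open>0 < k\<close> in \<open>simp add: k_def\<close>)
  moreover have "\<forall>\<^sub>F y in nhds ?z. \<forall>b\<in>Basis. dist (F' y b) (F' ?z b) < 1"
    by (intro eventually_ball_finite ballI finite_Basis tendstoD[OF tend]) simp
  moreover have "\<forall>\<^sub>F y in nhds ?z. y \<in> U"
    using U by (rule eventually_nhds_in_open)
  ultimately have "\<forall>\<^sub>F y in nhds ?z. y \<in> U \<and> k / 2 < F' y ?\<nu> \<and> (\<forall>b\<in>Basis. dist (F' y b) (F' ?z b) < 1)"
    by eventually_elim simp
  then obtain R where R: "0 < R" and ball: "\<And>y. y \<in> ball ?z R \<Longrightarrow> y \<in> U"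
    and ball_inward: "\<And>y. y \<in> ball ?z R \<Longrightarrow> k / 2 < F' y ?\<nu>"
    and ball_Basis: "\<And>y b. y \<in> ball ?z R \<Longrightarrow> b \<in> Basis \<Longrightarrow> dist (F' y b) (F' ?z b) < 1"
    unfolding eventually_nhds_metric by (metis dist_commute mem_ball)
  \<comment> \<open>A bound for the operator norm near \<open>p\<close> from the values on the
    basis, each of which moves by less than 1 on the ball.\<close>
  define L where "L = (\<Sum>b\<in>Basis. \<bar>F' ?z b\<bar> + 1)"
  have "0 < L"
    unfolding L_def by (intro sum_pos) auto
  have onorm: "onorm (F' y) \<le> L" if y: "y \<in> ball ?z R" for y
  proof (rule onorm_le)
    fix v
    have "F' y v = F' y (\<Sum>b\<in>Basis. (v \<bullet> b) *\<^sub>R b)"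
      by (simp add: euclidean_representation)
    also have "\<dots> = (\<Sum>b\<in>Basis. (v \<bullet> b) * F' y b)"
      using lin[OF ball[OF y]] by (simp add: linear_sum linear_scale)
    also have "norm \<dots> \<le> (\<Sum>b\<in>Basis. norm v * (\<bar>F' ?z b\<bar> + 1))"
    proof (rule order_trans[OF norm_sum], rule sum_mono)
      fix b :: 'e assume b: "b \<in> Basis"
      have "\<bar>F' y b\<bar> \<le> \<bar>F' ?z b\<bar> + 1"
        using ball_Basis[OF y b] by (simp add: dist_real_def)
      then show "norm ((v \<bullet> b) * F' y b) \<le> norm v * (\<bar>F' ?z b\<bar> + 1)"
        using Basis_le_norm[OF b, of v] by (simp add: abs_mult mult_mono)
    qed
    finally show "norm (F' y v) \<le> L * norm v"
      by (simp add: L_def sum_distrib_left mult.commute)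
  qed
  have Lip: "\<bar>F x - F y\<bar> \<le> L * norm (x - y)" if "x \<in> ball ?z R" "y \<in> ball ?z R" for x y
    using differentiable_bound[of "ball ?z R" F F' L x y] that onorm
      has_derivative_at_withinI[OF F[OF ball]] by auto
  have grow: "F x + k / 2 * t \<le> F (x + t *\<^sub>R ?\<nu>)"
    if x: "x \<in> ball ?z R" "x + t *\<^sub>R ?\<nu> \<in> ball ?z R" and "0 \<le> t" for x t
  proof (cases "t = 0")
    case False
    then have "0 < t" using \<open>0 \<le> t\<close> by simp
    have seg: "x + s *\<^sub>R ?\<nu> \<in> ball ?z R" if s: "0 \<le> s" "s \<le> t" for s
    proof -
      have "x + s *\<^sub>R ?\<nu> = (1 - s / t) *\<^sub>R x + (s / t) *\<^sub>R (x + t *\<^sub>R ?\<nu>)"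
        using \<open>0 < t\<close> by (simp add: algebra_simps)
      also have "\<dots> \<in> ball ?z R"
        using x s \<open>0 < t\<close> by (intro convexD[OF convex_ball]) (auto simp: field_simps)
      finally show ?thesis .
    qed
    have der: "((\<lambda>s. F (x + s *\<^sub>R ?\<nu>)) has_real_derivative F' (x + s *\<^sub>R ?\<nu>) ?\<nu>) (at s)"
      if s: "0 \<le> s" "s \<le> t" for s
    proof -
      have line: "((\<lambda>h. x + h *\<^sub>R ?\<nu>) has_derivative (\<lambda>h. h *\<^sub>R ?\<nu>)) (at s)"
        by (auto intro!: derivative_eq_intros)
      have "((\<lambda>s. F (x + s *\<^sub>R ?\<nu>)) has_derivative (\<lambda>h. F' (x + s *\<^sub>R ?\<nu>) (h *\<^sub>R ?\<nu>))) (at s)"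
        using diff_chain_at[OF line F[OF ball[OF seg[OF s]]]] by (simp add: o_def)
      moreover have "(\<lambda>h. F' (x + s *\<^sub>R ?\<nu>) (h *\<^sub>R ?\<nu>)) = (*) (F' (x + s *\<^sub>R ?\<nu>) ?\<nu>)"
        using lin[OF ball[OF seg[OF s]]] by (auto simp: linear_scale)
      ultimately show ?thesis
        by (simp add: has_field_derivative_def)
    qed
    obtain s where s: "0 < s" "s < t"
      "F (x + t *\<^sub>R ?\<nu>) - F (x + 0 *\<^sub>R ?\<nu>) = (t - 0) * F' (x + s *\<^sub>R ?\<nu>) ?\<nu>"
      using MVT2[OF \<open>0 < t\<close> der] by blast
    have "k / 2 * t \<le> t * F' (x + s *\<^sub>R ?\<nu>) ?\<nu>"
      using ball_inward[OF seg[of s]] s \<open>0 < t\<close> by (simp add: mult.commute)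
    then show ?thesis using s(3) by simp
  qed simp
  have "\<forall>\<^sub>F e in at_right 0. near c p e \<subseteq> ?S"
    by (rule near_subset[OF c openin_dom[OF c] order_refl p])
  moreover have "\<forall>\<^sub>F e in at_right (0::real). e < Min {R, k / 2, 1 / L} \<and> 0 < e"
    by (rule small_scale_right[of "Min {R, k / 2, 1 / L}"]) (use R \<open>0 < k\<close> \<open>0 < L\<close> in auto)
  ultimately show ?thesis
  proof eventually_elim
    case (elim e)
    then have e: "e < R" "e < k / 2" "e < 1 / L" "0 < e" by auto
    then have Le: "L \<le> 1 / e"
      using \<open>0 < L\<close> by (simp add: field_simps)
    have nb: "x \<in> ball ?z R" if "x \<in> near c p e" for x
      using that e(1) by (auto simp: near_def)
    have nF: "F x = \<rho> i (chart_inv c x)" if "x \<in> near c p e" for x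
      using elim(1) nb[OF that] ball that by (intro eq) auto
    show ?case
    proof (intro ballI conjI allI impI)
      fix x assume x: "x \<in> near c p e"
      fix y assume y: "y \<in> near c p e"
      have "\<bar>F x - F y\<bar> \<le> L * norm (x - y)"
        by (intro Lip nb x y)
      also have "\<dots> \<le> 1 / e * norm (x - y)"
        by (intro mult_right_mono Le) simp
      finally show "\<bar>\<rho> i (chart_inv c x) - \<rho> i (chart_inv c y)\<bar> \<le> norm (x - y) / e"
        using nF x y by simp
    next
      fix x and t :: real
      assume x: "x \<in> near c p e" and t: "0 \<le> t" "x + t *\<^sub>R ?\<nu> \<in> near c p e"
      have "e * t \<le> k / 2 * t"
        using e t by (intro mult_right_mono) auto
      then show "\<rho> i (chart_inv c x) + e * t \<le> \<rho> i (chart_inv c (x + t *\<^sub>R ?\<nu>))"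
        using grow[OF nb[OF x] nb[OF t(2)] t(1)] nF[OF x] nF[OF t(2)] by simp
    qed
  qed
qed

lemma near_rho_pos:
  assumes i: "i \<in> {1..N}" and c: "c \<in> A" and p: "p \<in> chart_dom c" and pos: "0 < \<rho> i p"
  shows "\<forall>\<^sub>F e in at_right 0. \<forall>x\<in>near c p e. e \<le> \<rho> i (chart_inv c x)"
proof -
  let ?S = "coord c ` chart_dom c" and ?f = "\<rho> i \<circ> chart_inv c"
  have "smooth_on ?S ?f"
    using bdf[OF i] c by (simp add: boundary_defining_function_def smooth_function_def)
  then have "(?f \<longlongrightarrow> ?f (coord c p)) (at (coord c p) within ?S)"
    using smooth_on_imp_continuous_on p unfolding continuous_on_def by blast
  then have "\<forall>\<^sub>F x in at (coord c p) within ?S. \<rho> i p / 2 < ?f x"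
    by (rule order_tendstoD) (use pos chart_inv_coord[OF c p] in simp)
  then obtain R where R: "0 < R" "\<And>x. x \<in> ?S \<Longrightarrow> x \<noteq> coord c p \<Longrightarrow> dist x (coord c p) < R \<Longrightarrow> \<rho> i p / 2 < ?f x"
    unfolding eventually_at by blast
  have "\<forall>\<^sub>F e in at_right 0. near c p e \<subseteq> ?S"
    by (rule near_subset[OF c openin_dom[OF c] order_refl p])
  moreover have "\<forall>\<^sub>F e in at_right (0::real). e < Min {R, \<rho> i p / 2}"
    by (rule small_scale_right[of "Min {R, \<rho> i p / 2}"]) (use R(1) pos in auto)
  ultimately show ?thesis
  proof eventually_elim
    case (elim e)
    show ?case
    proof
      fix x assume x: "x \<in> near c p e"
      then have "x \<in> ?S" "dist x (coord c p) < R"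
        using elim by (auto simp: near_def dist_commute)
      then have "\<rho> i p / 2 < ?f x"
        using R(2)[of x] chart_inv_coord[OF c p] pos by (cases "x = coord c p") auto
      then show "e \<le> \<rho> i (chart_inv c x)"
        using elim(2) by simp
    qed
  qed
qed

text \<open>One parameter \<open>e\<close> serves as radius, as lower bound and, through \<open>1 / e\<close>, as upper bound: each of the
  conditions holds for all sufficiently small \<open>e\<close>, so they hold simultaneously.\<close>

definition good_radius :: "('a, 'e) corner_chart \<Rightarrow> 'a set \<Rightarrow> 'a \<Rightarrow> real \<Rightarrow> bool" where
  "good_radius c W p e \<longleftrightarrow> 0 < e \<and> e < 1 \<and> near c p e \<subseteq> coord c ` W \<and>
    (\<forall>x\<in>near c p e. \<forall>v. e * (norm v)\<^sup>2 \<le> g0 c (chart_inv c x) v v \<and>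
      g0 c (chart_inv c x) v v \<le> (norm v)\<^sup>2 / e) \<and>
    (\<forall>i\<in>{1..N}. if \<rho> i p = 0 then
      (\<forall>x\<in>near c p e. (\<forall>y\<in>near c p e. \<bar>\<rho> i (chart_inv c x) - \<rho> i (chart_inv c y)\<bar> \<le> norm (x - y) / e) \<and>
        (\<forall>t\<ge>0. x + t *\<^sub>R inward c \<in> near c p e \<longrightarrow>
          \<rho> i (chart_inv c x) + e * t \<le> \<rho> i (chart_inv c (x + t *\<^sub>R inward c))))
      else \<forall>x\<in>near c p e. e \<le> \<rho> i (chart_inv c x))"

lemma ex_good_radius:
  assumes c: "c \<in> A" and W: "openin (top_of_set X) W" "W \<subseteq> chart_dom c" "p \<in> W"
  obtains e where "good_radius c W p e"
proof -
  have p: "p \<in> chart_dom c" using W by blast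
  have "\<forall>\<^sub>F e in at_right (0::real). 0 < e \<and> e < 1"
    by (rule small_scale_right[of 1]) auto
  moreover note near_subset[OF c W] near_metric[OF c p]
  moreover have "\<forall>\<^sub>F e in at_right 0. \<forall>i\<in>{1..N}. if \<rho> i p = 0 then
      (\<forall>x\<in>near c p e. (\<forall>y\<in>near c p e. \<bar>\<rho> i (chart_inv c x) - \<rho> i (chart_inv c y)\<bar> \<le> norm (x - y) / e) \<and>
        (\<forall>t\<ge>0. x + t *\<^sub>R inward c \<in> near c p e \<longrightarrow>
          \<rho> i (chart_inv c x) + e * t \<le> \<rho> i (chart_inv c (x + t *\<^sub>R inward c))))
      else \<forall>x\<in>near c p e. e \<le> \<rho> i (chart_inv c x)"
  proof (intro eventually_ball_finite ballI)
    fix i assume i: "i \<in> {1..N}"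
    have "0 < \<rho> i p" if "\<rho> i p \<noteq> 0"
      using rho_nonneg[OF i, of p] that p dom_subset[OF c] by force
    then show "\<forall>\<^sub>F e in at_right 0. if \<rho> i p = 0 then
      (\<forall>x\<in>near c p e. (\<forall>y\<in>near c p e. \<bar>\<rho> i (chart_inv c x) - \<rho> i (chart_inv c y)\<bar> \<le> norm (x - y) / e) \<and>
        (\<forall>t\<ge>0. x + t *\<^sub>R inward c \<in> near c p e \<longrightarrow>
          \<rho> i (chart_inv c x) + e * t \<le> \<rho> i (chart_inv c (x + t *\<^sub>R inward c))))
      else \<forall>x\<in>near c p e. e \<le> \<rho> i (chart_inv c x)"
      using near_rho_zero[OF i c p] near_rho_pos[OF i c p] by (cases "\<rho> i p = 0") simp_all
  qed simp
  ultimately have "\<forall>\<^sub>F e in at_right 0. good_radius c W p e"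
    unfolding good_radius_def by eventually_elim blast
  then obtain e where "good_radius c W p e"
    using eventually_happens[of "good_radius c W p" "at_right 0"] by auto
  then show ?thesis by (rule that)
qed

text \<open>Here the largest weight takes over. A vanishing \<open>\<rho> i\<close> contributes at
  most \<open>e powr (- \<alpha> i) * t powr (- \<alpha> i)\<close>, any other at most
  \<open>e powr (- \<alpha> i)\<close>; for \<open>t \<le> 1\<close> the factor
  \<open>t powr (- M)\<close> dominates in both cases.\<close>

lemma good_radius_mono_conf:
  assumes g: "good_radius c W p e" and x: "x \<in> near c p e" and t: "0 < t" "t \<le> 1"
    and rho: "\<And>i. i \<in> {1..N} \<Longrightarrow> \<rho> i p = 0 \<Longrightarrow> e * t \<le> \<rho> i (chart_inv c x)"
    and M: "0 \<le> M" "\<And>i. i \<in> {1..N} \<Longrightarrow> \<rho> i p = 0 \<Longrightarrow> \<alpha> i \<le> M"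
  shows "conf (chart_inv c x) \<le> (\<Sum>i\<in>{1..N}. e powr (- \<alpha> i)) * t powr (- M)"
  unfolding conf_def sum_distrib_right
proof (rule sum_mono)
  fix i assume i: "i \<in> {1..N}"
  have "0 < e" using g by (simp add: good_radius_def)
  show "\<rho> i (chart_inv c x) powr (- \<alpha> i) \<le> e powr (- \<alpha> i) * t powr (- M)"
  proof (cases "\<rho> i p = 0")
    case True
    have "\<rho> i (chart_inv c x) powr (- \<alpha> i) \<le> (e * t) powr (- \<alpha> i)"
      using rho[OF i True] weights[OF i] \<open>0 < e\<close> t by (intro powr_mono2') auto
    also have "\<dots> = e powr (- \<alpha> i) * t powr (- \<alpha> i)"
      using \<open>0 < e\<close> t by (simp add: powr_mult)
    also have "\<dots> \<le> e powr (- \<alpha> i) * t powr (- M)"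
      using M(2)[OF i True] t by (intro mult_left_mono powr_mono') auto
    finally show ?thesis .
  next
    case False
    then have "e \<le> \<rho> i (chart_inv c x)"
      using g i x by (auto simp: good_radius_def)
    then have "\<rho> i (chart_inv c x) powr (- \<alpha> i) \<le> e powr (- \<alpha> i) * 1"
      using weights[OF i] \<open>0 < e\<close> by (simp add: powr_mono2')
    also have "\<dots> \<le> e powr (- \<alpha> i) * t powr (- M)"
    proof (intro mult_left_mono)
      show "1 \<le> t powr (- M)"
        using powr_mono'[of "- M" 0 t] M(1) t by simp
    qed simp
    finally show ?thesis .
  qed
qed

text \<open>The Lipschitz bound keeps \<open>\<rho> i\<close> below
  \<open>\<rho> i (chart_inv c x) + r / e\<close> on the ball of radius
  \<open>r = norm (x - y)\<close> around \<open>x\<close>, and this single term bounds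
  \<open>conf\<close> from below on the ball that every curve to \<open>y\<close> must leave. The
  summand \<open>\<rho> i (chart_inv c x)\<close> is positive for interior points and disappears in
  the limit at the face.\<close>

lemma dist_lower:
  assumes c: "c \<in> A" and W: "W \<subseteq> chart_dom c" and g: "good_radius c W p e"
    and i: "i \<in> {1..N}" "\<rho> i p = 0"
    and x: "x \<in> near c p (e / 4)" and y: "y \<in> near c p (e / 4)" and "x \<noteq> y"
    and xY: "chart_inv c x \<in> Y"
  shows "ennreal (sqrt e * (\<rho> i (chart_inv c x) + norm (x - y) / e) powr (- \<alpha> i / 2) * norm (x - y)) \<le>
    riemannian_dist Y A g (chart_inv c x) (chart_inv c y)"
proof -
  have e: "0 < e" and sub: "near c p e \<subseteq> coord c ` chart_dom c"
    and met: "\<And>x v. x \<in> near c p e \<Longrightarrow> e * (norm v)\<^sup>2 \<le> g0 c (chart_inv c x) v v"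
    using g image_mono[OF W, of "coord c"] unfolding good_radius_def by blast+
  have Lip: "\<And>x y. x \<in> near c p e \<Longrightarrow> y \<in> near c p e \<Longrightarrow>
      \<bar>\<rho> i (chart_inv c x) - \<rho> i (chart_inv c y)\<bar> \<le> norm (x - y) / e"
    using g i unfolding good_radius_def by (metis (lifting))
  define r where "r = norm (x - y)"
  have "0 < r" using \<open>x \<noteq> y\<close> by (simp add: r_def)
  \<comment> \<open>Points within \<open>e / 4\<close> of \<open>coord c p\<close> are less than
    \<open>e / 2\<close> apart, so the closed ball of radius \<open>r\<close> around
    \<open>x\<close> stays within radius \<open>e\<close>, where the estimates hold.\<close>
  have "r < e / 2"
    using x y norm_triangle_ineq4[of "x - coord c p" "y - coord c p"]
    by (simp add: near_def dist_norm norm_minus_commute r_def)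
  have ball: "corner_model (walls c) \<inter> cball x r \<subseteq> near c p e"
  proof
    fix w assume w: "w \<in> corner_model (walls c) \<inter> cball x r"
    have "dist (coord c p) w \<le> dist (coord c p) x + dist x w"
      by (rule dist_triangle)
    also have "\<dots> < e"
      using w x \<open>r < e / 2\<close> e by (simp add: near_def)
    finally show "w \<in> near c p e"
      using w by (simp add: near_def)
  qed
  have near4: "near c p (e / 4) \<subseteq> near c p e"
    using e by (auto simp: near_def)
  define h where "h = \<rho> i (chart_inv c x) + r / e"
  have "0 < \<rho> i (chart_inv c x)"
    using rho_pos_interior[OF i(1) xY] .
  then have h: "0 < h"
    using \<open>0 < r\<close> e by (simp add: h_def add_pos_pos)
  have "ennreal (sqrt e * h powr (- \<alpha> i / 2) * r) \<le> riemannian_dist Y A g (chart_inv c x) (chart_inv c y)"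
  proof (rule riemannian_dist_lower[OF c])
    show "corner_model (walls c) \<inter> cball x r \<subseteq> coord c ` chart_dom c"
      using ball sub by blast
    show "x \<in> corner_model (walls c)"
      using x by (simp add: near_def)
    show "chart_inv c y \<notin> chart_inv c ` (corner_model (walls c) \<inter> ball x r)"
    proof
      assume "chart_inv c y \<in> chart_inv c ` (corner_model (walls c) \<inter> ball x r)"
      then obtain w where w: "w \<in> corner_model (walls c)" "w \<in> ball x r" "chart_inv c y = chart_inv c w"
        by blast
      then have "w \<in> coord c ` chart_dom c"
        using ball sub by (meson IntI ball_subset_cball subsetD)
      then have "y = w"
        using w(3) coord_chart_inv[OF c, of w] coord_chart_inv[OF c, of y] y near4 sub by (metis subsetD)
      then show False
        using w(2) by (simp add: r_def dist_norm)
    qed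
    fix w v assume w: "w \<in> corner_model (walls c) \<inter> cball x r" "chart_inv c w \<in> Y"
    have wn: "w \<in> near c p e" using w ball by blast
    have pos: "0 < \<rho> i (chart_inv c w)"
      using rho_pos_interior[OF i(1) w(2)] .
    have "\<bar>\<rho> i (chart_inv c x) - \<rho> i (chart_inv c w)\<bar> \<le> norm (x - w) / e"
      using Lip[OF _ wn] x near4 by blast
    also have "\<dots> \<le> r / e"
      using w(1) e by (intro divide_right_mono) (auto simp: dist_norm)
    finally have "\<rho> i (chart_inv c w) \<le> h"
      by (simp add: h_def)
    then have "h powr (- \<alpha> i) \<le> \<rho> i (chart_inv c w) powr (- \<alpha> i)"
      using pos weights[OF i(1)] by (intro powr_mono2') auto
    also have "\<dots> \<le> conf (chart_inv c w)"
      unfolding conf_def using i(1) by (intro member_le_sum) auto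
    finally have "h powr (- \<alpha> i) * (e * (norm v)\<^sup>2) \<le> conf (chart_inv c w) * g0 c (chart_inv c w) v v"
      by (intro mult_mono met wn conf_nonneg) (use e in auto)
    moreover have "sqrt (h powr (- \<alpha> i) * (e * (norm v)\<^sup>2)) = sqrt e * h powr (- \<alpha> i / 2) * norm v"
      using h by (simp add: real_sqrt_mult powr_half_sqrt[symmetric] powr_powr)
    ultimately show "sqrt e * h powr (- \<alpha> i / 2) * norm v \<le> sqrt (conf (chart_inv c w) * g0 c (chart_inv c w) v v)"
      by (metis real_sqrt_le_iff)
  qed (use \<open>0 < r\<close> e in auto)
  then show ?thesis
    by (simp add: h_def r_def)
qed

end

section \<open>The induced distance on a face\<close>

context conformal_corner
begin

abbreviation dist_Y :: "'a \<Rightarrow> 'a \<Rightarrow> ennreal" where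
  "dist_Y \<equiv> riemannian_dist Y A g"

sublocale ext_pseudometric Y dist_Y
proof
  have Y: "Y \<subseteq> (\<Union>c\<in>A. chart_dom c)"
    using Y_subset dom_Union by simp
  show "dist_Y x y = dist_Y y x" for x y
    using riemannian_dist_sym_le[OF Y] by (simp add: antisym)
  show "dist_Y x z \<le> dist_Y x y + dist_Y y z" for x y z
    by (rule riemannian_dist_triangle[OF Y])
qed

section \<open>Upper bound for distances between interior points\<close>

lemma inward_in_near:
  assumes c: "c \<in> A" and x: "x \<in> near c p (e / 2)" and s: "0 \<le> s" "s * norm (inward c) < e / 2"
  shows "x + s *\<^sub>R inward c \<in> near c p e"
proof -
  have "x + s *\<^sub>R inward c \<in> corner_model (walls c)"
    using x s inner_inward[OF c] by (auto simp: near_def corner_model_def inner_add_left)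
  moreover have "dist (coord c p) (x + s *\<^sub>R inward c) \<le> dist (coord c p) x + dist x (x + s *\<^sub>R inward c)"
    by (rule dist_triangle)
  then have "dist (coord c p) (x + s *\<^sub>R inward c) < e"
    using x s by (simp add: near_def dist_norm)
  ultimately show ?thesis
    by (simp add: near_def)
qed

lemma inward_interior:
  assumes c: "c \<in> A" and x: "x \<in> corner_model (walls c)"
    and s: "0 < s" and S: "x + s *\<^sub>R inward c \<in> coord c ` chart_dom c"
  shows "chart_inv c (x + s *\<^sub>R inward c) \<in> Y"
proof (rule interiorI[OF c S])
  fix b assume "b \<in> walls c"
  then show "0 < (x + s *\<^sub>R inward c) \<bullet> b"
    using x s inner_inward[OF c] by (simp add: corner_model_def inner_add_left add_nonneg_pos)
qed

text \<open>The constants are uniform up to the face: after an inward shift by \<open>s\<close>,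
  each \<open>\<rho> i\<close> that vanishes at \<open>p\<close> is at least \<open>e * s\<close>,
  however small it was at \<open>x\<close>. The radius \<open>r\<close> is a variable of its own,
  since \<open>x = y\<close> has to be allowed with \<open>r > 0\<close> and since \<open>r\<close>
  must absorb the error of sequences that approach the face.\<close>

lemma dist_upper:
  assumes c: "c \<in> A" and W: "W \<subseteq> chart_dom c" and gr: "good_radius c W p e"
    and M: "0 \<le> M" "M < 2" "\<And>i. i \<in> {1..N} \<Longrightarrow> \<rho> i p = 0 \<Longrightarrow> \<alpha> i \<le> M"
  obtains C r0 where "0 \<le> C" "0 < r0"
    and "\<forall>x y r. x \<in> near c p (e / 2) \<longrightarrow> y \<in> near c p (e / 2) \<longrightarrow> chart_inv c x \<in> Y \<longrightarrow> chart_inv c y \<in> Y \<longrightarrow>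
      norm (x - y) \<le> r \<longrightarrow> 0 < r \<longrightarrow> r \<le> r0 \<longrightarrow>
      dist_Y (chart_inv c x) (chart_inv c y) \<le> ennreal (C * r powr (1 - M / 2))"
proof -
  define \<theta> where "\<theta> = 1 - M / 2"
  have \<theta>: "0 < \<theta>" using M by (simp add: \<theta>_def)
  define K where "K = (\<Sum>i\<in>{1..N}. e powr (- \<alpha> i))"
  have K: "0 \<le> K" unfolding K_def by (intro sum_nonneg) simp
  let ?\<nu> = "inward c"
  have e: "0 < e" "e < 1" and sub: "near c p e \<subseteq> coord c ` chart_dom c"
    and met: "\<And>x v. x \<in> near c p e \<Longrightarrow> g0 c (chart_inv c x) v v \<le> (norm v)\<^sup>2 / e"
    using gr image_mono[OF W, of "coord c"] unfolding good_radius_def by blast+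
  have grow: "\<rho> i (chart_inv c x) + e * t \<le> \<rho> i (chart_inv c (x + t *\<^sub>R ?\<nu>))"
    if "i \<in> {1..N}" "\<rho> i p = 0" "x \<in> near c p e" "0 \<le> t" "x + t *\<^sub>R ?\<nu> \<in> near c p e" for i x t
    using gr that unfolding good_radius_def by (metis (lifting))
  \<comment> \<open>Inward shifts by at most \<open>r0\<close> move a point by less than
    \<open>e / 2\<close>, so points of the half ball stay within radius \<open>e\<close>. The
    summand 1 covers the case \<open>inward c = 0\<close> and gives
    \<open>r0 \<le> 1\<close>.\<close>
  define r0 where "r0 = e / (2 * (1 + norm ?\<nu>))"
  have "0 < 1 + norm ?\<nu>" by (simp add: add_pos_nonneg)
  have r0: "0 < r0" using e \<open>0 < 1 + norm ?\<nu>\<close> by (simp add: r0_def)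
  have "r0 * (1 + norm ?\<nu>) = e / 2"
    using \<open>0 < 1 + norm ?\<nu>\<close> by (simp add: r0_def field_simps)
  moreover have "0 \<le> r0 * norm ?\<nu>" using r0 by simp
  ultimately have r0': "r0 * norm ?\<nu> < e / 2" "r0 \<le> 1"
    using r0 e unfolding distrib_left mult_1_right by linarith+
  have half: "near c p (e / 2) \<subseteq> near c p e"
    using e by (auto simp: near_def)
  have small: "s * norm ?\<nu> < e / 2" if "s \<le> r0" for s
    using mult_right_mono[OF that, of "norm ?\<nu>"] r0'(1) by simp
  have inside: "x + s *\<^sub>R ?\<nu> \<in> near c p e" if "x \<in> near c p (e / 2)" "0 \<le> s" "s \<le> r0" for x s
    by (intro inward_in_near c small that)
  have interior: "chart_inv c (x + s *\<^sub>R ?\<nu>) \<in> Y" if "x \<in> near c p (e / 2)" "0 < s" "s \<le> r0" for x s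
    by (rule inward_interior[OF c]) (use that inside[of x s] sub in \<open>auto simp: near_def\<close>)
  have speed_bound: "sqrt (conf w * g0 c w v v) \<le> sqrt (K / e) * s powr (- M / 2) * norm v"
    if x: "x \<in> near c p (e / 2)" and s: "0 < s" "s \<le> r0" and w: "w = chart_inv c (x + s *\<^sub>R ?\<nu>)" for x s v w
  proof -
    have in_near: "x + s *\<^sub>R ?\<nu> \<in> near c p e"
      using inside x s by simp
    have "conf w \<le> K * s powr (- M)"
      unfolding K_def w
    proof (rule good_radius_mono_conf[OF gr in_near])
      fix i assume i: "i \<in> {1..N}" "\<rho> i p = 0"
      have xn: "x \<in> near c p e" using x half by blast
      then have "chart_inv c x \<in> X"
        using sub chart_inv_in_dom[OF c] dom_subset[OF c] by blast
      then show "e * s \<le> \<rho> i (chart_inv c (x + s *\<^sub>R ?\<nu>))"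
        using grow[OF i xn _ in_near] rho_nonneg[OF i(1)] s by force
    qed (use s r0' M in auto)
    then have "conf w * g0 c w v v \<le> (K * s powr (- M)) * ((norm v)\<^sup>2 / e)"
    proof (rule mult_mono)
      show "g0 c w v v \<le> (norm v)\<^sup>2 / e"
        unfolding w by (rule met[OF in_near])
      have "w \<in> chart_dom c"
        unfolding w using in_near sub chart_inv_in_dom[OF c] by blast
      then show "0 \<le> g0 c w v v"
        using g0_pos[OF c, of w v] bilinear_lzero[OF g0_bilinear[OF c, of w]] by (cases "v = 0") auto
    qed (use K in auto)
    then have "sqrt (conf w * g0 c w v v) \<le> sqrt ((K * s powr (- M)) * ((norm v)\<^sup>2 / e))"
      by (rule real_sqrt_le_mono)
    also have "(K * s powr (- M)) * ((norm v)\<^sup>2 / e) = (K / e) * (s powr (- M / 2) * norm v)\<^sup>2"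
      using s by (simp add: power_mult_distrib powr_power)
    also have "sqrt \<dots> = sqrt (K / e) * (s powr (- M / 2) * norm v)"
      by (subst real_sqrt_mult) simp
    finally show ?thesis by (simp add: mult.assoc)
  qed
  have convex_near: "convex (near c p (e / 2))"
    unfolding near_def by (intro convex_Int convex_corner_model convex_ball)
  \<comment> \<open>The factor \<open>1 / \<theta>\<close> is the integral of
    \<open>t powr (- M / 2)\<close> over \<open>{0..1}\<close>, finite since
    \<open>M < 2\<close>.\<close>
  define Cv where "Cv = sqrt (K / e) * norm ?\<nu> / \<theta>"
  have Cv: "0 \<le> Cv" using K e \<theta> by (simp add: Cv_def)
  have vertical: "dist_Y (chart_inv c x) (chart_inv c (x + r *\<^sub>R ?\<nu>)) \<le> ennreal (Cv * r powr \<theta>)"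
    if x: "x \<in> near c p (e / 2)" "chart_inv c x \<in> Y" and r: "0 < r" "r \<le> r0" for x r
  proof -
    define c0 where "c0 = sqrt (K / e) * norm ?\<nu> * r powr \<theta>"
    have c0: "0 \<le> c0" using K e by (simp add: c0_def)
    have pt: "x + t *\<^sub>R (x + r *\<^sub>R ?\<nu> - x) = x + (t * r) *\<^sub>R ?\<nu>" for t by simp
    have tr: "0 \<le> t * r" "t * r \<le> r0" if "t \<in> {0..1}" for t
    proof -
      have "t * r \<le> 1 * r"
        using that r by (intro mult_right_mono) auto
      then show "t * r \<le> r0"
        using r(2) by linarith
      show "0 \<le> t * r"
        using that r by simp
    qed
    have "dist_Y (chart_inv c x) (chart_inv c (x + r *\<^sub>R ?\<nu>)) \<le>
        (\<integral>\<^sup>+t\<in>{0..1}. ennreal (c0 * t powr (- M / 2)) \<partial>lborel)"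
    proof (rule riemannian_dist_segment[OF c], unfold pt)
      fix t :: real assume t: "t \<in> {0..1}"
      show "x + (t * r) *\<^sub>R ?\<nu> \<in> coord c ` chart_dom c"
        using inside[OF x(1) tr[OF t]] sub by blast
      \<comment> \<open>At shift 0 the point is the one represented by \<open>x\<close>, interior by
        assumption; every positive shift makes it interior.\<close>
      show "chart_inv c (x + (t * r) *\<^sub>R ?\<nu>) \<in> Y"
        using interior[OF x(1), of "t * r"] tr[OF t] x(2) by (cases "t * r = 0") auto
    next
      fix t w assume t: "t \<in> {0<..<1::real}" and w: "w = chart_inv c (x + (t * r) *\<^sub>R ?\<nu>)"
      have "sqrt (conf w * g0 c w (x + r *\<^sub>R ?\<nu> - x) (x + r *\<^sub>R ?\<nu> - x)) \<le>
          sqrt (K / e) * (t * r) powr (- M / 2) * norm (x + r *\<^sub>R ?\<nu> - x)"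
        using t r tr[of t] by (intro speed_bound[OF x(1) _ _ w]) auto
      also have "\<dots> = sqrt (K / e) * norm ?\<nu> * (r powr (- M / 2) * r) * t powr (- M / 2)"
        using t r by (simp add: powr_mult)
      also have "r powr (- M / 2) * r = r powr \<theta>"
        using r powr_add[of r "- M / 2" 1] by (simp add: \<theta>_def)
      finally show "sqrt (conf w * g0 c w (x + r *\<^sub>R ?\<nu> - x) (x + r *\<^sub>R ?\<nu> - x)) \<le> c0 * t powr (- M / 2)"
        by (simp add: c0_def)
    qed
    also have "\<dots> = ennreal (c0 * (1 powr (- M / 2 + 1) / (- M / 2 + 1)))"
      using c0 M by (intro nn_integral_has_integral_lebesgue' has_integral_mult_right has_integral_powr_from_0) auto
    also have "c0 * (1 powr (- M / 2 + 1) / (- M / 2 + 1)) = Cv * r powr \<theta>"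
      by (simp add: c0_def Cv_def \<theta>_def)
    finally show ?thesis .
  qed
  define C where "C = 2 * Cv + sqrt (K / e)"
  have "0 \<le> C" using Cv K e by (simp add: C_def)
  moreover have "dist_Y (chart_inv c x) (chart_inv c y) \<le> ennreal (C * r powr \<theta>)"
    if x: "x \<in> near c p (e / 2)" "chart_inv c x \<in> Y" and y: "y \<in> near c p (e / 2)" "chart_inv c y \<in> Y"
      and r: "norm (x - y) \<le> r" "0 < r" "r \<le> r0" for x y r
  proof -
    let ?x = "x + r *\<^sub>R ?\<nu>" and ?y = "y + r *\<^sub>R ?\<nu>"
    have pt: "?x + t *\<^sub>R (?y - ?x) = ((1 - t) *\<^sub>R x + t *\<^sub>R y) + r *\<^sub>R ?\<nu>" for t
      by (simp add: algebra_simps)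
    have comb: "(1 - t) *\<^sub>R x + t *\<^sub>R y \<in> near c p (e / 2)" if "t \<in> {0..1}" for t
      using that x y by (intro convexD[OF convex_near]) auto
    \<comment> \<open>The segment from \<open>x\<close> to \<open>y\<close>, shifted inward by
      \<open>r\<close>. At this height the speed factor is of order \<open>r powr (- M / 2)\<close>,
      and the coordinate length is at most \<open>r\<close>.\<close>
    have horizontal: "dist_Y (chart_inv c ?x) (chart_inv c ?y) \<le>
        (\<integral>\<^sup>+t\<in>{0..1::real}. ennreal (sqrt (K / e) * r powr \<theta>) \<partial>lborel)"
    proof (rule riemannian_dist_segment[OF c], unfold pt)
      fix t :: real assume t: "t \<in> {0..1}"
      show "((1 - t) *\<^sub>R x + t *\<^sub>R y) + r *\<^sub>R ?\<nu> \<in> coord c ` chart_dom c"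
        using inside[OF comb[OF t]] r sub by auto
      show "chart_inv c (((1 - t) *\<^sub>R x + t *\<^sub>R y) + r *\<^sub>R ?\<nu>) \<in> Y"
        using interior[OF comb[OF t]] r by auto
    next
      fix t w assume t: "t \<in> {0<..<1::real}" and w: "w = chart_inv c (((1 - t) *\<^sub>R x + t *\<^sub>R y) + r *\<^sub>R ?\<nu>)"
      have "sqrt (conf w * g0 c w (?y - ?x) (?y - ?x)) \<le> sqrt (K / e) * r powr (- M / 2) * norm (?y - ?x)"
        using t r by (intro speed_bound[OF comb _ _ w]) auto
      also have "\<dots> \<le> sqrt (K / e) * r powr (- M / 2) * r"
        using r(1) K e by (intro mult_left_mono) (auto simp: norm_minus_commute)
      also have "\<dots> = sqrt (K / e) * r powr \<theta>"
        using r powr_add[of r "- M / 2" 1] by (simp add: \<theta>_def)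
      finally show "sqrt (conf w * g0 c w (?y - ?x) (?y - ?x)) \<le> sqrt (K / e) * r powr \<theta>" .
    qed
    then have horizontal': "dist_Y (chart_inv c ?x) (chart_inv c ?y) \<le> ennreal (sqrt (K / e) * r powr \<theta>)"
      by (simp add: nn_integral_cmult)
    have "dist_Y (chart_inv c x) (chart_inv c y) \<le>
        dist_Y (chart_inv c x) (chart_inv c ?x) + dist_Y (chart_inv c ?x) (chart_inv c ?y) + dist_Y (chart_inv c ?y) (chart_inv c y)"
      by (rule dist_quadrangle)
    also have "\<dots> \<le> ennreal (Cv * r powr \<theta>) + ennreal (sqrt (K / e) * r powr \<theta>) + ennreal (Cv * r powr \<theta>)"
      using vertical[OF x r(2,3)] vertical[OF y r(2,3)] horizontal'
      by (intro add_mono) (simp_all add: ext_dist_sym)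
    also have "\<dots> = ennreal (C * r powr \<theta>)"
      using Cv K e by (simp add: C_def distrib_right flip: ennreal_plus)
    finally show ?thesis .
  qed
  ultimately show ?thesis
    using that[of C r0] r0 unfolding \<theta>_def by blast
qed

section \<open>Interior sequences that converge to a point of the face\<close>

lemma coord_tendsto:
  assumes c: "c \<in> A" and q: "q \<in> chart_dom c" and u: "range u \<subseteq> X" "u \<longlonglongrightarrow> q"
  shows "\<forall>\<^sub>F n in sequentially. u n \<in> chart_dom c" "(\<lambda>n. coord c (u n)) \<longlonglongrightarrow> coord c q"
proof -
  obtain G where G: "open G" "chart_dom c = X \<inter> G"
    using openin_dom[OF c] by (auto simp: openin_open)
  have "\<forall>\<^sub>F n in sequentially. u n \<in> G"
    using u(2) G q by (intro topological_tendstoD) auto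
  then show ev: "\<forall>\<^sub>F n in sequentially. u n \<in> chart_dom c"
    using u(1) G by (auto elim!: eventually_mono)
  show "(\<lambda>n. coord c (u n)) \<longlonglongrightarrow> coord c q"
    by (rule continuous_on_tendsto_compose[OF continuous_on_coord[OF c] u(2) q ev])
qed

lemma rho_tendsto:
  assumes i: "i \<in> {1..N}" and c: "c \<in> A" and q: "q \<in> chart_dom c" and u: "range u \<subseteq> X" "u \<longlonglongrightarrow> q"
  shows "(\<lambda>n. \<rho> i (u n)) \<longlonglongrightarrow> \<rho> i q"
proof -
  have "continuous_on (coord c ` chart_dom c) (\<rho> i \<circ> chart_inv c)"
    using bdf[OF i] c
    by (intro smooth_on_imp_continuous_on) (simp add: boundary_defining_function_def smooth_function_def)
  then have "(\<lambda>n. (\<rho> i \<circ> chart_inv c) (coord c (u n))) \<longlonglongrightarrow> (\<rho> i \<circ> chart_inv c) (coord c q)"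
    by (rule continuous_on_tendsto_compose[OF _ coord_tendsto(2)[OF assms(2-)]])
      (use q coord_tendsto(1)[OF assms(2-)] in \<open>auto elim!: eventually_mono\<close>)
  moreover have "\<forall>\<^sub>F n in sequentially. (\<rho> i \<circ> chart_inv c) (coord c (u n)) = \<rho> i (u n)"
    using coord_tendsto(1)[OF assms(2-)] by eventually_elim (simp add: chart_inv_coord[OF c])
  ultimately show ?thesis
    using chart_inv_coord[OF c q] by (simp add: tendsto_cong)
qed

text \<open>The coordinates of \<open>q\<close> are shifted inward by amounts of order
  \<open>1 / (n + 1)\<close>. Such sequences are the witnesses along which
  \<open>boundary_dist\<close> is evaluated.\<close>

lemma ex_interior_sequence:
  assumes c: "c \<in> A" and q: "q \<in> chart_dom c"
  obtains u where "range u \<subseteq> Y" "u \<longlonglongrightarrow> q"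
proof -
  let ?z = "coord c q" and ?\<nu> = "inward c"
  obtain e where gr: "good_radius c (chart_dom c) q e"
    using ex_good_radius[OF c openin_dom[OF c] order_refl q] .
  then have e: "0 < e" and sub: "near c q e \<subseteq> coord c ` chart_dom c"
    by (auto simp: good_radius_def)
  have z: "?z \<in> near c q (e / 2)"
    using coord_image_subset[OF c] q e by (auto simp: near_def)
  define s where "s n = e / (2 * (1 + norm ?\<nu>)) / real (Suc n)" for n
  have pos: "0 < 1 + norm ?\<nu>" by (simp add: add_pos_nonneg)
  have s: "0 < s n" "s n * norm ?\<nu> < e / 2" for n
  proof -
    show "0 < s n" using e pos by (simp add: s_def)
    have "s n \<le> e / (2 * (1 + norm ?\<nu>)) / 1"
      unfolding s_def using e pos by (intro divide_left_mono) auto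
    then have "s n * (1 + norm ?\<nu>) \<le> e / (2 * (1 + norm ?\<nu>)) * (1 + norm ?\<nu>)"
      using pos by (intro mult_right_mono) auto
    also have "\<dots> = e / 2" using pos by (simp add: field_simps)
    finally show "s n * norm ?\<nu> < e / 2"
      using \<open>0 < s n\<close> by (simp add: distrib_left)
  qed
  have in_near: "?z + s n *\<^sub>R ?\<nu> \<in> near c q e" for n
    using s by (intro inward_in_near c z) (auto intro: less_imp_le)
  define u where "u n = chart_inv c (?z + s n *\<^sub>R ?\<nu>)" for n
  have "range u \<subseteq> Y"
  proof (rule image_subsetI)
    fix n
    show "u n \<in> Y"
      unfolding u_def using in_near sub z s by (intro inward_interior c) (auto simp: near_def)
  qed
  moreover have "s \<longlonglongrightarrow> 0"
    unfolding s_def by (rule LIMSEQ_Suc[OF lim_const_over_n])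
  then have "(\<lambda>n. ?z + s n *\<^sub>R ?\<nu>) \<longlonglongrightarrow> ?z + 0 *\<^sub>R ?\<nu>"
    by (intro tendsto_intros)
  then have lim: "(\<lambda>n. ?z + s n *\<^sub>R ?\<nu>) \<longlonglongrightarrow> ?z" by simp
  have "u \<longlonglongrightarrow> chart_inv c ?z"
    unfolding u_def
    by (rule continuous_on_tendsto_compose[OF continuous_on_chart_inv[OF c] lim])
      (use q in_near sub in \<open>auto intro!: always_eventually\<close>)
  then have "u \<longlonglongrightarrow> q"
    by (simp add: chart_inv_coord[OF c q])
  ultimately show ?thesis by (rule that)
qed

lemma eventually_in_near:
  assumes c: "c \<in> A" and q: "q \<in> chart_dom c" "coord c q \<in> ball (coord c p) e"
    and u: "range u \<subseteq> X" "u \<longlonglongrightarrow> q"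
  shows "\<forall>\<^sub>F n in sequentially. coord c (u n) \<in> near c p e \<and> chart_inv c (coord c (u n)) = u n"
proof -
  have "\<forall>\<^sub>F n in sequentially. coord c (u n) \<in> ball (coord c p) e"
    using coord_tendsto(2)[OF c q(1) u] q(2) by (rule topological_tendstoD[OF _ open_ball])
  then show ?thesis
    using coord_tendsto(1)[OF c q(1) u]
    by eventually_elim (use coord_image_subset[OF c] chart_inv_coord[OF c] in \<open>auto simp: near_def\<close>)
qed

text \<open>Since \<open>\<rho> i\<close> tends to 0 along \<open>u\<close>, only the distance
  divided by \<open>e\<close> survives in the base of the power in \<open>dist_lower\<close>, and
  the two powers of the distance merge. The form with a bound \<open>B\<close> serves both a
  constant second sequence, in the test for accessibility, and a sequence tending to another
  point.\<close>

lemma lower_limit: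
  assumes c: "c \<in> A" and W: "W \<subseteq> chart_dom c" and gr: "good_radius c W p e"
    and i: "i \<in> {1..N}" "\<rho> i p = 0"
    and q: "q \<in> chart_dom c" "coord c q \<in> ball (coord c p) (e / 4)" "\<rho> i q = 0"
    and q': "q' \<in> chart_dom c" "coord c q' \<in> ball (coord c p) (e / 4)"
    and ne: "coord c q \<noteq> coord c q'"
    and u: "range u \<subseteq> Y" "u \<longlonglongrightarrow> q" and v: "range v \<subseteq> X" "v \<longlonglongrightarrow> q'"
    and B: "\<forall>\<^sub>F n in sequentially. dist_Y (u n) (v n) \<le> ennreal B" "0 \<le> B"
  shows "sqrt e * (1 / e) powr (- \<alpha> i / 2) * norm (coord c q - coord c q') powr (1 - \<alpha> i / 2) \<le> B"
proof -
  have e: "0 < e" using gr by (simp add: good_radius_def)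
  have uX: "range u \<subseteq> X" using u(1) Y_subset by blast
  let ?n = "\<lambda>n. norm (coord c (u n) - coord c (v n))" and ?l = "norm (coord c q - coord c q')"
  have l: "0 < ?l" using ne by simp
  have diff: "(\<lambda>n. coord c (u n) - coord c (v n)) \<longlonglongrightarrow> coord c q - coord c q'"
    by (intro tendsto_diff coord_tendsto(2)[OF c q(1) uX u(2)] coord_tendsto(2)[OF c q'(1) v])
  then have n: "?n \<longlonglongrightarrow> ?l" by (rule tendsto_norm)
  have "(\<lambda>n. sqrt e * (\<rho> i (u n) + ?n n / e) powr (- \<alpha> i / 2) * ?n n) \<longlonglongrightarrow>
      sqrt e * (\<rho> i q + ?l / e) powr (- \<alpha> i / 2) * ?l"
    using rho_tendsto[OF i(1) c q(1) uX u(2)] n q(3) l e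
    by (intro tendsto_mult tendsto_powr tendsto_add tendsto_divide tendsto_const) auto
  moreover have "\<forall>\<^sub>F n in sequentially. sqrt e * (\<rho> i (u n) + ?n n / e) powr (- \<alpha> i / 2) * ?n n \<le> B"
    using eventually_in_near[OF c q(1,2) uX u(2)] eventually_in_near[OF c q' v] B(1)
      order_tendstoD(1)[OF n l]
  proof eventually_elim
    case (elim n)
    have "ennreal (sqrt e * (\<rho> i (chart_inv c (coord c (u n))) + ?n n / e) powr (- \<alpha> i / 2) * ?n n)
        \<le> dist_Y (chart_inv c (coord c (u n))) (chart_inv c (coord c (v n)))"
      by (rule dist_lower[OF c W gr i]) (use elim u(1) in auto)
    then have "ennreal (sqrt e * (\<rho> i (u n) + ?n n / e) powr (- \<alpha> i / 2) * ?n n) \<le> ennreal B"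
      using elim by simp
    then show ?case
      using B(2) by simp
  qed
  ultimately have "sqrt e * (\<rho> i q + ?l / e) powr (- \<alpha> i / 2) * ?l \<le> B"
    by (rule tendsto_upperbound) simp
  moreover have "(\<rho> i q + ?l / e) powr (- \<alpha> i / 2) * ?l = (1 / e) powr (- \<alpha> i / 2) * ?l powr (1 - \<alpha> i / 2)"
    using q(3) l e powr_mult[of "1 / e" ?l "- \<alpha> i / 2"] powr_add[of ?l "- \<alpha> i / 2" 1] by simp
  ultimately show ?thesis
    by (simp add: mult.assoc)
qed

text \<open>A Cauchy sequence is compared with one of its own late terms. For
  \<open>\<alpha> i \<ge> 2\<close> the exponent \<open>1 - \<alpha> i / 2\<close> is not positive
  and the coordinate distance is at most 1, so \<open>lower_limit\<close> would force
  \<open>k \<le> k / 2\<close>.\<close>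

lemma accessible_weight:
  assumes p: "p \<in> X" and i: "i \<in> {1..N}" "\<rho> i p = 0" and acc: "accessible_point Y dist_Y p"
  shows "\<alpha> i < 2"
proof (rule ccontr)
  assume "\<not> \<alpha> i < 2"
  obtain c where c: "c \<in> A" "p \<in> chart_dom c"
    using p dom_Union by blast
  obtain e where gr: "good_radius c (chart_dom c) p e"
    using ex_good_radius[OF c(1) openin_dom[OF c(1)] order_refl c(2)] .
  then have e: "0 < e" "e < 1" by (auto simp: good_radius_def)
  obtain u where u: "dist_Cauchy Y dist_Y u" "u \<longlonglongrightarrow> p"
    using acc by (auto simp: accessible_point_def)
  then have uY: "range u \<subseteq> Y" by (simp add: dist_Cauchy_def)
  then have uX: "range u \<subseteq> X" using Y_subset by blast
  define k where "k = sqrt e * (1 / e) powr (- \<alpha> i / 2)"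
  have "0 < k" using e by (simp add: k_def)
  then have "0 < ennreal (k / 2)" by simp
  then obtain K where K: "\<And>m n. m \<ge> K \<Longrightarrow> n \<ge> K \<Longrightarrow> dist_Y (u m) (u n) < ennreal (k / 2)"
    using u(1)[unfolded dist_Cauchy_def, THEN conjunct2, rule_format, OF \<open>0 < ennreal (k / 2)\<close>]
    by (elim exE) blast
  have pb: "coord c p \<in> ball (coord c p) (e / 4)" using e by simp
  have "\<forall>\<^sub>F n in sequentially. n \<ge> K \<and> u n \<in> chart_dom c \<and> coord c (u n) \<in> ball (coord c p) (e / 4)"
    using eventually_ge_at_top[of K] coord_tendsto(1)[OF c uX u(2)] eventually_in_near[OF c pb uX u(2)]
    by eventually_elim (auto simp: near_def)
  then obtain n where n: "n \<ge> K" "u n \<in> chart_dom c" "coord c (u n) \<in> ball (coord c p) (e / 4)"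
    unfolding eventually_sequentially by blast
  have "0 < \<rho> i (u n)"
    using rho_pos_interior[OF i(1)] uY by auto
  then have "u n \<noteq> p" using i(2) by auto
  then have ne: "coord c p \<noteq> coord c (u n)"
    using chart_inv_coord[OF c(1)] n(2) c(2) by metis
  have "k * norm (coord c p - coord c (u n)) powr (1 - \<alpha> i / 2) \<le> k / 2"
    unfolding k_def
  proof (rule lower_limit[OF c(1) order_refl gr i c(2) pb i(2) n(2,3) ne uY u(2)])
    show "range (\<lambda>_. u n) \<subseteq> X" using uX by auto
    show "\<forall>\<^sub>F m in sequentially. dist_Y (u m) (u n) \<le> ennreal (sqrt e * (1 / e) powr (- \<alpha> i / 2) / 2)"
      using eventually_ge_at_top[of K]
      by eventually_elim (use K n(1) in \<open>auto simp: k_def intro: less_imp_le\<close>)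
  qed (use e in auto)
  moreover have "1 \<le> norm (coord c p - coord c (u n)) powr (1 - \<alpha> i / 2)"
  proof -
    have "norm (coord c p - coord c (u n)) \<le> 1"
      using n(3) e by (simp add: dist_norm)
    then show ?thesis
      using powr_mono'[of "1 - \<alpha> i / 2" 0 "norm (coord c p - coord c (u n))"] ne \<open>\<not> \<alpha> i < 2\<close> by simp
  qed
  then have "k * 1 \<le> k * norm (coord c p - coord c (u n)) powr (1 - \<alpha> i / 2)"
    using \<open>0 < k\<close> by (intro mult_left_mono) auto
  ultimately show False
    using \<open>0 < k\<close> by simp
qed

text \<open>Each sequence may use half of the gap between \<open>r\<close> and the coordinate
  distance of the limits. The two indices are independent, as the Cauchy property requires.\<close>

lemma dist_eventually_small:
  assumes c: "c \<in> A"
    and upper: "\<forall>x y r. x \<in> near c p (e / 2) \<longrightarrow> y \<in> near c p (e / 2) \<longrightarrow> chart_inv c x \<in> Y \<longrightarrow> chart_inv c y \<in> Y \<longrightarrow>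
      norm (x - y) \<le> r \<longrightarrow> 0 < r \<longrightarrow> r \<le> r0 \<longrightarrow>
      dist_Y (chart_inv c x) (chart_inv c y) \<le> ennreal (C * r powr \<theta>)"
    and q: "q \<in> chart_dom c" "coord c q \<in> ball (coord c p) (e / 2)"
    and q': "q' \<in> chart_dom c" "coord c q' \<in> ball (coord c p) (e / 2)"
    and u: "range u \<subseteq> Y" "u \<longlonglongrightarrow> q" and v: "range v \<subseteq> Y" "v \<longlonglongrightarrow> q'"
    and r: "norm (coord c q - coord c q') < r" "r \<le> r0"
  shows "\<exists>K. \<forall>m\<ge>K. \<forall>n\<ge>K. dist_Y (u m) (v n) \<le> ennreal (C * r powr \<theta>)"
proof -
  define \<delta> where "\<delta> = (r - norm (coord c q - coord c q')) / 2"
  have \<delta>: "0 < \<delta>" using r by (simp add: \<delta>_def)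
  have "0 < r" using r(1) by (meson le_less_trans norm_ge_zero)
  have uX: "range u \<subseteq> X" and vX: "range v \<subseteq> X" using u v Y_subset by blast+
  have "\<forall>\<^sub>F n in sequentially. (coord c (u n) \<in> near c p (e / 2) \<and> chart_inv c (coord c (u n)) = u n \<and>
      dist (coord c (u n)) (coord c q) < \<delta>) \<and>
      (coord c (v n) \<in> near c p (e / 2) \<and> chart_inv c (coord c (v n)) = v n \<and>
      dist (coord c (v n)) (coord c q') < \<delta>)"
    using eventually_in_near[OF c q uX u(2)] eventually_in_near[OF c q' vX v(2)]
      tendstoD[OF coord_tendsto(2)[OF c q(1) uX u(2)] \<delta>] tendstoD[OF coord_tendsto(2)[OF c q'(1) vX v(2)] \<delta>]
    by eventually_elim blast
  then obtain K where K: "\<And>n. n \<ge> K \<Longrightarrow> (coord c (u n) \<in> near c p (e / 2) \<and> chart_inv c (coord c (u n)) = u n \<and>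
      dist (coord c (u n)) (coord c q) < \<delta>) \<and>
      (coord c (v n) \<in> near c p (e / 2) \<and> chart_inv c (coord c (v n)) = v n \<and>
      dist (coord c (v n)) (coord c q') < \<delta>)"
    unfolding eventually_sequentially by blast
  have "dist_Y (u m) (v n) \<le> ennreal (C * r powr \<theta>)" if mn: "m \<ge> K" "n \<ge> K" for m n
  proof -
    have "norm (coord c (u m) - coord c (v n)) \<le>
        dist (coord c (u m)) (coord c q) + norm (coord c q - coord c q') + dist (coord c (v n)) (coord c q')"
      using dist_triangle[of "coord c (u m)" "coord c (v n)" "coord c q"]
        dist_triangle[of "coord c q" "coord c (v n)" "coord c q'"]
      by (simp add: dist_norm norm_minus_commute)
    also have "\<dots> \<le> r"
      using K[OF mn(1)] K[OF mn(2)] by (simp add: \<delta>_def)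
    finally have "dist_Y (chart_inv c (coord c (u m))) (chart_inv c (coord c (v n))) \<le> ennreal (C * r powr \<theta>)"
      using upper K[OF mn(1)] K[OF mn(2)] u(1) v(1) r(2) \<open>0 < r\<close>
      by (metis range_subsetD)
    then show ?thesis
      using K[OF mn(1)] K[OF mn(2)] by simp
  qed
  then show ?thesis by blast
qed

text \<open>For equal limits the coordinate distance is 0, so \<open>r\<close> can be taken
  arbitrarily small, and \<open>C * r powr \<theta>\<close> tends to 0 with it. Comparing a sequence
  with itself gives the Cauchy property.\<close>

lemma sequences_Cauchy_equiv:
  assumes c: "c \<in> A"
    and upper: "\<forall>x y r. x \<in> near c p (e / 2) \<longrightarrow> y \<in> near c p (e / 2) \<longrightarrow> chart_inv c x \<in> Y \<longrightarrow> chart_inv c y \<in> Y \<longrightarrow>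
      norm (x - y) \<le> r \<longrightarrow> 0 < r \<longrightarrow> r \<le> r0 \<longrightarrow>
      dist_Y (chart_inv c x) (chart_inv c y) \<le> ennreal (C * r powr \<theta>)"
    and pos: "0 < r0" "0 \<le> C" "0 < \<theta>"
    and q: "q \<in> chart_dom c" "coord c q \<in> ball (coord c p) (e / 2)"
    and u: "range u \<subseteq> Y" "u \<longlonglongrightarrow> q" and v: "range v \<subseteq> Y" "v \<longlonglongrightarrow> q"
  shows "(u, v) \<in> Cauchy_equiv Y dist_Y"
proof -
  have small: "\<exists>K. \<forall>m\<ge>K. \<forall>n\<ge>K. dist_Y (u m) (v n) < \<epsilon>"
    if \<epsilon>: "0 < \<epsilon>" and u: "range u \<subseteq> Y" "u \<longlonglongrightarrow> q" and v: "range v \<subseteq> Y" "v \<longlonglongrightarrow> q" for \<epsilon> u v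
  proof -
    have "((\<lambda>r. r powr \<theta>) \<longlongrightarrow> 0) (at_right 0)"
      by (rule tendsto_zero_powrI[OF tendsto_ident_at tendsto_const _ pos(3)])
        (auto intro: small_scale_right[of 1])
    then have "((\<lambda>r. ennreal (C * r powr \<theta>)) \<longlongrightarrow> ennreal (C * 0)) (at_right 0)"
      by (intro tendsto_ennrealI tendsto_mult tendsto_const)
    then have "\<forall>\<^sub>F r in at_right 0. ennreal (C * r powr \<theta>) < \<epsilon>"
      by (rule order_tendstoD) (use \<epsilon> in simp)
    moreover have "\<forall>\<^sub>F r in at_right 0. 0 < r \<and> r \<le> r0"
      by (rule small_scale_right[of r0]) (use pos in auto)
    ultimately have "\<forall>\<^sub>F r in at_right 0. ennreal (C * r powr \<theta>) < \<epsilon> \<and> 0 < r \<and> r \<le> r0"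
      by eventually_elim blast
    then obtain r where r: "ennreal (C * r powr \<theta>) < \<epsilon>" "0 < r" "r \<le> r0"
      using eventually_happens[of _ "at_right (0::real)"] by auto
    have "norm (coord c q - coord c q) < r" using r(2) by simp
    then obtain K where "\<forall>m\<ge>K. \<forall>n\<ge>K. dist_Y (u m) (v n) \<le> ennreal (C * r powr \<theta>)"
      using dist_eventually_small[OF c upper q q u v _ r(3)] by blast
    then show ?thesis
      using r(1) by (intro exI[of _ K]) (auto intro: le_less_trans)
  qed
  have Cauchy: "dist_Cauchy Y dist_Y w" if "range w \<subseteq> Y" "w \<longlonglongrightarrow> q" for w
    unfolding dist_Cauchy_def using small[OF _ that that] that(1) by blast
  have "(\<lambda>n. dist_Y (u n) (v n)) \<longlonglongrightarrow> 0"
  proof (rule order_tendstoI)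
    fix \<epsilon> :: ennreal assume "0 < \<epsilon>"
    then obtain K where "\<forall>m\<ge>K. \<forall>n\<ge>K. dist_Y (u m) (v n) < \<epsilon>"
      using small[OF _ u v] by blast
    then show "\<forall>\<^sub>F n in sequentially. dist_Y (u n) (v n) < \<epsilon>"
      by (intro eventually_sequentiallyI[of K]) auto
  qed auto
  then show ?thesis
    using Cauchy u v by (simp add: Cauchy_equiv_def)
qed

text \<open>Both estimates pass to the completion. The index \<open>i\<close> attains the largest
  weight among the functions vanishing at \<open>p\<close>, so the two exponents agree; the lower
  bound also asks that \<open>\<rho> i\<close> vanish at \<open>q\<close>, as it does along the
  face.\<close>

lemma boundary_dist_comparison:
  assumes c: "c \<in> A" and W: "W \<subseteq> chart_dom c" and gr: "good_radius c W p e"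
    and M: "0 \<le> M" "M < 2" "\<And>i. i \<in> {1..N} \<Longrightarrow> \<rho> i p = 0 \<Longrightarrow> \<alpha> i \<le> M"
    and i: "i \<in> {1..N}" "\<rho> i p = 0" "\<alpha> i = M"
  obtains C r0 k where "0 \<le> C" "0 < r0" "0 < k"
    and "\<forall>q q' r. q \<in> chart_dom c \<longrightarrow> q' \<in> chart_dom c \<longrightarrow>
      coord c q \<in> ball (coord c p) (e / 4) \<longrightarrow> coord c q' \<in> ball (coord c p) (e / 4) \<longrightarrow>
      norm (coord c q - coord c q') < r \<longrightarrow> r \<le> r0 \<longrightarrow>
      boundary_dist Y dist_Y q q' \<le> ennreal (C * r powr (1 - M / 2))"
    and "\<forall>q q'. q \<in> chart_dom c \<longrightarrow> q' \<in> chart_dom c \<longrightarrow> \<rho> i q = 0 \<longrightarrow>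
      coord c q \<in> ball (coord c p) (e / 4) \<longrightarrow> coord c q' \<in> ball (coord c p) (e / 4) \<longrightarrow>
      ennreal (k * norm (coord c q - coord c q') powr (1 - M / 2)) \<le> boundary_dist Y dist_Y q q'"
proof -
  let ?\<theta> = "1 - M / 2"
  have \<theta>: "0 < ?\<theta>" using M by simp
  have e: "0 < e" using gr by (simp add: good_radius_def)
  obtain C r0 where C: "0 \<le> C" "0 < r0" and upper: "\<forall>x y r. x \<in> near c p (e / 2) \<longrightarrow> y \<in> near c p (e / 2) \<longrightarrow>
      chart_inv c x \<in> Y \<longrightarrow> chart_inv c y \<in> Y \<longrightarrow> norm (x - y) \<le> r \<longrightarrow> 0 < r \<longrightarrow> r \<le> r0 \<longrightarrow>
      dist_Y (chart_inv c x) (chart_inv c y) \<le> ennreal (C * r powr ?\<theta>)"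
    using dist_upper[OF c W gr M] .
  have half: "x \<in> ball (coord c p) (e / 2)" if "x \<in> ball (coord c p) (e / 4)" for x
    using that e by simp
  have lim: "(\<lambda>n. dist_Y (u n) (v n)) \<longlonglongrightarrow> boundary_dist Y dist_Y q q'"
    if q: "q \<in> chart_dom c" "coord c q \<in> ball (coord c p) (e / 4)"
      and q': "q' \<in> chart_dom c" "coord c q' \<in> ball (coord c p) (e / 4)"
      and u: "range u \<subseteq> Y" "u \<longlonglongrightarrow> q" and v: "range v \<subseteq> Y" "v \<longlonglongrightarrow> q'" for q q' u v
    by (rule boundary_dist_tendsto[OF _ _ u v])
      (rule sequences_Cauchy_equiv[OF c upper C(2,1) \<theta>]; use q q' half in blast)+
  define k where "k = sqrt e * (1 / e) powr (- \<alpha> i / 2)"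
  have k: "0 < k" using e by (simp add: k_def)
  show ?thesis
  proof (rule that[OF C k]; intro allI impI)
    fix q q' r
    assume q: "q \<in> chart_dom c" and q': "q' \<in> chart_dom c"
      and qb: "coord c q \<in> ball (coord c p) (e / 4)" and qb': "coord c q' \<in> ball (coord c p) (e / 4)"
      and r: "norm (coord c q - coord c q') < r" "r \<le> r0"
    obtain u where u: "range u \<subseteq> Y" "u \<longlonglongrightarrow> q"
      using ex_interior_sequence[OF c q] .
    obtain v where v: "range v \<subseteq> Y" "v \<longlonglongrightarrow> q'"
      using ex_interior_sequence[OF c q'] .
    obtain K where "\<forall>m\<ge>K. \<forall>n\<ge>K. dist_Y (u m) (v n) \<le> ennreal (C * r powr ?\<theta>)"
      using dist_eventually_small[OF c upper q half[OF qb] q' half[OF qb'] u v r] by blast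
    then show "boundary_dist Y dist_Y q q' \<le> ennreal (C * r powr ?\<theta>)"
      by (intro LIMSEQ_le_const2[OF lim[OF q qb q' qb' u v]]) blast
  next
    fix q q'
    assume q: "q \<in> chart_dom c" and q': "q' \<in> chart_dom c" and 0: "\<rho> i q = 0"
      and qb: "coord c q \<in> ball (coord c p) (e / 4)" and qb': "coord c q' \<in> ball (coord c p) (e / 4)"
    let ?l = "norm (coord c q - coord c q')" and ?b = "boundary_dist Y dist_Y q q'"
    show "ennreal (k * ?l powr ?\<theta>) \<le> ?b"
    proof (cases "coord c q = coord c q'")
      case True
      then show ?thesis by simp
    next
      case False
      obtain u where u: "range u \<subseteq> Y" "u \<longlonglongrightarrow> q"
        using ex_interior_sequence[OF c q] .
      obtain v where v: "range v \<subseteq> Y" "v \<longlonglongrightarrow> q'"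
        using ex_interior_sequence[OF c q'] .
      have vX: "range v \<subseteq> X" using v Y_subset by blast
      show ?thesis
      \<comment> \<open>\<open>lower_limit\<close> takes an eventual upper bound of the distances,
        and every finite \<open>B\<close> above their limit is one.\<close>
      proof (rule dense_ge)
        fix B assume B: "?b < B"
        show "ennreal (k * ?l powr ?\<theta>) \<le> B"
        proof (cases B)
          case (real b)
          have "\<forall>\<^sub>F n in sequentially. dist_Y (u n) (v n) < B"
            by (rule order_tendstoD(2)[OF lim[OF q qb q' qb' u v] B])
          then have "\<forall>\<^sub>F n in sequentially. dist_Y (u n) (v n) \<le> ennreal b"
            using real by (auto elim!: eventually_mono intro: less_imp_le)
          then have "k * ?l powr (1 - \<alpha> i / 2) \<le> b"
            unfolding k_def
            by (rule lower_limit[OF c W gr i(1,2) q qb 0 q' qb' False u vX v(2) _ real(1)])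
          then show ?thesis
            using real i(3) by (simp add: ennreal_leI)
        qed simp
      qed
    qed
  qed
qed

text \<open>A chart in which the face is a slice links the comparison of distances with the count of
  dimension. The first estimate is confined to a neighbourhood; the second reaches all of
  \<open>F\<close>, because a cover of \<open>F\<close> restricts to the neighbourhood.\<close>

lemma face_local_estimates:
  assumes F: "p \<in> F" and sub: "submanifold_of_dim X A F m"
    and M: "0 \<le> M" "M < 2" "\<And>i q. i \<in> {1..N} \<Longrightarrow> q \<in> F \<Longrightarrow> \<rho> i q = 0 \<Longrightarrow> \<alpha> i \<le> M"
    and i: "i \<in> {1..N}" "\<And>q. q \<in> F \<Longrightarrow> \<rho> i q = 0" "\<alpha> i = M"
  obtains P where "openin (top_of_set X) P" "p \<in> P"
    and "\<And>s. real m / (1 - M / 2) < s \<Longrightarrow> small_covers (boundary_dist Y dist_Y) (F \<inter> P) s"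
    and "\<And>s. 0 \<le> s \<Longrightarrow> s < real m / (1 - M / 2) \<Longrightarrow> \<not> small_covers (boundary_dist Y dist_Y) F s"
proof -
  obtain c J W where c: "c \<in> A" and J: "J \<subseteq> Basis" "card J + m = DIM('e)"
    and W: "openin (top_of_set X) W" "p \<in> W" "W \<subseteq> chart_dom c"
    and FW: "F \<inter> W = {q\<in>W. \<forall>b\<in>J. coord c q \<bullet> b = coord c p \<bullet> b}"
    using sub[unfolded submanifold_of_dim_def, THEN conjunct2, rule_format, OF F]
    by (elim bexE exE conjE)
  obtain e where gr: "good_radius c W p e"
    using ex_good_radius[OF c W(1,3,2)] .
  then have e: "0 < e" "e < 1" and nW: "near c p e \<subseteq> coord c ` W"
    by (auto simp: good_radius_def)
  have p: "p \<in> chart_dom c" using W by blast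
  obtain C r0 k where C: "0 \<le> C" "0 < r0" "0 < k"
    and up: "\<forall>q q' r. q \<in> chart_dom c \<longrightarrow> q' \<in> chart_dom c \<longrightarrow>
      coord c q \<in> ball (coord c p) (e / 4) \<longrightarrow> coord c q' \<in> ball (coord c p) (e / 4) \<longrightarrow>
      norm (coord c q - coord c q') < r \<longrightarrow> r \<le> r0 \<longrightarrow>
      boundary_dist Y dist_Y q q' \<le> ennreal (C * r powr (1 - M / 2))"
    and lo: "\<forall>q q'. q \<in> chart_dom c \<longrightarrow> q' \<in> chart_dom c \<longrightarrow> \<rho> i q = 0 \<longrightarrow>
      coord c q \<in> ball (coord c p) (e / 4) \<longrightarrow> coord c q' \<in> ball (coord c p) (e / 4) \<longrightarrow>
      ennreal (k * norm (coord c q - coord c q') powr (1 - M / 2)) \<le> boundary_dist Y dist_Y q q'"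
    using boundary_dist_comparison[OF c W(3) gr M(1,2) M(3)[OF _ F] i(1) i(2)[OF F] i(3)] .
  define V where "V = near c p (e / 4)"
  have V_sub: "V \<subseteq> coord c ` W"
    using nW e by (auto simp: V_def near_def)
  define P where "P = chart_inv c ` V"
  have in_P: "q \<in> P \<longleftrightarrow> q \<in> W \<and> coord c q \<in> ball (coord c p) (e / 4)" for q
  proof
    assume "q \<in> P"
    then obtain x where x: "x \<in> V" "q = chart_inv c x" by (auto simp: P_def)
    then obtain w where "w \<in> W" "x = coord c w" using V_sub by blast
    then show "q \<in> W \<and> coord c q \<in> ball (coord c p) (e / 4)"
      using x W(3) chart_inv_coord[OF c, of w] by (auto simp: V_def near_def)
  next
    assume q: "q \<in> W \<and> coord c q \<in> ball (coord c p) (e / 4)"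
    then have "coord c q \<in> V"
      using coord_image_subset[OF c] W(3) by (auto simp: V_def near_def)
    then show "q \<in> P"
      unfolding P_def using q W(3) chart_inv_coord[OF c, of q] by (metis imageI subsetD)
  qed
  have \<theta>: "0 < 1 - M / 2" using M by simp
  show ?thesis
  proof (rule that[of P])
    show "openin (top_of_set X) P"
      unfolding P_def
    proof (rule openin_chart_inv_image[OF c])
      show "openin (top_of_set (corner_model (walls c))) V"
        unfolding V_def near_def by (intro openin_Int_open) auto
      show "V \<subseteq> coord c ` chart_dom c"
        using V_sub W(3) by blast
    qed
    show "p \<in> P"
      using in_P W(2) e by simp
    fix s :: real
    show "small_covers (boundary_dist Y dist_Y) (F \<inter> P) s" if s: "real m / (1 - M / 2) < s"
    proof (rule small_covers_Hoelder[OF J, where x = "coord c" and a = "coord c p" and l = 1])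
      show "coord c q \<bullet> b = coord c p \<bullet> b" if "q \<in> F \<inter> P" "b \<in> J" for q b
        using that FW in_P by blast
      show "\<bar>coord c q \<bullet> b - coord c p \<bullet> b\<bar> < 1" if "q \<in> F \<inter> P" "b \<in> Basis" for q b
        using Basis_le_norm[OF that(2), of "coord c q - coord c p"] that(1) in_P[of q] e
        by (simp add: inner_diff_left dist_norm norm_minus_commute)
      show "boundary_dist Y dist_Y q q' \<le> ennreal (C * r powr (1 - M / 2))"
        if "q \<in> F \<inter> P" "q' \<in> F \<inter> P" "norm (coord c q - coord c q') < r" "r \<le> r0" for q q' r
        using that up in_P W(3) by (meson IntD2 subsetD)
    qed (use C \<theta> s in auto)
    show "\<not> small_covers (boundary_dist Y dist_Y) F s" if s: "0 \<le> s" "s < real m / (1 - M / 2)"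
    \<comment> \<open>By the coordinatewise bound, every point of a box with side
      \<open>e / (8 * DIM('e))\<close> is within \<open>e / 8\<close> of \<open>coord c p\<close>,
      hence inside the ball of radius \<open>e / 4\<close>.\<close>
    proof (rule not_small_covers_Hoelder[OF J, where x = "coord c" and a = "coord c p" and S = "F \<inter> P"
          and l = "e / (8 * DIM('e))" and c = k])
      fix y assume y: "\<forall>b\<in>J. y \<bullet> b = coord c p \<bullet> b"
        "\<forall>b\<in>Basis - J. coord c p \<bullet> b \<le> y \<bullet> b \<and> y \<bullet> b \<le> coord c p \<bullet> b + e / (8 * DIM('e))"
      have le: "coord c p \<bullet> b \<le> y \<bullet> b \<and> y \<bullet> b \<le> coord c p \<bullet> b + e / (8 * DIM('e))" if "b \<in> Basis" for b
        using y that e by (cases "b \<in> J") auto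
      have "norm (y - coord c p) \<le> DIM('e) * (e / (8 * DIM('e)))"
      proof (rule norm_le_DIM_bound)
        fix b :: 'e assume "b \<in> Basis"
        then show "\<bar>(y - coord c p) \<bullet> b\<bar> \<le> e / (8 * DIM('e))"
          using le[of b] unfolding inner_diff_left by linarith
      qed
      also have "\<dots> < e / 4" using e by simp
      finally have yb: "y \<in> ball (coord c p) (e / 4)"
        by (simp add: dist_norm norm_minus_commute)
      \<comment> \<open>The box extends from \<open>coord c p\<close> in the positive directions
        only, so no wall is crossed, even where a free direction is a wall direction.\<close>
      have "y \<in> corner_model (walls c)"
        using coord_image_subset[OF c] p le walls_Basis[OF c] unfolding corner_model_def
        by (smt (verit) image_subset_iff mem_Collect_eq subsetD)
      then have "y \<in> V" using yb by (simp add: V_def near_def)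
      then obtain q where q: "q \<in> W" "y = coord c q" using V_sub by blast
      then have "q \<in> F \<inter> P"
        using FW in_P[of q] yb y(1) by blast
      then show "y \<in> coord c ` (F \<inter> P)"
        using q by blast
    next
      show "ennreal (k * norm (coord c q - coord c q') powr (1 - M / 2)) \<le> boundary_dist Y dist_Y q q'"
        if "q \<in> F \<inter> P" "q' \<in> F \<inter> P" for q q'
        using that lo in_P W(3) i(2) by (meson IntD1 IntD2 subsetD)
    qed (use C \<theta> s e in auto)
  qed
qed

text \<open>Compactness of \<open>X\<close> leaves finitely many charts, and inside each chart the
  Lindeloef property of Euclidean space selects a countable subfamily.\<close>

lemma countable_subcover:
  assumes X: "compact X" and "F \<subseteq> X"
    and P: "\<And>p. p \<in> F \<Longrightarrow> openin (top_of_set X) (P p)" "\<And>p. p \<in> F \<Longrightarrow> p \<in> P p"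
  obtains D where "D \<subseteq> F" "countable D" "F \<subseteq> (\<Union>p\<in>D. P p)"
proof -
  have "\<exists>G. open G \<and> chart_dom c = X \<inter> G" if "c \<in> A" for c
    using openin_dom[OF that] by (auto simp: openin_open)
  then obtain G where G: "\<And>c. c \<in> A \<Longrightarrow> open (G c)" "\<And>c. c \<in> A \<Longrightarrow> chart_dom c = X \<inter> G c"
    by metis
  have "X \<subseteq> (\<Union>c\<in>A. G c)"
    using dom_Union G(2) by blast
  then obtain A0 where A0: "A0 \<subseteq> A" "finite A0" "X \<subseteq> (\<Union>c\<in>A0. G c)"
    using compactE_image[OF X, of A G] G(1) by metis
  have "\<exists>D. D \<subseteq> F \<and> countable D \<and> F \<inter> chart_dom c \<subseteq> (\<Union>p\<in>D. P p)" if c: "c \<in> A" for c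
  proof -
    let ?f = "\<lambda>p. coord c ` (P p \<inter> chart_dom c)"
    have op: "openin (top_of_set (coord c ` chart_dom c)) T" if T: "T \<in> ?f ` F" for T
    proof -
      obtain p where p: "p \<in> F" "T = ?f p" using T by blast
      have "openin (top_of_set (chart_dom c)) (P p \<inter> chart_dom c)"
        using openin_subtopology_Int2[OF P(1)[OF p(1)], of "chart_dom c"] dom_subset[OF c]
        by (simp add: subtopology_subtopology Int_absorb1 Int_commute)
      then show ?thesis
        unfolding p(2) by (rule homeomorphism_imp_open_map[OF homeomorphism_coord[OF c]])
    qed
    obtain \<F>' where \<F>': "\<F>' \<subseteq> ?f ` F" "countable \<F>'" "\<Union>\<F>' = \<Union>(?f ` F)"
      using Lindelof_openin[of "?f ` F", OF op] by blast
    then obtain D where D: "countable D" "D \<subseteq> F" "\<F>' = ?f ` D"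
      by (meson countable_subset_image)
    have "q \<in> (\<Union>p\<in>D. P p)" if q: "q \<in> F \<inter> chart_dom c" for q
    proof -
      have "coord c q \<in> ?f q"
        using q P(2) by blast
      then have "coord c q \<in> \<Union>(?f ` F)"
        using q by blast
      then have "coord c q \<in> \<Union>(?f ` D)"
        unfolding \<F>'(3)[symmetric] D(3) .
      then obtain p w where w: "p \<in> D" "w \<in> P p" "w \<in> chart_dom c" "coord c q = coord c w"
        by blast
      then have "q = w"
        using chart_inv_coord[OF c] q by (metis IntD2)
      then show ?thesis using w by blast
    qed
    then show ?thesis using D by blast
  qed
  then obtain D where D: "\<And>c. c \<in> A \<Longrightarrow> D c \<subseteq> F \<and> countable (D c) \<and> F \<inter> chart_dom c \<subseteq> (\<Union>p\<in>D c. P p)"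
    by metis
  show ?thesis
  proof (rule that[of "\<Union>c\<in>A0. D c"])
    show "(\<Union>c\<in>A0. D c) \<subseteq> F"
      using D A0 by blast
    show "countable (\<Union>c\<in>A0. D c)"
      using D A0 by (intro countable_UN[OF countable_finite[OF A0(2)]]) blast
    show "F \<subseteq> (\<Union>p\<in>\<Union>c\<in>A0. D c. P p)"
    proof
      fix q assume q: "q \<in> F"
      then obtain c where c: "c \<in> A0" "q \<in> G c"
        using A0(3) \<open>F \<subseteq> X\<close> by blast
      then have "q \<in> chart_dom c"
        using G(2) A0(1) q \<open>F \<subseteq> X\<close> by blast
      then show "q \<in> (\<Union>p\<in>\<Union>c\<in>A0. D c. P p)"
        using D[of c] c A0(1) q by blast
    qed
  qed
qed

end

theorem corollary6p13:
  fixes X :: "'a::t2_space set"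
    and A :: "('a, 'e::euclidean_space) corner_chart set"
    and N :: nat
    and H :: "nat \<Rightarrow> 'a set"
    and \<rho> :: "nat \<Rightarrow> 'a \<Rightarrow> real"
    and \<alpha> :: "nat \<Rightarrow> real"
    and g0 :: "('a, 'e) metric_family"
    and I :: "nat set"
    and m :: nat
  defines "Y \<equiv> mf_interior X A"
    and "d \<equiv> riemannian_dist (mf_interior X A) A (sum_metric N \<rho> \<alpha> g0)"
    and "F \<equiv> open_face X N H I"
    and "M \<equiv> Max (\<alpha> ` I)"
  assumes manifold: "compact_corner_manifold X A"
    and hypersurfaces: "bij_betw H {1..N} (boundary_hypersurfaces X A)"
    and embedded: "\<And>i. i \<in> {1..N} \<Longrightarrow> embedded_hypersurface X A (H i)"
    and bdf: "\<And>i. i \<in> {1..N} \<Longrightarrow> boundary_defining_function X A (H i) (\<rho> i)"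
    and metric: "riemannian_metric A g0"
    and weights: "\<And>i. i \<in> {1..N} \<Longrightarrow> 0 \<le> \<alpha> i"
    and index: "I \<subseteq> {1..N}" "I \<noteq> {}"
    and nonempty: "F \<noteq> {}"
    and dimension: "submanifold_of_dim X A F m"
    and accessible: "\<And>p. p \<in> F \<Longrightarrow> p \<in> mf_boundary X A \<and> accessible_point Y d p"
  shows "hausdorff_dim (boundary_dist Y d) F = ennreal (real m / (1 - M / 2))"
proof -
  interpret conformal_corner X A N H \<rho> \<alpha> g0
    by unfold_locales (use manifold bdf metric weights in \<open>auto simp: compact_corner_manifold_def\<close>)
  have FX: "F \<subseteq> X"
    by (auto simp: F_def open_face_def)
  have rho_0: "\<rho> i p = 0 \<longleftrightarrow> i \<in> I" if "p \<in> F" "i \<in> {1..N}" for p i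
    using that H_iff[OF that(2), of p] by (auto simp: F_def open_face_def)
  have "finite I"
    using index(1) finite_subset by blast
  then have "M \<in> \<alpha> ` I"
    unfolding M_def using index(2) by (intro Max_in) auto
  then obtain i where i: "i \<in> I" "\<alpha> i = M"
    by blast
  have iN: "i \<in> {1..N}" using i index by blast
  have M_ge: "\<alpha> j \<le> M" if "j \<in> I" for j
    using that \<open>finite I\<close> by (simp add: M_def)
  have "0 \<le> M"
    using i weights[OF iN] by simp
  obtain p0 where p0: "p0 \<in> F" using nonempty by blast
  \<comment> \<open>One accessible point is enough: \<open>M\<close> is attained at an index
    \<open>i\<close> in \<open>I\<close>, and \<open>\<rho> i\<close> vanishes at
    \<open>p0\<close>.\<close>
  have "M < 2"
    using accessible_weight[of p0 i] accessible[OF p0] p0 FX iN rho_0[OF p0 iN] i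
    unfolding Y_def d_def by auto
  have loc: "\<exists>P. openin (top_of_set X) P \<and> p \<in> P \<and>
      (\<forall>s. real m / (1 - M / 2) < s \<longrightarrow> small_covers (boundary_dist Y d) (F \<inter> P) s) \<and>
      (\<forall>s. 0 \<le> s \<longrightarrow> s < real m / (1 - M / 2) \<longrightarrow> \<not> small_covers (boundary_dist Y d) F s)"
    if p: "p \<in> F" for p
    unfolding Y_def d_def
  proof (rule face_local_estimates[OF p dimension \<open>0 \<le> M\<close> \<open>M < 2\<close> _ iN _ i(2)])
    show "\<And>j q. j \<in> {1..N} \<Longrightarrow> q \<in> F \<Longrightarrow> \<rho> j q = 0 \<Longrightarrow> \<alpha> j \<le> M"
      using rho_0 M_ge by blast
    show "\<And>q. q \<in> F \<Longrightarrow> \<rho> i q = 0"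
      using rho_0 iN i(1) by blast
  qed blast
  then obtain P where P: "\<And>p. p \<in> F \<Longrightarrow> openin (top_of_set X) (P p)" "\<And>p. p \<in> F \<Longrightarrow> p \<in> P p"
    "\<And>p s. p \<in> F \<Longrightarrow> real m / (1 - M / 2) < s \<Longrightarrow> small_covers (boundary_dist Y d) (F \<inter> P p) s"
    by metis
  show ?thesis
  proof (rule hausdorff_dim_eqI)
    show "0 \<le> real m / (1 - M / 2)"
      using \<open>M < 2\<close> by simp
    fix s :: real
    show "small_covers (boundary_dist Y d) F s" if s: "real m / (1 - M / 2) < s"
    proof -
      obtain D where D: "D \<subseteq> F" "countable D" "F \<subseteq> (\<Union>p\<in>D. P p)"
        using countable_subcover[OF _ FX P(1,2)] manifold by (auto simp: compact_corner_manifold_def)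
      have "D \<noteq> {}" using D(3) p0 by auto
      \<comment> \<open>The nonempty countable set \<open>D\<close> is enumerated, possibly with
        repetitions, to match the sequence form of \<open>small_covers_UN\<close>.\<close>
      have "F = (\<Union>n. F \<inter> P (from_nat_into D n))"
      proof -
        have "(\<Union>n. P (from_nat_into D n)) = (\<Union>p\<in>D. P p)"
          using range_from_nat_into[OF \<open>D \<noteq> {}\<close> D(2)] by (metis image_image)
        then have "F \<subseteq> (\<Union>n. P (from_nat_into D n))"
          using D(3) by simp
        then show ?thesis
          by (simp add: Int_absorb2 flip: Int_UN_distrib)
      qed
      moreover have "small_covers (boundary_dist Y d) (\<Union>n. F \<inter> P (from_nat_into D n)) s"
        using D(1) from_nat_into[OF \<open>D \<noteq> {}\<close>] by (intro small_covers_UN P(3) s) blast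
      ultimately show ?thesis by simp
    qed
    show "\<not> small_covers (boundary_dist Y d) F s" if "0 \<le> s" "s < real m / (1 - M / 2)"
      using loc[OF p0] that by blast
  qed
qed

end
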